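(* 1. Let $G\in\mathcal G$. Then $\sharp(\hat{\mathcal J}_G)\le\sharp(\mathcal M_{\Psi(G)})$. More precisely, there exists an injective map $\tilde\Psi:\hat{\mathcal J}_G\to\mathcal M_{\Psi(G)}$ such that if $J_1,J_2\in\mathcal J_G$ and $J_1<J_2$, then $\tilde\Psi(J_1)<_r\tilde\Psi(J_2)$. 2. If $G\in\mathcal G_{dis}$, then $M(\Psi(G))\subset\mathbb R$ and $M(\Psi(G))=J(\eta(\Psi(G)))$. 3. Let $G\in\mathcal G$. Then $\sharp(\hat{\mathcal J}_G)\le\sharp(\hat{\mathcal J}_{\eta(\Psi(G))})$.
   Context: $\hat{\mathbb C}$ is the Riemann sphere. A polynomial semigroup is a semigroup (under composition) generated by a family of non-constant polynomial maps on $\hat{\mathbb C}$ (degree one allowed). The Fatou set $F(G)$ is the set of $z\in\hat{\mathbb C}$ having a neighborhood on which $G$ is a normal family; the Julia set is $J(G)=\hat{\mathbb C}\setminus F(G)$. $P(G)=\overline{\bigcup_{g\in G}\{\text{critical values of } g:\hat{\mathbb C}\to\hat{\mathbb C}\}}$ and $P^{*}(G)=P(G)\setminus\{\infty\}$. $\mathcal G$ is the set of polynomial semigroups $G$ all of whose elements have degree at least two and for which $P^{*}(G)$ is bounded in $\mathbb C$; $\mathcal G_{dis}=\{G\in\mathcal G: J(G)\text{ is disconnected}\}$. For a polynomial semigroup $G$, $\hat{\mathcal J}_G$ is the set of all connected components of $J(G)$ and $\mathcal J_G$ the set of those contained in $\mathbb C$. For connected $K_1,K_2\subset\mathbb C$,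 $K_1<K_2$ means $K_1\neq K_2$ and $K_1$ is contained in a bounded component of $\mathbb C\setminus K_2$. A real affine semigroup is a set of maps $x\mapsto ax+b$ ($a,b\in\mathbb R$, $a\ne0$) closed under composition. For a polynomial $g$ with leading coefficient $a(g)$, put $\Psi(g)(x)=\deg(g)\,x+\log|a(g)|$; $\Psi$ is a semigroup homomorphism, and $\Psi(G)=\{\Psi(g): g\in G\}$ is a real affine semigroup. Let $\eta$ send the real map $x\mapsto ax+b$ to the polynomial $z\mapsto az+b$ on $\hat{\mathbb C}$; $\eta(\Psi(G))$ is a polynomial semigroup. $\hat{\mathbb R}=\mathbb R\cup\{\pm\infty\}$ with the usual two-point compactification topology. For a real affine semigroup $H$, $M(H)$ is the closure in $\hat{\mathbb R}$ of $\{x\in\mathbb R:\exists h\in H,\ h(x)=x,\ |h'(x)|>1\}$, and $\mathcal M_H$ is the set of connected components of $M(H)$. For connected $M_1,M_2\subset\hat{\mathbb R}$, $M_1<_rM_2$ means $M_1\ne M_2$ and $x<y$ for all $(x,y)\in M_1\times M_2$. $\sharp$ denotes cardinality. *)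

theory Defs
  imports "HOL-Analysis.Analysis" "HOL-Computational_Algebra.Polynomial"
begin

section \<open>The Riemann sphere\<close>

datatype riemann_sphere = Fin complex | Infty

fun stereographic :: "riemann_sphere \<Rightarrow> complex \<times> real" where
  "stereographic (Fin z) =
     ((2 / ((cmod z)\<^sup>2 + 1)) *\<^sub>R z, ((cmod z)\<^sup>2 - 1) / ((cmod z)\<^sup>2 + 1))"
| "stereographic Infty = (0, 1)"

lemma inj_stereographic: "inj stereographic"
proof (rule injI)
  have pos: "(cmod z)\<^sup>2 + 1 > 0" for z
    by (simp add: add_nonneg_pos)
  have height: "((cmod z)\<^sup>2 - 1) / ((cmod z)\<^sup>2 + 1) = 1 - 2 / ((cmod z)\<^sup>2 + 1)" for z
    using pos[of z] by (simp add: field_simps)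
  fix x y assume eq: "stereographic x = stereographic y"
  show "x = y"
  proof (cases x; cases y)
    fix z w assume xy: "x = Fin z" "y = Fin w"
    have "2 / ((cmod z)\<^sup>2 + 1) = 2 / ((cmod w)\<^sup>2 + 1)"
      using eq unfolding xy by (simp add: height)
    moreover have "(2 / ((cmod z)\<^sup>2 + 1)) *\<^sub>R z = (2 / ((cmod w)\<^sup>2 + 1)) *\<^sub>R w"
      using eq unfolding xy by simp
    moreover have "2 / ((cmod w)\<^sup>2 + 1) \<noteq> 0"
      using pos[of w] by simp
    ultimately have "z = w"
      by (metis real_vector.scale_left_imp_eq)
    then show ?thesis using xy by simp
  next
    fix z assume xy: "x = Fin z" "y = Infty"
    show ?thesis using eq pos[of z] unfolding xy by (simp add: height)
  next
    fix z assume xy: "x = Infty" "y = Fin z"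
    show ?thesis using eq pos[of z] unfolding xy by (simp add: height)
  qed simp
qed

text \<open>The metric is the chordal metric; it induces the one-point compactification topology.\<close>

instantiation riemann_sphere :: metric_space
begin

definition dist_riemann_sphere :: "riemann_sphere \<Rightarrow> riemann_sphere \<Rightarrow> real" where
  "dist_riemann_sphere x y = dist (stereographic x) (stereographic y)"

definition uniformity_riemann_sphere :: "(riemann_sphere \<times> riemann_sphere) filter" where
  "uniformity_riemann_sphere = (INF e\<in>{0<..}. principal {(x, y). dist x y < e})"

definition open_riemann_sphere :: "riemann_sphere set \<Rightarrow> bool" where
  "open_riemann_sphere U \<longleftrightarrow> (\<forall>x\<in>U. \<forall>\<^sub>F (x', y) in uniformity. x' = x \<longrightarrow> y \<in> U)"

instance
proof
  fix x y z :: riemann_sphere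
  show "dist x y = 0 \<longleftrightarrow> x = y"
    using inj_stereographic by (auto simp: dist_riemann_sphere_def inj_eq)
  show "dist x y \<le> dist x z + dist y z"
    unfolding dist_riemann_sphere_def by (rule dist_triangle2)
qed (simp_all only: uniformity_riemann_sphere_def open_riemann_sphere_def)

end

section \<open>Polynomial semigroups\<close>

text \<open>
  A polynomial map of the sphere is represented by its polynomial, which it determines
  uniquely; composition of maps is then \<^const>\<open>pcompose\<close>.
\<close>

text \<open>Since \<open>\<infinity>\<close> is sent to \<open>\<infinity>\<close>, this is the intended map only for non-constant polynomials.\<close>

fun sphere_map :: "complex poly \<Rightarrow> riemann_sphere \<Rightarrow> riemann_sphere" where
  "sphere_map p (Fin z) = Fin (poly p z)"
| "sphere_map p Infty = Infty"

inductive_set generated_semigroup :: "complex poly set \<Rightarrow> complex poly set"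
  for S :: "complex poly set" where
  generator: "p \<in> S \<Longrightarrow> p \<in> generated_semigroup S"
| compose: "p \<in> generated_semigroup S \<Longrightarrow> q \<in> generated_semigroup S
    \<Longrightarrow> pcompose p q \<in> generated_semigroup S"

definition polynomial_semigroup :: "complex poly set \<Rightarrow> bool" where
  "polynomial_semigroup G \<longleftrightarrow>
     (\<exists>S. (\<forall>p\<in>S. degree p \<ge> 1) \<and> G = generated_semigroup S)"

definition normal_family_on ::
  "riemann_sphere set \<Rightarrow> (riemann_sphere \<Rightarrow> riemann_sphere) set \<Rightarrow> bool" where
  "normal_family_on U \<F> \<longleftrightarrow>
     (\<forall>f :: nat \<Rightarrow> riemann_sphere \<Rightarrow> riemann_sphere. range f \<subseteq> \<F> \<longrightarrow>
        (\<exists>r l. strict_mono r \<and>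
           (\<forall>K. compact K \<and> K \<subseteq> U \<longrightarrow> uniform_limit K (\<lambda>n. f (r n)) l sequentially)))"

definition fatou_set :: "complex poly set \<Rightarrow> riemann_sphere set" where
  "fatou_set G = {z. \<exists>U. open U \<and> z \<in> U \<and> normal_family_on U (sphere_map ` G)}"

definition julia_set :: "complex poly set \<Rightarrow> riemann_sphere set" where
  "julia_set G = - fatou_set G"

text \<open>At \<open>\<infinity>\<close> the derivative is taken in the chart \<open>w = 1 / z\<close>.\<close>

fun critical_point :: "complex poly \<Rightarrow> riemann_sphere \<Rightarrow> bool" where
  "critical_point p (Fin z) \<longleftrightarrow> poly (pderiv p) z = 0"
| "critical_point p Infty \<longleftrightarrow>
     ((\<lambda>w. if w = 0 then 0 else 1 / poly p (1 / w)) has_field_derivative 0) (at 0)"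

definition critical_values :: "complex poly \<Rightarrow> riemann_sphere set" where
  "critical_values p = sphere_map p ` {x. critical_point p x}"

definition postcritical_set :: "complex poly set \<Rightarrow> riemann_sphere set" where
  "postcritical_set G = closure (\<Union>g\<in>G. critical_values g)"

definition planar_postcritical_set :: "complex poly set \<Rightarrow> riemann_sphere set" where
  "planar_postcritical_set G = postcritical_set G - {Infty}"

definition postcritically_bounded_semigroups :: "complex poly set set" ("\<G>") where
  "\<G> = {G. polynomial_semigroup G \<and> (\<forall>g\<in>G. degree g \<ge> 2) \<and>
            bounded (Fin -` planar_postcritical_set G)}"

definition disconnected_semigroups :: "complex poly set set" ("\<G>\<^sub>d\<^sub>i\<^sub>s") where
  "\<G>\<^sub>d\<^sub>i\<^sub>s = {G \<in> \<G>. \<not> connected (julia_set G)}"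

definition planar_julia_components :: "complex poly set \<Rightarrow> riemann_sphere set set" where
  "planar_julia_components G = {K \<in> components (julia_set G). Infty \<notin> K}"

definition surrounded_by :: "complex set \<Rightarrow> complex set \<Rightarrow> bool" where
  "surrounded_by K1 K2 \<longleftrightarrow>
     K1 \<noteq> K2 \<and> (\<exists>U \<in> components (- K2). bounded U \<and> K1 \<subseteq> U)"

section \<open>Real affine semigroups\<close>

definition Psi :: "complex poly \<Rightarrow> real \<Rightarrow> real" where
  "Psi g = (\<lambda>x. real (degree g) * x + ln (cmod (lead_coeff g)))"

text \<open>The coefficients of an affine map \<open>h\<close> are recovered from its values at \<open>0\<close> and \<open>1\<close>.\<close>

definition eta :: "(real \<Rightarrow> real) \<Rightarrow> complex poly" where
  "eta h = [:complex_of_real (h 0), complex_of_real (h 1 - h 0):]"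

lemma eta_affine: "eta (\<lambda>x. a * x + b) = [:complex_of_real b, complex_of_real a:]"
  by (simp add: eta_def)

definition repelling_closure :: "(real \<Rightarrow> real) set \<Rightarrow> ereal set" where
  "repelling_closure H =
     closure (ereal ` {x. \<exists>h\<in>H. h x = x \<and> \<bar>deriv h x\<bar> > 1})"

definition less_r :: "ereal set \<Rightarrow> ereal set \<Rightarrow> bool" where
  "less_r M1 M2 \<longleftrightarrow> M1 \<noteq> M2 \<and> (\<forall>x\<in>M1. \<forall>y\<in>M2. x < y)"

end

theory Submission
  imports Defs "HOL-Complex_Analysis.Complex_Analysis"
    "HOL-Computational_Algebra.Fundamental_Theorem_Algebra"
begin

text \<open>
  For a polynomial \<open>g\<close> the repelling fixed point of \<^term>\<open>Psi g\<close> is the logarithm of the capacity of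
  the filled Julia set of \<open>g\<close>. Postcritical boundedness makes all filled Julia sets
  \<open>K(g)\<close>, \<open>g \<in> G\<close>, full continua containing a common point, so two of them with disjoint boundaries are
  nested. If moreover the boundaries are at distance at least \<open>\<delta>\<close>, then a dilation of the inner one still
  fits into the outer one, which yields a definite gap between the logarithmic capacities. Hence a
  splitting of \<open>J(G)\<close> into disjoint closed sets splits \<open>M(\<Psi>(G))\<close> into disjoint closed sets, and since
  \<open>J(G)\<close> is the closure of the union of the boundaries \<open>\<partial>K(g)\<close>, each component of \<open>J(G)\<close> picks out a component
  of \<open>M(\<Psi>(G))\<close>. If the set of capacities is unbounded, then \<open>M(\<Psi>(G))\<close> is an interval, so it is bounded
  whenever \<open>J(G)\<close> is disconnected.

  All facts about capacity are obtained without potential theory: monotonicity from the symmetry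
  of the resultant of iterates, and the bound of the diameter by the capacity from Lagrange
  interpolation.
\<close>

section \<open>Iteration of polynomials\<close>

text \<open>Nesting alone does not suffice: on the two sides of a splitting of J(G) the capacities
  could accumulate at a common value although the filled Julia sets are strictly nested. Hence the
  quantitative gap, which excludes common finite values. At the two ends of the extended line the
  capacity itself locates the boundaries: they accumulate at \<infinity>, or they shrink to the
  common point, and neither point can lie on both sides.

  That J(G) is the closure of the boundaries is not formal. Normality off the closure needs values
  omitted on a domain by all elements at once, but only the domain itself is known to avoid the
  boundaries, not its images. Bounds for capacities under composition, together with a theorem of
  Schottky type, transfer the avoidance to the images.

  The interval statement and the description of J(\<eta>(\<Psi>(G))) have one source: the real
  points of M(\<Psi>(G)) are mapped into themselves by the inverse of every \<Psi>(g). The third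
  claim is immediate for connected J(G) and otherwise combines the first two.\<close>

definition filled_julia :: "complex poly \<Rightarrow> complex set" where
  "filled_julia p = {z. bounded (range (\<lambda>n. (poly p ^^ n) z))}"

text \<open>The logarithmic capacity of \<^term>\<open>filled_julia p\<close> is \<open>-log |a| / (deg p - 1)\<close> with \<open>a\<close> the leading coefficient.\<close>

definition log_cap :: "complex poly \<Rightarrow> real" where
  "log_cap p = - ln (cmod (lead_coeff p)) / (real (degree p) - 1)"

primrec iter_poly :: "complex poly \<Rightarrow> nat \<Rightarrow> complex poly" where
  "iter_poly p 0 = [:0, 1:]"
| "iter_poly p (Suc n) = pcompose p (iter_poly p n)"

lemma poly_iter_poly: "poly (iter_poly p n) = poly p ^^ n"
  by (induction n) (auto simp: poly_pcompose fun_eq_iff)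

lemma degree_iter_poly: "degree (iter_poly p n) = degree p ^ n"
  by (induction n) (auto simp: degree_pcompose)

section \<open>The affine maps \<open>Psi\<close> and their fixed points\<close>

lemma Psi_pcompose:
  assumes "degree p \<ge> 1" "degree q \<ge> 1"
  shows "Psi (pcompose p q) = Psi p \<circ> Psi q"
proof -
  have "lead_coeff p \<noteq> 0" "lead_coeff q \<noteq> 0"
    using assms by auto
  then show ?thesis
    using assms by (auto simp: Psi_def fun_eq_iff lead_coeff_comp norm_mult norm_power
        ln_mult ln_realpow algebra_simps simp del: degree_pcompose) (simp add: degree_pcompose)
qed

text \<open>Written as an expansion about its fixed point, the affine map iterates by taking powers
  of the degree, and \<open>log_cap\<close> becomes visible as the point that
  \<open>repelling_closure\<close> collects.\<close>

lemma Psi_eq_log_cap: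
  assumes "degree p \<ge> 2"
  shows "Psi p x = log_cap p + real (degree p) * (x - log_cap p)"
proof -
  define d where "d = real (degree p)"
  define l where "l = ln (cmod (lead_coeff p))"
  have "d - 1 \<noteq> 0" using assms by (simp add: d_def)
  then have "d * x + l = - l / (d - 1) + d * (x - - l / (d - 1))"
    by (simp add: divide_simps) (simp add: algebra_simps)
  then show ?thesis by (simp add: Psi_def log_cap_def d_def l_def)
qed

lemma Psi_fixed_iff:
  assumes "degree p \<ge> 2"
  shows "Psi p x = x \<longleftrightarrow> x = log_cap p"
proof -
  have "Psi p x = x \<longleftrightarrow> (real (degree p) - 1) * (x - log_cap p) = 0"
    unfolding Psi_eq_log_cap[OF assms] by (simp add: algebra_simps)
  then show ?thesis using assms by auto
qed

lemma deriv_Psi: "deriv (Psi p) x = real (degree p)"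
  unfolding Psi_def by (rule DERIV_imp_deriv) (auto intro!: derivative_eq_intros)

lemma Psi_iter_poly:
  assumes "degree p \<ge> 2"
  shows "Psi (iter_poly p n) x = log_cap p + real (degree p) ^ n * (x - log_cap p)"
proof (induction n)
  case 0
  show ?case by (simp add: Psi_def)
next
  case (Suc n)
  have "degree (iter_poly p n) \<ge> 1" using assms by (simp add: degree_iter_poly)
  then have "Psi (iter_poly p (Suc n)) x = Psi p (Psi (iter_poly p n) x)"
    using assms by (simp add: Psi_pcompose)
  also have "\<dots> = log_cap p + real (degree p) ^ Suc n * (x - log_cap p)"
    unfolding Psi_eq_log_cap[OF assms] Suc by simp
  finally show ?case .
qed

lemma ln_lead_coeff_iter_poly:
  assumes "degree p \<ge> 2"
  shows "ln (cmod (lead_coeff (iter_poly p n))) = - log_cap p * (real (degree p) ^ n - 1)"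
  using Psi_iter_poly[OF assms, of n 0] by (simp add: Psi_def algebra_simps)

section \<open>Escape to infinity and filled Julia sets\<close>

lemma escape_radius:
  fixes p :: "complex poly"
  assumes "degree p \<ge> 2"
  obtains R where "R > 0" "\<And>z. cmod z \<ge> R \<Longrightarrow> cmod (poly p z) \<ge> 2 * cmod z"
proof -
  obtain a q where p: "p = pCons a q" by (cases p)
  have dq: "degree q \<ge> 1" using assms p by (auto split: if_splits)
  obtain b s where q: "q = pCons b s" by (cases q)
  have "s \<noteq> 0" using dq q by auto
  \<comment> \<open>The factor 3 for \<open>q\<close> leaves 2 for \<open>p\<close>: as
    \<open>p\<close> is \<open>a + z * q\<close>, one copy of \<open>cmod z\<close> absorbs the
    constant term \<open>a\<close>.\<close>
  then obtain r where r: "\<And>z. r \<le> cmod z \<Longrightarrow> 3 \<le> cmod (poly q z)"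
    using poly_infinity[of s 3 b] q by auto
  show thesis
  proof
    show "max 1 (max r (cmod a)) > 0" by simp
    fix z assume z: "max 1 (max r (cmod a)) \<le> cmod z"
    have "3 * cmod z \<le> cmod (poly q z) * cmod z"
      using r[of z] z by (intro mult_right_mono) auto
    also have "\<dots> = cmod (z * poly q z)" by (simp add: norm_mult)
    also have "\<dots> \<le> cmod (poly p z) + cmod a"
      unfolding p using norm_triangle_ineq4[of "poly (pCons a q) z" a] by simp
    finally show "2 * cmod z \<le> cmod (poly p z)" using z by simp
  qed
qed

lemma escape_iterates:
  assumes R: "\<And>z. cmod z \<ge> R \<Longrightarrow> cmod (poly p z) \<ge> 2 * cmod z" and z: "cmod z \<ge> R"
  shows "cmod ((poly p ^^ n) z) \<ge> 2 ^ n * cmod z"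
proof (induction n)
  case (Suc n)
  have "cmod z \<le> 2 ^ n * cmod z"
    using mult_right_mono[of 1 "2^n::real" "cmod z"] by simp
  then have "R \<le> cmod ((poly p ^^ n) z)" using Suc z by linarith
  from R[OF this] Suc show ?case by simp
qed simp

text \<open>Once an orbit leaves the disc of radius \<open>R\<close>, its modulus at least doubles
  at every step. Hence a bounded orbit never leaves the disc, and an unbounded one even tends to
  infinity.\<close>

lemma filled_characterization:
  fixes p :: "complex poly"
  assumes "degree p \<ge> 2"
  obtains R where "R > 0" "filled_julia p = {z. \<forall>n. cmod ((poly p ^^ n) z) \<le> R}"
    "\<And>z. cmod z \<ge> R \<Longrightarrow> cmod (poly p z) \<ge> 2 * cmod z"
    "\<And>z. z \<notin> filled_julia p \<Longrightarrow> filterlim (\<lambda>n. (poly p ^^ n) z) at_infinity sequentially"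
proof -
  obtain R where R0: "R > 0" and R: "\<And>z. cmod z \<ge> R \<Longrightarrow> cmod (poly p z) \<ge> 2 * cmod z"
    using escape_radius[OF assms] by metis
  have esc: "filterlim (\<lambda>n. (poly p ^^ n) z) at_infinity sequentially"
    if "cmod ((poly p ^^ m) z) > R" for m z
  proof -
    \<comment> \<open>The growth estimate starts at the escape time \<open>m\<close>, so the limit
      is first proved for the shifted orbit.\<close>
    have "filterlim (\<lambda>n. (poly p ^^ (n + m)) z) at_infinity sequentially"
      unfolding filterlim_at_infinity_conv_norm_at_top
    proof (rule filterlim_at_top_mono)
      show "\<forall>\<^sub>F n in sequentially. 2 ^ n * R \<le> cmod ((poly p ^^ (n + m)) z)"
      proof (rule always_eventually, rule allI)
        fix n
        have "2 ^ n * R \<le> 2 ^ n * cmod ((poly p ^^ m) z)"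
          using that by simp
        also have "\<dots> \<le> cmod ((poly p ^^ n) ((poly p ^^ m) z))"
          using that by (intro escape_iterates[OF R]) auto
        finally show "2 ^ n * R \<le> cmod ((poly p ^^ (n + m)) z)"
          by (simp add: funpow_add)
      qed
      have "filterlim (\<lambda>n. (2::real) ^ n) at_top sequentially"
        by real_asymp
      then show "filterlim (\<lambda>n. 2 ^ n * R) at_top sequentially"
        using R0 by (intro filterlim_at_top_mult_tendsto_pos[OF tendsto_const]) auto
    qed
    then show ?thesis
      unfolding filterlim_iff
    proof (intro allI impI)
      fix P :: "complex \<Rightarrow> bool"
      assume "\<forall>P. eventually P at_infinity \<longrightarrow> (\<forall>\<^sub>F n in sequentially. P ((poly p ^^ (n + m)) z))"
        "eventually P at_infinity"
      then have "\<forall>\<^sub>F n in sequentially. P ((poly p ^^ (n + m)) z)" by blast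
      then show "\<forall>\<^sub>F n in sequentially. P ((poly p ^^ n) z)"
        by (rule eventually_sequentially_seg[THEN iffD1])
    qed
  qed
  have notb: "\<not> bounded (range (\<lambda>n. (poly p ^^ n) z))"
    if "filterlim (\<lambda>n. (poly p ^^ n) z) at_infinity sequentially" for z
  proof
    assume "bounded (range (\<lambda>n. (poly p ^^ n) z))"
    then obtain B where B: "\<And>n. cmod ((poly p ^^ n) z) \<le> B" unfolding bounded_iff by auto
    have "\<forall>\<^sub>F n in sequentially. cmod ((poly p ^^ n) z) \<ge> B + 1"
      using that unfolding filterlim_at_infinity_conv_norm_at_top filterlim_at_top by blast
    then have "\<exists>n. cmod ((poly p ^^ n) z) \<ge> B + 1" by (auto simp: eventually_sequentially)
    with B show False by (metis add_le_same_cancel1 not_one_le_zero order_trans)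
  qed
  have eq: "filled_julia p = {z. \<forall>n. cmod ((poly p ^^ n) z) \<le> R}"
  proof (intro set_eqI iffI)
    fix z assume "z \<in> filled_julia p"
    then show "z \<in> {z. \<forall>n. cmod ((poly p ^^ n) z) \<le> R}"
      using notb esc unfolding filled_julia_def by (auto simp: not_le[symmetric])
  qed (auto simp: filled_julia_def bounded_iff)
  show thesis
  proof
    show "filterlim (\<lambda>n. (poly p ^^ n) z) at_infinity sequentially" if "z \<notin> filled_julia p" for z
      using that esc eq by (auto simp: not_le)
  qed (use R0 R eq in auto)
qed

lemma continuous_on_iterates [continuous_intros]:
  "continuous_on S (\<lambda>z. (poly p ^^ n) (z :: complex))"
  unfolding poly_iter_poly[symmetric] by (intro continuous_intros)

lemma holomorphic_on_poly: "poly p holomorphic_on S"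
  by (auto intro!: holomorphic_intros)

lemma holomorphic_on_iterates: "(poly p ^^ n) holomorphic_on S"
  unfolding poly_iter_poly[symmetric] by (rule holomorphic_on_poly)

lemma compact_filled:
  assumes "degree p \<ge> 2"
  shows "compact (filled_julia p)"
proof -
  obtain R where R: "filled_julia p = {z. \<forall>n. cmod ((poly p ^^ n) z) \<le> R}"
    using filled_characterization[OF assms] by metis
  have "filled_julia p = (\<Inter>n. {z. cmod ((poly p ^^ n) z) \<le> R})" using R by auto
  moreover have "closed (\<Inter>n. {z. cmod ((poly p ^^ n) z) \<le> R})"
    by (intro closed_INT ballI closed_Collect_le continuous_intros)
  moreover have "bounded (filled_julia p)"
    unfolding bounded_iff R by (rule exI[of _ R]) (auto dest: spec[of _ 0])
  ultimately show ?thesis by (simp add: compact_eq_bounded_closed)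
qed

lemma filled_escape:
  assumes "degree p \<ge> 2" "z \<notin> filled_julia p"
  shows "filterlim (\<lambda>n. (poly p ^^ n) z) at_infinity sequentially"
  using filled_characterization[OF assms(1)] assms(2) by metis

lemma filled_bounded_orbits:
  assumes "degree p \<ge> 2"
  obtains R where "R > 0" "\<And>z n. z \<in> filled_julia p \<Longrightarrow> cmod ((poly p ^^ n) z) \<le> R"
  using filled_characterization[OF assms] by (metis (mono_tags, lifting) mem_Collect_eq)

lemma poly_in_filled_iff: "poly p z \<in> filled_julia p \<longleftrightarrow> z \<in> filled_julia p"
proof -
  have "range (\<lambda>n. (poly p ^^ n) z) = insert z (range (\<lambda>n. (poly p ^^ n) (poly p z)))"
  proof -
    have "(poly p ^^ n) z \<in> insert z (range (\<lambda>n. (poly p ^^ n) (poly p z)))" for n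
      by (cases n) (auto simp: funpow_swap1)
    moreover have "(poly p ^^ n) (poly p z) = (poly p ^^ Suc n) z" for n
      by (simp add: funpow_swap1)
    moreover have "z = (poly p ^^ 0) z" by simp
    ultimately show ?thesis by blast
  qed
  then show ?thesis unfolding filled_julia_def by simp
qed

lemma iterate_in_filled_iff: "(poly p ^^ n) z \<in> filled_julia p \<longleftrightarrow> z \<in> filled_julia p"
  by (induction n) (auto simp: poly_in_filled_iff)

text \<open>A fixed point has a bounded orbit, and the fixed points are the zeros of a nonconstant
  polynomial.\<close>

lemma filled_nonempty:
  assumes "degree p \<ge> 2"
  shows "filled_julia p \<noteq> {}"
proof -
  have "degree (p + - [:0, 1:]) = degree p"
    using assms by (intro degree_add_eq_left) simp
  then have "degree (p - [:0, 1:]) = degree p"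
    by (simp only: add_uminus_conv_diff)
  then have "\<not> constant (poly (p - [:0, 1:]))"
    using assms by (simp add: constant_degree)
  then obtain z where "poly p z = z"
    using fundamental_theorem_of_algebra[of "p - [:0, 1:]"] by auto
  then have "(poly p ^^ n) z = z" for n by (induction n) auto
  then have "z \<in> filled_julia p" unfolding filled_julia_def by simp
  then show ?thesis by blast
qed

lemma frontier_filled_subset:
  assumes "degree p \<ge> 2"
  shows "frontier (filled_julia p) \<subseteq> filled_julia p"
  using compact_filled[OF assms] by (simp add: compact_imp_closed frontier_subset_closed)

text \<open>On a bounded complementary component the maximum principle extends the bound for all
  iterates from the boundary to the inside, so the component would consist of bounded orbits. Thus
  every complementary component is unbounded, and a bounded planar set leaves only one of
  these.\<close>

lemma connected_Compl_filled:
  assumes "degree p \<ge> 2"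
  shows "connected (- filled_julia p)"
proof -
  obtain R where R0: "R > 0" and R: "\<And>z n. z \<in> filled_julia p \<Longrightarrow> cmod ((poly p ^^ n) z) \<le> R"
    using filled_bounded_orbits[OF assms] by metis
  have cl: "closed (filled_julia p)" "bounded (filled_julia p)"
    using compact_filled[OF assms] by (auto simp: compact_imp_closed compact_imp_bounded)
  have unb: "\<not> bounded C" if C: "C \<in> components (- filled_julia p)" for C
  proof
    assume b: "bounded C"
    have oC: "open C" using C cl by (meson open_Compl open_components)
    have fr: "frontier C \<subseteq> filled_julia p"
      using frontier_of_components_closed_complement[OF cl(1) C]
        frontier_filled_subset[OF assms] by blast
    have "C \<subseteq> filled_julia p"
    proof
      fix z assume z: "z \<in> C"
      have "cmod ((poly p ^^ n) z) \<le> R" for n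
      proof (rule maximum_modulus_frontier[of "poly p ^^ n" C])
        show "continuous_on (closure C) (poly p ^^ n)"
          using continuous_on_iterates[of "closure C" n p] by simp
      qed (use b z fr R in \<open>auto intro: holomorphic_on_iterates\<close>)
      then show "z \<in> filled_julia p" unfolding filled_julia_def bounded_iff by auto
    qed
    moreover have "C \<noteq> {}" "C \<subseteq> - filled_julia p"
      using C by (auto dest: in_components_nonempty in_components_subset)
    ultimately show False by blast
  qed
  have "C = D" if "C \<in> components (- filled_julia p)" "D \<in> components (- filled_julia p)" for C D
    using that unb cl(2) by (intro cobounded_unique_unbounded_components[of "- filled_julia p"]) auto
  then show ?thesis by (auto simp: connected_eq_connected_components_eq)
qed

section \<open>Logarithmic capacity of filled Julia sets\<close>

lemma poly_roots_product:
  fixes P :: "complex poly"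
  obtains r where "\<And>z. poly P z = lead_coeff P * (\<Prod>i<degree P. z - r i)"
    "\<And>i. i < degree P \<Longrightarrow> poly P (r i) = 0"
proof -
  obtain r where r: "smult (lead_coeff P) (\<Prod>i<degree P. [:- r i, 1:]) = P"
    using complex_poly_decompose' by blast
  have *: "poly P z = lead_coeff P * (\<Prod>i<degree P. z - r i)" for z
    by (subst r[symmetric]) (simp add: poly_prod)
  moreover have "poly P (r i) = 0" if "i < degree P" for i
    using that unfolding * by auto
  ultimately show thesis using that by blast
qed

text \<open>Both sides are the absolute value of the resultant of \<open>P\<close> and \<open>Q\<close>.\<close>

lemma resultant_symmetry:
  fixes P Q :: "complex poly"
  obtains r s where "\<And>i. i < degree P \<Longrightarrow> poly P (r i) = 0" "\<And>j. j < degree Q \<Longrightarrow> poly Q (s j) = 0"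
    "cmod (lead_coeff P) ^ degree Q * (\<Prod>i<degree P. cmod (poly Q (r i))) =
     cmod (lead_coeff Q) ^ degree P * (\<Prod>j<degree Q. cmod (poly P (s j)))"
proof -
  obtain r where r: "\<And>z. poly P z = lead_coeff P * (\<Prod>i<degree P. z - r i)"
    "\<And>i. i < degree P \<Longrightarrow> poly P (r i) = 0" using poly_roots_product by blast
  obtain s where s: "\<And>z. poly Q z = lead_coeff Q * (\<Prod>i<degree Q. z - s i)"
    "\<And>i. i < degree Q \<Longrightarrow> poly Q (s i) = 0" using poly_roots_product by blast
  have 1: "(\<Prod>i<degree P. cmod (poly Q (r i))) =
      cmod (lead_coeff Q) ^ degree P * (\<Prod>i<degree P. \<Prod>j<degree Q. cmod (r i - s j))"
    by (subst s(1)) (simp add: norm_mult prod.distrib prod_norm[symmetric])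
  have 2: "(\<Prod>j<degree Q. cmod (poly P (s j))) =
      cmod (lead_coeff P) ^ degree Q * (\<Prod>j<degree Q. \<Prod>i<degree P. cmod (s j - r i))"
    by (subst r(1)) (simp add: norm_mult prod.distrib prod_norm[symmetric])
  have 3: "(\<Prod>j<degree Q. \<Prod>i<degree P. cmod (s j - r i)) =
      (\<Prod>i<degree P. \<Prod>j<degree Q. cmod (r i - s j))"
    by (subst prod.swap) (simp add: norm_minus_commute)
  show thesis
    using that[of r s] r(2) s(2) unfolding 1 2 3 by (simp add: mult_ac)
qed

lemma degree_lead_coeff_diff_const:
  assumes "degree p \<ge> 1"
  shows "degree (p - [:u:]) = degree p" "lead_coeff (p - [:u:]) = lead_coeff (p :: complex poly)"
proof -
  show *: "degree (p - [:u:]) = degree p"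
  proof -
    have "degree (p + - [:u:]) = degree p" using assms by (intro degree_add_eq_left) simp
    then show ?thesis by (simp only: add_uminus_conv_diff)
  qed
  show "lead_coeff (p - [:u:]) = lead_coeff p"
    unfolding * using assms by (cases "degree p") (auto simp: coeff_pCons)
qed

text \<open>With \<open>u\<close> in \<open>filled_julia p\<close> and \<open>w\<close> outside
  \<open>filled_julia q\<close>, let \<open>P\<close> be the \<open>n\<close>-th iterate of
  \<open>p\<close> minus \<open>u\<close>, and \<open>Q\<close> the \<open>m\<close>-th iterate of
  \<open>q\<close> minus \<open>w\<close>. Zeros of \<open>P\<close> lie in
  \<open>filled_julia p\<close>, so \<open>Q\<close> is at most \<open>C\<close> there; zeros of
  \<open>Q\<close> lie outside \<open>filled_julia p\<close>, so \<open>P\<close> is at least 1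
  there once \<open>n\<close> is large. The resultant then compares the leading coefficients, whose
  logarithms are explicit in \<open>log_cap\<close>.\<close>

lemma log_cap_mono:
  assumes p: "degree p \<ge> 2" and q: "degree q \<ge> 2" and sub: "filled_julia p \<subseteq> filled_julia q"
  shows "log_cap p \<le> log_cap q"
proof -
  define d where "d = real (degree p)"
  define e where "e = real (degree q)"
  have de: "d \<ge> 2" "e \<ge> 2" using p q by (auto simp: d_def e_def)
  obtain u where u: "u \<in> filled_julia p" using filled_nonempty[OF p] by blast
  have "filled_julia q \<noteq> UNIV"
    using compact_filled[OF q] compact_imp_bounded not_bounded_UNIV by metis
  then obtain w where w: "w \<notin> filled_julia q" by blast
  obtain R where R: "R > 0" "\<And>z n. z \<in> filled_julia q \<Longrightarrow> cmod ((poly q ^^ n) z) \<le> R"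
    using filled_bounded_orbits[OF q] by metis
  define C where "C = R + cmod w"
  have C: "C > 0" using R by (auto simp: C_def intro: add_pos_nonneg)
  have step: "\<forall>\<^sub>F n in sequentially. log_cap p * (1 - 1 / d ^ n) \<le> log_cap q * (1 - 1 / e ^ m) + ln C / e ^ m" for m
  proof -
    define Q where "Q = iter_poly q m - [:w:]"
    have dQ: "degree Q = degree q ^ m" "lead_coeff Q = lead_coeff (iter_poly q m)"
      using q degree_lead_coeff_diff_const[of "iter_poly q m" w]
      by (auto simp: Q_def degree_iter_poly simp flip: One_nat_def)
    have "Q \<noteq> 0" using dQ q by (auto simp: Q_def degree_iter_poly)
    then have fin: "finite {z. poly Q z = 0}" by (rule poly_roots_finite)
    have out: "z \<notin> filled_julia p" if "poly Q z = 0" for z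
    proof -
      have "(poly q ^^ m) z = w" using that by (simp add: Q_def poly_iter_poly)
      with w iterate_in_filled_iff[of m q z] have "z \<notin> filled_julia q" by auto
      with sub show ?thesis by blast
    qed
    have "\<forall>\<^sub>F n in sequentially. \<forall>z\<in>{z. poly Q z = 0}. cmod ((poly p ^^ n) z) \<ge> 1 + cmod u"
    \<comment> \<open>\<open>Q\<close> has finitely many zeros, so one threshold for
      \<open>n\<close> serves them all.\<close>
    proof (rule eventually_ball_finite[OF fin], rule ballI)
      fix z assume "z \<in> {z. poly Q z = 0}"
      with out[of z] show "\<forall>\<^sub>F n in sequentially. cmod ((poly p ^^ n) z) \<ge> 1 + cmod u"
        using filled_escape[OF p, of z] unfolding filterlim_at_infinity_conv_norm_at_top filterlim_at_top
        by blast
    qed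
    then show ?thesis
    proof eventually_elim
      case (elim n)
      define P where "P = iter_poly p n - [:u:]"
      have dP: "degree P = degree p ^ n" "lead_coeff P = lead_coeff (iter_poly p n)"
        using p degree_lead_coeff_diff_const[of "iter_poly p n" u]
        by (auto simp: P_def degree_iter_poly simp flip: One_nat_def)
      obtain r s where rs: "\<And>i. i < degree P \<Longrightarrow> poly P (r i) = 0" "\<And>j. j < degree Q \<Longrightarrow> poly Q (s j) = 0"
        and eq: "cmod (lead_coeff P) ^ degree Q * (\<Prod>i<degree P. cmod (poly Q (r i))) =
         cmod (lead_coeff Q) ^ degree P * (\<Prod>j<degree Q. cmod (poly P (s j)))"
        using resultant_symmetry by blast
      have "cmod (poly Q (r i)) \<le> C" if "i < degree P" for i
      proof -
        have "(poly p ^^ n) (r i) = u" using rs(1)[OF that] by (simp add: P_def poly_iter_poly)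
        with u iterate_in_filled_iff[of n p "r i"] sub have "r i \<in> filled_julia q" by auto
        from R(2)[OF this, of m] show ?thesis
          using norm_triangle_ineq4[of "(poly q ^^ m) (r i)" w]
          by (simp add: C_def Q_def poly_iter_poly)
      qed
      then have "(\<Prod>i<degree P. cmod (poly Q (r i))) \<le> (\<Prod>i<degree P. C)"
        by (intro prod_mono) auto
      then have X: "(\<Prod>i<degree P. cmod (poly Q (r i))) \<le> C ^ degree P" by simp
      have "1 \<le> cmod (poly P (s j))" if "j < degree Q" for j
      proof -
        have "cmod ((poly p ^^ n) (s j)) \<ge> 1 + cmod u" using elim rs(2)[OF that] by auto
        then show ?thesis
          using norm_triangle_ineq2[of "(poly p ^^ n) (s j)" u] by (simp add: P_def poly_iter_poly)
      qed
      then have Y: "1 \<le> (\<Prod>j<degree Q. cmod (poly P (s j)))"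
        by (intro prod_ge_1) auto
      have A0: "cmod (lead_coeff P) > 0" using dP p
        by (metis degree_0 le_zero_eq leading_coeff_0_iff not_numeral_le_zero power_eq_0_iff zero_less_norm_iff)
      have B0: "cmod (lead_coeff Q) > 0" using \<open>Q \<noteq> 0\<close> by simp
      have "cmod (lead_coeff Q) ^ degree P * 1 \<le> cmod (lead_coeff P) ^ degree Q * C ^ degree P"
        using mult_left_mono[OF Y, of "cmod (lead_coeff Q) ^ degree P"]
          mult_left_mono[OF X, of "cmod (lead_coeff P) ^ degree Q"] eq by simp
      then have "ln (cmod (lead_coeff Q) ^ degree P) \<le> ln (cmod (lead_coeff P) ^ degree Q * C ^ degree P)"
        using A0 B0 C by (subst ln_le_cancel_iff) auto
      then have "real (degree P) * ln (cmod (lead_coeff Q)) \<le> real (degree Q) * ln (cmod (lead_coeff P)) + real (degree P) * ln C"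
        using A0 B0 C by (simp add: ln_mult ln_realpow del: degree_iter_poly)
      then have "d ^ n * (- log_cap q * (e ^ m - 1)) \<le> e ^ m * (- log_cap p * (d ^ n - 1)) + d ^ n * ln C"
        unfolding dP(2) dQ(2) ln_lead_coeff_iter_poly[OF p] ln_lead_coeff_iter_poly[OF q] d_def e_def
        unfolding dP(1) dQ(1) by simp
      \<comment> \<open>Division by \<open>d ^ n * e ^ m\<close>, the product of the two
        degrees.\<close>
      then show ?case using de by (simp add: field_simps)
    qed
  qed
  have lim: "(\<lambda>n. c * (1 - 1 / x ^ n) + b / x ^ n) \<longlonglongrightarrow> c * (1 - 0) + b * 0" if "x \<ge> 2" for x b c :: real
  proof -
    have "(\<lambda>n. inverse (x ^ n)) \<longlonglongrightarrow> 0"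
      using that by (intro LIMSEQ_inverse_realpow_zero) auto
    then show ?thesis unfolding divide_inverse by (intro tendsto_intros) auto
  qed
  \<comment> \<open>\<open>n\<close> tends to infinity first, with \<open>m\<close> fixed, because
    the threshold for \<open>n\<close> depends on the zeros of \<open>Q\<close> and hence on
    \<open>m\<close>.\<close>
  have "log_cap p \<le> log_cap q * (1 - 1 / e ^ m) + ln C / e ^ m" for m
    using tendsto_upperbound[OF _ step[of m]] lim[OF de(1), of "log_cap p" 0] by simp
  then show ?thesis
    using tendsto_lowerbound[OF lim[OF de(2), of "log_cap q" "ln C"], of "log_cap p"] by simp
qed

text \<open>Conjugation by the dilation \<open>T\<close> carries the filled Julia set along and
  multiplies the leading coefficient by \<open>t\<close> to the power one minus the degree, which
  raises \<open>log_cap\<close> by exactly \<open>ln t\<close>. Monotonicity does the rest.\<close>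

lemma log_cap_dilation:
  assumes p: "degree p \<ge> 2" and q: "degree q \<ge> 2" and t: "t > 0"
    and sub: "(\<lambda>z. c + of_real t * (z - c)) ` filled_julia p \<subseteq> filled_julia q"
  shows "log_cap p + ln t \<le> log_cap q"
proof -
  define T where "T = (\<lambda>z. c + of_real t * (z - c))"
  \<comment> \<open>\<open>pt\<close> is the conjugate of \<open>p\<close> by \<open>T\<close>; the
    inner linear polynomial is the inverse dilation \<open>c + (z - c) / t\<close>.\<close>
  define pt where "pt = [:c - of_real t * c:] + smult (of_real t) (pcompose p [:c - c / of_real t, 1 / of_real t:])"
  have pT: "poly pt (T z) = T (poly p z)" for z
  proof -
    have "poly pt (T z) = c - of_real t * c + of_real t * poly p (c - c / of_real t + T z / of_real t)"
      unfolding pt_def poly_add poly_smult poly_pcompose by simp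
    moreover have "c - c / of_real t + T z / of_real t = z"
      unfolding T_def using t by (simp only: add_divide_distrib) simp
    ultimately have "poly pt (T z) = c - of_real t * c + of_real t * poly p z" by metis
    then show ?thesis unfolding T_def by (simp add: right_diff_distrib)
  qed
  have it: "(poly pt ^^ n) (T z) = T ((poly p ^^ n) z)" for n z
    by (induction n) (auto simp: pT)
  have dpt: "degree (smult (of_real t) (pcompose p [:c - c / of_real t, 1 / of_real t:])) = degree p"
    using t by (simp add: degree_pcompose)
  have dpt': "degree pt = degree p" unfolding pt_def
    by (subst degree_add_eq_right) (use dpt p in auto)
  have lpt: "lead_coeff pt = of_real t * (lead_coeff p * (1 / of_real t) ^ degree p)"
  proof -
    have "lead_coeff pt = lead_coeff (smult (of_real t) (pcompose p [:c - c / of_real t, 1 / of_real t:]))"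
      unfolding pt_def by (rule lead_coeff_add_le) (use dpt p in auto)
    then show ?thesis using t by (simp add: lead_coeff_smult lead_coeff_comp)
  qed
  have "filled_julia pt \<subseteq> T ` filled_julia p"
  proof
    fix w assume w: "w \<in> filled_julia pt"
    define z where "z = c + (w - c) / of_real t"
    have wz: "w = T z" using t by (simp add: z_def T_def)
    obtain B where B: "\<And>n. cmod ((poly pt ^^ n) w) \<le> B"
      using w unfolding filled_julia_def bounded_iff by auto
    have "cmod ((poly p ^^ n) z) \<le> cmod c + (B + cmod c) / t" for n
    proof -
      have "(poly p ^^ n) z = c + ((poly pt ^^ n) w - c) / of_real t"
        unfolding wz it using t by (simp add: T_def)
      also have "cmod \<dots> \<le> cmod c + cmod ((poly pt ^^ n) w - c) / t"
        using t norm_triangle_ineq[of c "((poly pt ^^ n) w - c) / of_real t"] by (simp add: norm_divide)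
      also have "cmod ((poly pt ^^ n) w - c) \<le> B + cmod c"
        using norm_triangle_ineq4[of "(poly pt ^^ n) w" c] B[of n] by linarith
      finally show ?thesis using t by (simp add: divide_right_mono)
    qed
    then have "z \<in> filled_julia p" unfolding filled_julia_def bounded_iff by auto
    then show "w \<in> T ` filled_julia p" using wz by blast
  qed
  with sub have "filled_julia pt \<subseteq> filled_julia q" by (auto simp: T_def)
  with dpt' p q have "log_cap pt \<le> log_cap q" by (intro log_cap_mono) auto
  moreover have "log_cap pt = log_cap p + ln t"
  proof -
    have "lead_coeff p \<noteq> 0" using p by auto
    then have "ln (cmod (lead_coeff pt)) = ln t + (ln (cmod (lead_coeff p)) - real (degree p) * ln t)"
      unfolding lpt using t by (simp add: norm_mult norm_divide norm_power ln_mult ln_div ln_realpow)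
    then have "- ln (cmod (lead_coeff pt)) = - ln (cmod (lead_coeff p)) + (real (degree p) - 1) * ln t"
      by (simp add: algebra_simps)
    then show ?thesis unfolding log_cap_def unfolding dpt' using p by (simp add: add_divide_distrib diff_divide_distrib)
  qed
  ultimately show ?thesis by simp
qed

text \<open>The squaring map, conjugated so that its invariant disc becomes
  \<open>cball c r\<close>, has \<open>log_cap\<close> equal to \<open>ln r\<close>; monotonicity
  compares \<open>p\<close> with it.\<close>

lemma log_cap_le_ln_radius:
  assumes p: "degree p \<ge> 2" and r: "r > 0" and sub: "filled_julia p \<subseteq> cball c r"
  shows "log_cap p \<le> ln r"
proof -
  define q where "q = [:c + c ^ 2 / of_real r, - 2 * c / of_real r, 1 / of_real r:]"
  have q: "poly q z - c = (z - c) ^ 2 / of_real r" for z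
    using r by (simp add: q_def power2_eq_square divide_simps) (simp add: algebra_simps)
  have dq: "degree q = 2" "lead_coeff q = 1 / of_real r" using r by (auto simp: q_def)
  have "cmod (poly q z - c) \<le> r" if "cmod (z - c) \<le> r" for z
  proof -
    have "cmod (z - c) ^ 2 \<le> r ^ 2" using that by (intro power_mono) auto
    then have "cmod (z - c) ^ 2 / r \<le> r ^ 2 / r" using r by (intro divide_right_mono) auto
    then show ?thesis unfolding q using r by (simp add: norm_divide norm_power norm_mult power2_eq_square)
  qed
  then have "cmod ((poly q ^^ n) z - c) \<le> r" if "cmod (z - c) \<le> r" for n z
    using that by (induction n) auto
  note * = this
  have "cball c r \<subseteq> filled_julia q"
  proof (intro subsetI)
    fix z assume "z \<in> cball c r"
    with * have "range (\<lambda>n. (poly q ^^ n) z) \<subseteq> cball c r" by (auto simp: dist_norm norm_minus_commute)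
    then show "z \<in> filled_julia q" unfolding filled_julia_def using bounded_cball bounded_subset by blast
  qed
  with sub dq p have "log_cap p \<le> log_cap q" by (intro log_cap_mono) auto
  also have "log_cap q = ln r" unfolding log_cap_def dq(2) using dq(1) r by (simp add: norm_divide ln_div)
  finally show ?thesis .
qed

section \<open>The diameter bound by Lagrange interpolation\<close>

text \<open>This is the divided difference of order \<open>N\<close>, read off from the
  interpolation formula: every node product \<open>B k\<close> is monic of degree \<open>N\<close>,
  and two polynomials of degree at most \<open>N\<close> that agree at \<open>N + 1\<close> nodes
  coincide.\<close>

lemma lagrange_lead_coeff:
  fixes Q :: "complex poly"
  assumes deg: "degree Q \<le> N" and inj: "inj_on z {..N}"
  shows "coeff Q N = (\<Sum>k\<le>N. poly Q (z k) / (\<Prod>j\<in>{..N} - {k}. z k - z j))"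
proof -
  define c where "c = (\<lambda>k. poly Q (z k) / (\<Prod>j\<in>{..N} - {k}. z k - z j))"
  define B where "B = (\<lambda>k. \<Prod>j\<in>{..N} - {k}. [:- z j, 1:])"
  define L where "L = (\<Sum>k\<le>N. smult (c k) (B k))"
  have degB: "degree (B k) = N" if "k \<le> N" for k
    using that by (simp add: B_def degree_prod_sum_eq)
  have "lead_coeff (B k) = 1" for k unfolding B_def by (simp add: lead_coeff_prod)
  then have coB: "coeff (B k) N = 1" if "k \<le> N" for k using degB[OF that] by metis
  have polyB: "poly (B k) (z i) = (if i = k then (\<Prod>j\<in>{..N} - {k}. z k - z j) else 0)"
    if "i \<le> N" "k \<le> N" for i k
    using that by (auto simp: B_def poly_prod)
  have L: "poly L (z i) = poly Q (z i)" if "i \<le> N" for i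
  proof -
    have nz: "(\<Prod>j\<in>{..N} - {i}. z i - z j) \<noteq> 0"
      using inj that by (auto simp: inj_on_def)
    have "poly L (z i) = (\<Sum>k\<le>N. c k * poly (B k) (z i))" by (simp add: L_def poly_sum)
    also have "\<dots> = (\<Sum>k\<le>N. if k = i then c i * (\<Prod>j\<in>{..N} - {i}. z i - z j) else 0)"
      using that by (intro sum.cong) (auto simp: polyB)
    also have "\<dots> = poly Q (z i)" using that nz by (simp add: c_def)
    finally show ?thesis .
  qed
  have degL: "degree L \<le> N" unfolding L_def
    by (rule degree_sum_le) (auto intro: order.trans[OF degree_smult_le] simp: degB)
  have "Q - L = 0"
  proof (rule ccontr)
    assume nz: "Q - L \<noteq> 0"
    have "card {x. poly (Q - L) x = 0} \<le> N"
      using card_poly_roots_bound[OF nz] degree_diff_le[OF deg degL] by linarith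
    moreover have "z ` {..N} \<subseteq> {x. poly (Q - L) x = 0}" using L by auto
    then have "card (z ` {..N}) \<le> card {x. poly (Q - L) x = 0}"
      by (intro card_mono poly_roots_finite nz)
    ultimately show False using card_image[OF inj] by simp
  qed
  then have "coeff Q N = coeff L N" by simp
  also have "\<dots> = (\<Sum>k\<le>N. c k)" by (simp add: L_def coeff_sum coB)
  finally show ?thesis by (simp add: c_def)
qed

text \<open>Multiplied by a power of the node spacing, these products bound the denominators of the
  divided difference from below in \<open>dist_filled_le\<close>.\<close>

lemma prod_abs_diff_nat:
  assumes "k \<le> N"
  shows "(\<Prod>j\<in>{..N} - {k}. \<bar>real k - real j\<bar>) = fact k * fact (N - k)"
proof -
  have f: "(\<Prod>j<m. real (Suc j)) = fact m" for m by (induction m) auto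
  have eq: "{..N} - {k} = {..<k} \<union> {k<..N}" using assms by auto
  have "(\<Prod>j\<in>{..N} - {k}. \<bar>real k - real j\<bar>) =
      (\<Prod>j<k. \<bar>real k - real j\<bar>) * (\<Prod>j\<in>{k<..N}. \<bar>real k - real j\<bar>)"
    unfolding eq by (rule prod.union_disjoint) auto
  also have "(\<Prod>j<k. \<bar>real k - real j\<bar>) = (\<Prod>j<k. real (Suc j))"
    by (rule prod.reindex_bij_witness[of _ "\<lambda>j. k - Suc j" "\<lambda>j. k - Suc j"]) auto
  also have "(\<Prod>j\<in>{k<..N}. \<bar>real k - real j\<bar>) = (\<Prod>j<N-k. real (Suc j))"
    by (rule prod.reindex_bij_witness[of _ "\<lambda>j. k + Suc j" "\<lambda>j. j - Suc k"]) auto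
  finally show ?thesis unfolding f .
qed

text \<open>A single term of the exponential series is at most its sum; this takes the place of
  Stirling's formula.\<close>

lemma power_le_exp_fact: "real N ^ N \<le> exp (real N) * fact N"
proof -
  have s: "(\<lambda>n. real N ^ n / fact n) sums exp (real N)"
    using exp_converges[of "real N"] by (simp add: divide_inverse mult.commute)
  have "(\<Sum>n\<in>{N}. real N ^ n / fact n) \<le> (\<Sum>n. real N ^ n / fact n)"
    using s by (intro sum_le_suminf) (auto simp: sums_iff)
  then show ?thesis using s by (simp add: sums_iff divide_simps)
qed

text \<open>Let \<open>l = dist a b\<close> and let \<open>N\<close> be the degree of the
  \<open>n\<close>-th iterate. Connectedness provides \<open>N + 1\<close> points of the filled
  Julia set whose distances from \<open>a\<close> are equally spaced between 0 and \<open>l\<close>.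
  The iterate is at most \<open>R\<close> there, so the divided difference bounds its leading
  coefficient by \<open>R * (2 * exp 1 / l) ^ N\<close>. Logarithms divided by \<open>N\<close> give
  the claim in the limit. The factor 2 comes from a sum of binomial coefficients, the factor
  \<open>exp 1\<close> from \<open>N ^ N / fact N\<close>.\<close>

lemma dist_filled_le:
  assumes p: "degree p \<ge> 2" and con: "connected (filled_julia p)" and ab: "a \<in> filled_julia p" "b \<in> filled_julia p"
  shows "dist a b \<le> 2 * exp 1 * exp (log_cap p)"
proof (cases "a = b")
  case False
  define l where "l = dist a b"
  have l: "l > 0" using False by (simp add: l_def)
  obtain R where R: "R > 0" "\<And>z n. z \<in> filled_julia p \<Longrightarrow> cmod ((poly p ^^ n) z) \<le> R"
    using filled_bounded_orbits[OF p] by metis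
  define d where "d = real (degree p)"
  have d: "d \<ge> 2" using p by (simp add: d_def)
  have ivt: "\<exists>z\<in>filled_julia p. dist a z = y" if "0 \<le> y" "y \<le> l" for y
  proof -
    have "connected (dist a ` filled_julia p)"
      by (intro connected_continuous_image con continuous_intros)
    moreover have "0 \<in> dist a ` filled_julia p" "l \<in> dist a ` filled_julia p"
      using ab by (force simp: l_def)+
    ultimately have "{0..l} \<subseteq> dist a ` filled_julia p" using connected_contains_Icc by blast
    then show ?thesis using that by fastforce
  qed
  have key: "- log_cap p * (1 - 1 / d ^ n) \<le> ln R / d ^ n + (ln 2 + 1 - ln l)" for n
  proof -
    define N where "N = degree p ^ n"
    have N: "N > 0" "real N = d ^ n" using p by (auto simp: N_def d_def)
    have "\<exists>z\<in>filled_julia p. dist a z = real k * l / real N" if "k \<le> N" for k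
      using that l N by (intro ivt) (auto simp: field_simps)
    then obtain z where z: "\<And>k. k \<le> N \<Longrightarrow> z k \<in> filled_julia p" "\<And>k. k \<le> N \<Longrightarrow> dist a (z k) = real k * l / real N"
      by metis
    \<comment> \<open>The distances from \<open>a\<close> alone keep the nodes apart, wherever they
      lie in the plane.\<close>
    have sep: "\<bar>real k - real j\<bar> * (l / real N) \<le> cmod (z k - z j)" if "k \<le> N" "j \<le> N" for k j
    proof -
      have "\<bar>dist a (z k) - dist a (z j)\<bar> \<le> dist (z k) (z j)"
        by (metis abs_dist_diff_le dist_commute)
      moreover have "dist a (z k) - dist a (z j) = (real k - real j) * (l / real N)"
        using that z by (simp add: algebra_simps)
      ultimately show ?thesis using l N by (simp add: dist_norm abs_mult)
    qed
    have inj: "inj_on z {..N}"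
    proof (rule inj_onI)
      fix k j assume "k \<in> {..N}" "j \<in> {..N}" "z k = z j"
      then have "\<bar>real k - real j\<bar> * (l / real N) \<le> 0" using sep[of k j] by simp
      moreover have "l / real N > 0" using l N by simp
      ultimately have "\<bar>real k - real j\<bar> \<le> 0" using mult_le_0_iff by (metis abs_ge_zero less_le_not_le order_antisym_conv)
      then show "k = j" by simp
    qed
    have "cmod (coeff (iter_poly p n) N) \<le> (\<Sum>k\<le>N. cmod ((poly p ^^ n) (z k) / (\<Prod>j\<in>{..N} - {k}. z k - z j)))"
      by (subst lagrange_lead_coeff[OF _ inj]) (auto simp: degree_iter_poly N_def poly_iter_poly intro: sum_norm_le)
    also have "\<dots> \<le> (\<Sum>k\<le>N. R / ((l / real N) ^ N * (fact k * fact (N - k))))"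
    proof (rule sum_mono)
      fix k assume k: "k \<in> {..N}"
      have "(l / real N) ^ N * (fact k * fact (N - k)) = (\<Prod>j\<in>{..N} - {k}. \<bar>real k - real j\<bar> * (l / real N))"
        using k by (simp only: prod.distrib prod_constant prod_abs_diff_nat card_Diff_singleton
            finite_atMost card_atMost atMost_iff) simp
      also have "\<dots> \<le> (\<Prod>j\<in>{..N} - {k}. cmod (z k - z j))"
        using k l N sep by (intro prod_mono) auto
      finally have "(l / real N) ^ N * (fact k * fact (N - k)) \<le> (\<Prod>j\<in>{..N} - {k}. cmod (z k - z j))" .
      moreover have "0 < (l / real N) ^ N * (fact k * fact (N - k))" using l N by simp
      moreover have "cmod ((poly p ^^ n) (z k)) \<le> R" using R z k by auto
      ultimately show "cmod ((poly p ^^ n) (z k) / (\<Prod>j\<in>{..N} - {k}. z k - z j)) \<le> R / ((l / real N) ^ N * (fact k * fact (N - k)))"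
        unfolding norm_divide prod_norm[symmetric] using R(1) by (intro frac_le) auto
    qed
    also have "\<dots> = R / (l / real N) ^ N * (\<Sum>k\<le>N. 1 / (fact k * fact (N - k)))"
      by (simp add: sum_distrib_left)
    also have "(\<Sum>k\<le>N. 1 / (fact k * fact (N - k))) = 2 ^ N / (fact N :: real)"
    proof -
      have "(\<Sum>k\<le>N. 1 / (fact k * fact (N - k))) = (\<Sum>k\<le>N. real (N choose k) / fact N)"
        by (intro sum.cong) (auto simp: binomial_fact)
      also have "\<dots> = real (\<Sum>k\<le>N. N choose k) / fact N" by (simp add: sum_divide_distrib)
      finally show ?thesis by (simp add: choose_row_sum)
    qed
    also have "R / (l / real N) ^ N * (2 ^ N / fact N) = R * (2 / l) ^ N * (real N ^ N / fact N)"
      by (simp add: power_divide)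
    also have "\<dots> \<le> R * (2 / l) ^ N * exp (real N)"
      using power_le_exp_fact[of N] R(1) l by (intro mult_left_mono) (auto simp: divide_simps)
    finally have ub: "cmod (lead_coeff (iter_poly p n)) \<le> R * (2 / l) ^ N * exp (real N)"
      by (simp add: degree_iter_poly N_def)
    have "iter_poly p n \<noteq> 0" using N by (metis N_def degree_0 degree_iter_poly less_irrefl)
    then have "ln (cmod (lead_coeff (iter_poly p n))) \<le> ln (R * (2 / l) ^ N * exp (real N))"
      using ub R(1) l by (subst ln_le_cancel_iff) auto
    also have "\<dots> = ln R + d ^ n * (ln 2 + 1 - ln l)"
      using R(1) l N by (simp add: ln_mult ln_realpow ln_div algebra_simps)
    finally have "- log_cap p * (d ^ n - 1) \<le> ln R + d ^ n * (ln 2 + 1 - ln l)"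
      unfolding ln_lead_coeff_iter_poly[OF p] d_def .
    then have "- log_cap p * (d ^ n - 1) / d ^ n \<le> (ln R + d ^ n * (ln 2 + 1 - ln l)) / d ^ n"
      using d by (intro divide_right_mono) auto
    moreover have "- log_cap p * (d ^ n - 1) / d ^ n = - log_cap p * (1 - 1 / d ^ n)"
      "(ln R + d ^ n * (ln 2 + 1 - ln l)) / d ^ n = ln R / d ^ n + (ln 2 + 1 - ln l)"
      using d by (simp_all add: divide_simps)
    ultimately show ?thesis by simp
  qed
  have L: "(\<lambda>n. inverse (d ^ n)) \<longlonglongrightarrow> 0" using d by (intro LIMSEQ_inverse_realpow_zero) auto
  have "(\<lambda>n. - log_cap p * (1 - 1 / d ^ n)) \<longlonglongrightarrow> - log_cap p * (1 - 1 * 0)"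
    unfolding divide_inverse by (intro tendsto_mult tendsto_diff tendsto_const L)
  moreover have "(\<lambda>n. ln R / d ^ n + (ln 2 + 1 - ln l)) \<longlonglongrightarrow> ln R * 0 + (ln 2 + 1 - ln l)"
    unfolding divide_inverse by (intro tendsto_mult tendsto_add tendsto_const L)
  ultimately have "- log_cap p * (1 - 1 * 0) \<le> ln R * 0 + (ln 2 + 1 - ln l)"
    using key by (auto intro: LIMSEQ_le)
  then have "- log_cap p \<le> ln 2 + 1 - ln l" by simp
  then have "ln l \<le> ln (2 * exp 1 * exp (log_cap p))" by (simp add: ln_mult)
  then show ?thesis using l by (subst (asm) ln_le_cancel_iff) (auto simp: l_def)
qed simp

section \<open>Connectedness of filled Julia sets\<close>

lemma open_poly_image:
  fixes p :: "complex poly"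
  assumes "degree p \<ge> 1" "open U"
  shows "open (poly p ` U)"
proof (rule open_mapping_thm[of "poly p" UNIV U])
  have "\<not> constant (poly p)" using assms by (simp add: constant_degree)
  then show "\<not> poly p constant_on UNIV" unfolding constant_def constant_on_def by (metis UNIV_I)
qed (use assms in \<open>auto intro: holomorphic_on_poly\<close>)

text \<open>By the open mapping theorem the image of \<open>U\<close> contains a disc about
  \<open>poly p z\<close>, hence also a slightly contracted copy of this value.\<close>

lemma poly_smaller_nearby:
  fixes p :: "complex poly"
  assumes "degree p \<ge> 1" "open U" "z \<in> U" "poly p z \<noteq> 0"
  obtains y where "y \<in> U" "cmod (poly p y) < cmod (poly p z)"
proof -
  have "poly p z \<in> poly p ` U" using assms by blast
  then obtain e where e: "e > 0" "ball (poly p z) e \<subseteq> poly p ` U"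
    using open_poly_image[OF assms(1,2)] open_contains_ball by metis
  define s where "s = min (1/2) (e / (2 * cmod (poly p z)))"
  have s: "0 < s" "s < 1" "s * cmod (poly p z) < e"
    using assms(4) e(1) by (auto simp: s_def min_def field_simps)
  define w where "w = of_real (1 - s) * poly p z"
  have "poly p z - w = of_real s * poly p z" by (simp add: w_def algebra_simps)
  then have "dist (poly p z) w < e" using s by (simp add: dist_norm norm_mult)
  then obtain y where y: "y \<in> U" "w = poly p y" using e by (auto simp: subset_iff mem_ball)
  have "cmod w = (1 - s) * cmod (poly p z)" using s by (simp only: w_def norm_mult norm_of_real)
  also have "\<dots> < cmod (poly p z)" using s assms(4) by simp
  finally show thesis using that y by simp
qed

text \<open>The closed region enclosed by a lemniscate of \<open>p\<close>. For the iterates of one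
  polynomial and a large level, these regions shrink to the filled Julia set.\<close>

definition sublevel :: "complex poly \<Rightarrow> real \<Rightarrow> complex set" where
  "sublevel p t = {z. cmod (poly p z) \<le> t}"

lemma closed_sublevel: "closed (sublevel p t)"
  unfolding sublevel_def by (intro closed_Collect_le continuous_intros)

lemma compact_sublevel:
  assumes "degree p \<ge> 1"
  shows "compact (sublevel p t)"
proof -
  have "filterlim (poly p) at_infinity at_infinity"
    using assms by (intro filterlim_poly_at_infinity) auto
  then have "\<forall>\<^sub>F z in at_infinity. t + 1 \<le> cmod (poly p z)"
    unfolding filterlim_at_infinity_conv_norm_at_top filterlim_at_top by blast
  then obtain b where b: "\<And>z. b \<le> cmod z \<Longrightarrow> t + 1 \<le> cmod (poly p z)"
    by (auto simp: eventually_at_infinity)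
  have "sublevel p t \<subseteq> cball 0 b"
  proof
    fix z assume "z \<in> sublevel p t"
    then have "\<not> b \<le> cmod z" using b[of z] by (auto simp: sublevel_def)
    then show "z \<in> cball 0 b" by simp
  qed
  then show ?thesis
    using closed_sublevel bounded_cball bounded_subset compact_eq_bounded_closed by metis
qed

text \<open>The minimum of the modulus over the compact piece \<open>A\<close> is attained at a
  zero: otherwise a smaller value occurs nearby, at a point still in the sublevel set and off
  \<open>B\<close>, hence in \<open>A\<close>.\<close>

lemma sublevel_part_has_zero:
  assumes p: "degree p \<ge> 1" and AB: "closed A" "closed B" "A \<inter> B = {}" "A \<union> B = sublevel p t" and "A \<noteq> {}"
  obtains z where "z \<in> A" "poly p z = 0"
proof -
  have "compact A"
    using AB compact_sublevel[OF p, of t] by (metis compact_Int_closed inf.absorb_iff2 inf_commute sup_ge1)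
  moreover have "continuous_on A (\<lambda>z. cmod (poly p z))" by (intro continuous_intros)
  ultimately obtain z where z: "z \<in> A" "\<And>y. y \<in> A \<Longrightarrow> cmod (poly p z) \<le> cmod (poly p y)"
    using continuous_attains_inf[of A "\<lambda>z. cmod (poly p z)"] \<open>A \<noteq> {}\<close> by blast
  have "poly p z = 0"
  proof (rule ccontr)
    assume nz: "poly p z \<noteq> 0"
    have "open (- B)" "z \<in> - B" using AB z by (auto simp: open_Compl)
    then obtain y where y: "y \<in> - B" "cmod (poly p y) < cmod (poly p z)"
      using poly_smaller_nearby[OF p _ _ nz] by metis
    have "z \<in> sublevel p t" using z AB by auto
    then have "y \<in> sublevel p t" using y by (simp add: sublevel_def)
    then have "y \<in> A" using y AB by auto
    with z y show False by fastforce
  qed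
  with z that show thesis by blast
qed

text \<open>Both pieces of a separation would contain a zero, whereas all zeros lie in one connected
  subset.\<close>

lemma connected_sublevel_if_zeros_joined:
  assumes p: "degree p \<ge> 1" and Q: "connected Q" "Q \<subseteq> sublevel p t" "{z. poly p z = 0} \<subseteq> Q"
  shows "connected (sublevel p t)"
proof (rule ccontr)
  assume "\<not> connected (sublevel p t)"
  then obtain A B where AB: "closed A" "closed B" "A \<inter> B = {}" "A \<union> B = sublevel p t" "A \<noteq> {}" "B \<noteq> {}"
    using closed_sublevel[of p t] by (auto simp: connected_closed_set)
  obtain a where a: "a \<in> A" "poly p a = 0" using sublevel_part_has_zero[OF p AB(1-5)] by blast
  obtain b where b: "b \<in> B" "poly p b = 0"
    using sublevel_part_has_zero[OF p AB(2,1) _ _ AB(6), of t] AB by blast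
  show False
    using connected_closedD[OF Q(1), of A B] a b AB Q by blast
qed

lemma connected_sublevel_mono:
  assumes "degree p \<ge> 1" "connected (sublevel p s)" "s \<le> t" "0 \<le> s"
  shows "connected (sublevel p t)"
proof (rule connected_sublevel_if_zeros_joined[OF assms(1,2)])
  show "sublevel p s \<subseteq> sublevel p t" unfolding sublevel_def using assms(3) by force
  show "{z. poly p z = 0} \<subseteq> sublevel p s" unfolding sublevel_def using assms(4) by auto
qed

lemma connected_sublevel_large:
  assumes "degree p \<ge> 1"
  obtains t where "connected (sublevel p t)" "t \<ge> R"
proof -
  have "compact {z. poly p z = 0}" using assms by (intro finite_imp_compact poly_roots_finite) auto
  then have "bounded {z. poly p z = 0}" by (rule compact_imp_bounded)
  then obtain r where r: "{z. poly p z = 0} \<subseteq> cball 0 r"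
    unfolding bounded_iff by (auto simp: subset_iff)
  have "compact (poly p ` cball 0 r)" by (intro compact_continuous_image continuous_intros) auto
  then have "bounded (poly p ` cball 0 r)" by (rule compact_imp_bounded)
  then obtain t where t: "\<And>z. z \<in> cball 0 r \<Longrightarrow> cmod (poly p z) \<le> t"
    unfolding bounded_iff by blast
  have "cball 0 r \<subseteq> sublevel p (max t R)" (is ?sub)
    using t unfolding sublevel_def by (auto simp: le_max_iff_disj)
  have "connected (sublevel p (max t R))"
    using r \<open>?sub\<close> by (intro connected_sublevel_if_zeros_joined[OF assms, of "cball 0 r"]) auto
  then show thesis by (rule that) simp
qed

lemma connected_sublevel_limit:
  assumes p: "degree p \<ge> 1" and "\<And>s. s > t \<Longrightarrow> connected (sublevel p s)"
  shows "connected (sublevel p t)"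
proof -
  have "sublevel p t = (\<Inter>n::nat. sublevel p (t + 1 / real (Suc n)))"
  proof (intro equalityI subsetI)
    fix z assume "z \<in> (\<Inter>n::nat. sublevel p (t + 1 / real (Suc n)))"
    then have *: "cmod (poly p z) \<le> t + 1 / real (Suc n)" for n unfolding sublevel_def by blast
    have "(\<lambda>n. t + 1 / real (Suc n)) \<longlonglongrightarrow> t + 0"
      by (intro tendsto_add tendsto_const LIMSEQ_Suc[OF lim_1_over_n])
    from LIMSEQ_le_const[OF this] * show "z \<in> sublevel p t"
      unfolding sublevel_def by simp
  next
    fix z assume "z \<in> sublevel p t"
    then have "cmod (poly p z) \<le> t + 1 / real (Suc n)" for n
      unfolding sublevel_def by (simp add: add_increasing2)
    then show "z \<in> (\<Inter>n::nat. sublevel p (t + 1 / real (Suc n)))"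
      unfolding sublevel_def by blast
  qed
  also have "connected \<dots>"
  proof (rule connected_nest)
    show "sublevel p (t + 1 / real (Suc n)) \<subseteq> sublevel p (t + 1 / real (Suc m))" if "m \<le> n" for m n
    proof -
      have "1 / real (Suc n) \<le> 1 / real (Suc m)" using that by (simp add: frac_le)
      then show ?thesis unfolding sublevel_def by force
    qed
  qed (use assms in \<open>auto intro: compact_sublevel\<close>)
  finally show ?thesis .
qed

text \<open>Off the critical points the open sublevel set looks like a half-disc near its boundary, so
  two different pieces of it cannot touch.\<close>

lemma connected_open_sublevel:
  assumes p: "degree p \<ge> 1" and t: "t > 0" and con: "connected (sublevel p t)"
    and crit: "\<And>z. cmod (poly p z) = t \<Longrightarrow> poly (pderiv p) z \<noteq> 0"
  shows "connected {z. cmod (poly p z) < t}"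
proof (rule ccontr)
  define O' where "O' = {z. cmod (poly p z) < t}"
  have opO: "open O'" unfolding O'_def by (intro open_Collect_less continuous_intros)
  assume "\<not> connected {z. cmod (poly p z) < t}"
  then obtain U V where UV: "open U" "open V" "U \<inter> V \<inter> O' = {}" "O' \<subseteq> U \<union> V" "U \<inter> O' \<noteq> {}" "V \<inter> O' \<noteq> {}"
    unfolding O'_def[symmetric] connected_def by blast
  define A where "A = closure (U \<inter> O')"
  define B where "B = closure (V \<inter> O')"
  have Osub: "O' \<subseteq> sublevel p t" by (auto simp: O'_def sublevel_def)
  then have sub: "A \<subseteq> sublevel p t" "B \<subseteq> sublevel p t"
    unfolding A_def B_def by (intro closure_minimal closed_sublevel; blast)+
  have "z \<in> A \<union> B" if z: "z \<in> sublevel p t" for z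
  proof -
    \<comment> \<open>Since \<open>t > 0\<close>, a point at level \<open>t\<close> is not a zero,
      so smaller values occur arbitrarily near it: the closed sublevel set is the closure of the
      open one.\<close>
    have "z \<in> closure O'"
    proof (cases "z \<in> O'")
      case False
      then have zt: "cmod (poly p z) = t" using z by (auto simp: O'_def sublevel_def)
      show ?thesis unfolding closure_iff_nhds_not_empty
      proof (intro allI impI)
        fix N W assume W: "W \<subseteq> N" "open W" "z \<in> W"
        obtain y where "y \<in> W" "cmod (poly p y) < cmod (poly p z)"
          using poly_smaller_nearby[OF p W(2,3)] zt t by (metis norm_zero less_irrefl)
        then show "O' \<inter> N \<noteq> {}" using W zt by (auto simp: O'_def)
      qed
    qed (use closure_subset in blast)
    moreover have "O' = (U \<inter> O') \<union> (V \<inter> O')" using UV by blast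
    ultimately show ?thesis unfolding A_def B_def by (metis closure_Un)
  qed
  with sub have un: "A \<union> B = sublevel p t" by blast
  have "A \<inter> B = {}"
  proof (rule ccontr)
    assume "A \<inter> B \<noteq> {}"
    then obtain z where z: "z \<in> A" "z \<in> B" by blast
    have meet: "W \<inter> (U \<inter> O') \<noteq> {}" "W \<inter> (V \<inter> O') \<noteq> {}" if "open W" "z \<in> W" for W
      using z that unfolding A_def B_def by (metis disjoint_iff open_Int_closure_eq_empty)+
    have "z \<notin> O'"
    proof
      assume "z \<in> O'"
      then consider "z \<in> U \<inter> O'" | "z \<in> V \<inter> O'" using UV by blast
      then show False
      proof cases
        case 1
        then show False using meet(2)[of "U \<inter> O'"] UV opO by blast
      next
        case 2
        then show False using meet(1)[of "V \<inter> O'"] UV opO by blast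
      qed
    qed
    then have zt: "cmod (poly p z) = t" using z sub by (auto simp: O'_def sublevel_def)
    have "deriv (poly p) z \<noteq> 0" using crit[OF zt] by (simp add: DERIV_imp_deriv[OF poly_DERIV])
    then obtain r where r: "r > 0" "inj_on (poly p) (ball z r)"
      using has_complex_derivative_locally_injective[of "poly p" UNIV z] holomorphic_on_poly[of p UNIV] by auto
    obtain g where g: "g holomorphic_on poly p ` ball z r" "\<And>y. y \<in> ball z r \<Longrightarrow> g (poly p y) = y"
      using holomorphic_has_inverse[OF holomorphic_on_poly open_ball r(2)] by metis
    have "poly p z \<in> poly p ` ball z r" using r by auto
    then obtain e where e: "e > 0" "ball (poly p z) e \<subseteq> poly p ` ball z r"
      using open_poly_image[OF p open_ball] open_contains_ball by metis
    \<comment> \<open>\<open>H\<close> is the image under the local inverse of a lens, the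
      intersection of two discs, which is convex; so \<open>H\<close> is connected. It lies in the
      open sublevel set and contains all of its points near \<open>z\<close>, hence meets both
      \<open>U\<close> and \<open>V\<close>.\<close>
    define H where "H = g ` (ball (poly p z) e \<inter> ball 0 t)"
    have conH: "connected H" unfolding H_def
    proof (intro connected_continuous_image)
      show "continuous_on (ball (poly p z) e \<inter> ball 0 t) g"
        by (rule continuous_on_subset[OF holomorphic_on_imp_continuous_on[OF g(1)]]) (use e in blast)
      show "connected (ball (poly p z) e \<inter> ball 0 t)"
        by (intro convex_connected convex_Int convex_ball)
    qed
    define W where "W = ball z r \<inter> poly p -` ball (poly p z) e"
    have W: "open W" unfolding W_def by (intro open_Int open_vimage open_ball continuous_intros)
    have zW: "z \<in> W" using r e by (auto simp: W_def)
    have WH: "W \<inter> O' \<subseteq> H"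
    proof
      fix y assume y: "y \<in> W \<inter> O'"
      then have "poly p y \<in> ball (poly p z) e \<inter> ball 0 t" by (auto simp: W_def O'_def)
      moreover have "y = g (poly p y)" using y g by (auto simp: W_def)
      ultimately show "y \<in> H" unfolding H_def by blast
    qed
    have HO: "H \<subseteq> O'"
    proof
      fix y assume "y \<in> H"
      then obtain w where w: "w \<in> ball (poly p z) e" "cmod w < t" "y = g w" by (auto simp: H_def)
      then obtain x where "x \<in> ball z r" "w = poly p x" using e by blast
      with w g show "y \<in> O'" by (auto simp: O'_def)
    qed
    have "U \<inter> H \<noteq> {}" "V \<inter> H \<noteq> {}" using meet[OF W zW] WH by blast+
    then show False using conH UV HO unfolding connected_def by blast
  qed
  moreover have "A \<noteq> {}" "B \<noteq> {}" "closed A" "closed B" using UV by (auto simp: A_def B_def)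
  ultimately show False using con un connected_closedD[of "sublevel p t" A B] sub by blast
qed

lemma finite_subset_open_connected_compact:
  fixes U :: "complex set"
  assumes "open U" "connected U" "finite F" "F \<subseteq> U" "F \<noteq> {}"
  obtains Q where "compact Q" "connected Q" "F \<subseteq> Q" "Q \<subseteq> U"
proof -
  obtain a where a: "a \<in> F" using assms by blast
  have "path_connected U" using assms connected_open_path_connected by blast
  then have "\<forall>b\<in>F. \<exists>g. path g \<and> path_image g \<subseteq> U \<and> pathstart g = a \<and> pathfinish g = b"
    using a assms unfolding path_connected_def by blast
  then obtain g where g: "\<And>b. b \<in> F \<Longrightarrow> path (g b) \<and> path_image (g b) \<subseteq> U \<and> pathstart (g b) = a \<and> pathfinish (g b) = b"
    by metis
  show thesis
  proof
    show "compact (\<Union>b\<in>F. path_image (g b))" using assms g by (intro compact_UN) (auto intro: compact_path_image)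
    have "a \<in> path_image (g b)" if "b \<in> F" for b using g[OF that] by (metis pathstart_in_path_image)
    then have "\<Inter> ((\<lambda>b. path_image (g b)) ` F) \<noteq> {}" using assms(5) by blast
    then show "connected (\<Union>b\<in>F. path_image (g b))"
      using g by (intro connected_Union) (auto intro: connected_path_image)
    show "F \<subseteq> (\<Union>b\<in>F. path_image (g b))" 
    proof
      fix b assume b: "b \<in> F"
      have "b \<in> path_image (g b)" using g[OF b] pathfinish_in_path_image[of "g b"] by simp
      then show "b \<in> (\<Union>b\<in>F. path_image (g b))" using b by blast
    qed
    show "(\<Union>b\<in>F. path_image (g b)) \<subseteq> U" using g by blast
  qed
qed

text \<open>A compact connected set through all zeros fits into the open sublevel set; the maximum
  of the modulus on it is a level below \<open>t\<close> at which the closed sublevel set is already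
  connected.\<close>

lemma connected_sublevel_decrease:
  assumes p: "degree p \<ge> 1" and t: "t > 0" and con: "connected {z. cmod (poly p z) < t}"
  obtains s where "0 \<le> s" "s < t" "connected (sublevel p s)"
proof -
  have "\<not> constant (poly p)" using p by (simp add: constant_degree)
  then have ne: "{z. poly p z = 0} \<noteq> {}" using fundamental_theorem_of_algebra by blast
  have fin: "finite {z. poly p z = 0}" using p by (intro poly_roots_finite) auto
  have "open {z. cmod (poly p z) < t}" by (intro open_Collect_less continuous_intros)
  then obtain Q where Q: "compact Q" "connected Q" "{z. poly p z = 0} \<subseteq> Q" "Q \<subseteq> {z. cmod (poly p z) < t}"
    using finite_subset_open_connected_compact[OF _ con fin _ ne] t
    by (metis (mono_tags, lifting) mem_Collect_eq norm_zero subsetI)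
  have "Q \<noteq> {}" using Q ne by blast
  moreover have "continuous_on Q (\<lambda>z. cmod (poly p z))" by (intro continuous_intros)
  ultimately obtain x where x: "x \<in> Q" "\<And>y. y \<in> Q \<Longrightarrow> cmod (poly p y) \<le> cmod (poly p x)"
    using continuous_attains_sup[OF Q(1)] by blast
  show thesis
  proof
    show "0 \<le> cmod (poly p x)" by simp
    show "cmod (poly p x) < t" using x Q by auto
    show "connected (sublevel p (cmod (poly p x)))"
      using x Q by (intro connected_sublevel_if_zeros_joined[OF p Q(2)]) (auto simp: sublevel_def)
  qed
qed

text \<open>Descent on the level. High levels are connected, and so is the infimum of the connected
  levels, as a nested intersection. If this infimum exceeded \<open>R\<close>, no critical value
  would have that modulus, so connectedness would pass to the open sublevel set and on to a lower
  level.\<close>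

lemma connected_sublevel:
  assumes p: "degree p \<ge> 1" and R: "R > 0"
    and crit: "\<And>c. poly (pderiv p) c = 0 \<Longrightarrow> cmod (poly p c) < R"
  shows "connected (sublevel p R)"
proof -
  define T where "T = {t. t \<ge> R \<and> connected (sublevel p t)}"
  have T: "T \<noteq> {}" "bdd_below T"
    using connected_sublevel_large[OF p, of R] by (auto simp: T_def bdd_below_def)
  define t where "t = Inf T"
  have tR: "t \<ge> R" unfolding t_def by (rule cInf_greatest[OF T(1)]) (auto simp: T_def)
  have "connected (sublevel p s)" if s: "s > t" for s
  proof -
    obtain u where "u \<in> T" "u < s" using s T unfolding t_def by (meson cInf_lessD)
    then show ?thesis using connected_sublevel_mono[OF p, of u s] R by (auto simp: T_def)
  qed
  then have con: "connected (sublevel p t)" by (rule connected_sublevel_limit[OF p])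
  have "t = R"
  proof (rule ccontr)
    assume "t \<noteq> R"
    with tR have lt: "t > R" by simp
    have "connected {z. cmod (poly p z) < t}"
      using con crit lt R by (intro connected_open_sublevel[OF p]) force+
    then obtain s where s: "0 \<le> s" "s < t" "connected (sublevel p s)"
      using connected_sublevel_decrease[OF p, of t] lt R by auto
    have "max s R \<in> T" using connected_sublevel_mono[OF p s(3), of "max s R"] s(1) by (auto simp: T_def)
    then have "t \<le> max s R" unfolding t_def using T by (intro cInf_lower)
    with s lt show False by simp
  qed
  with con show ?thesis by simp
qed

text \<open>By the chain rule a critical point of an iterate is critical for the preceding iterate
  or is mapped by it to a critical point of \<open>p\<close>.\<close>

lemma critical_value_iterate_in_filled:
  assumes "\<And>c. poly (pderiv p) c = 0 \<Longrightarrow> c \<in> filled_julia p" "poly (pderiv (iter_poly p n)) c = 0"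
  shows "(poly p ^^ n) c \<in> filled_julia p"
  using assms(2)
proof (induction n)
  case 0
  then show ?case by (simp add: pderiv_pCons)
next
  case (Suc n)
  then consider "poly (pderiv p) ((poly p ^^ n) c) = 0" | "poly (pderiv (iter_poly p n)) c = 0"
    by (auto simp: pderiv_pcompose poly_pcompose poly_iter_poly)
  then have "(poly p ^^ n) c \<in> filled_julia p" using assms(1) Suc.IH by cases auto
  then show ?case by (simp add: poly_in_filled_iff)
qed

text \<open>The sets where the \<open>n\<close>-th iterate is at most \<open>R\<close> in modulus
  decrease to the filled Julia set. Each is connected because the critical values of the iterates
  lie in the filled Julia set, hence below the level \<open>R\<close>.\<close>

lemma connected_filled:
  assumes p: "degree p \<ge> 2" and crit: "\<And>c. poly (pderiv p) c = 0 \<Longrightarrow> c \<in> filled_julia p"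
  shows "connected (filled_julia p)"
proof -
  obtain R0 where R0: "R0 > 0" "filled_julia p = {z. \<forall>n. cmod ((poly p ^^ n) z) \<le> R0}"
    "\<And>z. cmod z \<ge> R0 \<Longrightarrow> cmod (poly p z) \<ge> 2 * cmod z"
    using filled_characterization[OF p] by metis
  \<comment> \<open>Critical values have modulus at most \<open>R0\<close>; the added 1 puts them
    strictly below the level, as \<open>connected_sublevel\<close> demands.\<close>
  define R where "R = R0 + 1"
  have eq: "filled_julia p = (\<Inter>n. sublevel (iter_poly p n) R)"
  proof (intro equalityI subsetI)
    fix z assume "z \<in> filled_julia p"
    then have "cmod ((poly p ^^ n) z) \<le> R0" for n using R0 by auto
    then have "cmod ((poly p ^^ n) z) \<le> R" for n unfolding R_def by (meson add_increasing2 zero_le_one order_refl order_trans)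
    then show "z \<in> (\<Inter>n. sublevel (iter_poly p n) R)"
      by (simp add: sublevel_def poly_iter_poly)
  next
    fix z assume "z \<in> (\<Inter>n. sublevel (iter_poly p n) R)"
    then show "z \<in> filled_julia p" by (auto simp: sublevel_def poly_iter_poly filled_julia_def bounded_iff)
  qed
  have "connected (sublevel (iter_poly p n) R)" for n
  proof (rule connected_sublevel)
    show "degree (iter_poly p n) \<ge> 1" using p by (simp add: degree_iter_poly)
    show "R > 0" using R0 by (simp add: R_def)
    fix c assume "poly (pderiv (iter_poly p n)) c = 0"
    then have "(poly p ^^ n) c \<in> filled_julia p" using critical_value_iterate_in_filled[OF crit] by blast
    then have "cmod ((poly p ^^ 0) ((poly p ^^ n) c)) \<le> R0" unfolding R0(2) by blast
    then show "cmod (poly (iter_poly p n) c) < R" by (simp add: poly_iter_poly R_def)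
  qed
  moreover have "sublevel (iter_poly p n) R \<subseteq> sublevel (iter_poly p m) R" if "m \<le> n" for m n
  proof -
    have "sublevel (iter_poly p (Suc k)) R \<subseteq> sublevel (iter_poly p k) R" for k
    proof
      fix z assume z: "z \<in> sublevel (iter_poly p (Suc k)) R"
      have le: "cmod (poly p ((poly p ^^ k) z)) \<le> R" using z by (simp add: sublevel_def poly_pcompose poly_iter_poly)
      have "cmod ((poly p ^^ k) z) \<le> R"
      proof (cases "R0 \<le> cmod ((poly p ^^ k) z)")
        case True
        from R0(3)[OF True] le show ?thesis using norm_ge_zero[of "(poly p ^^ k) z"] by linarith
      qed (simp add: R_def)
      then show "z \<in> sublevel (iter_poly p k) R" by (simp add: sublevel_def poly_iter_poly)
    qed
    then show ?thesis using that by (rule lift_Suc_antimono_le)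
  qed
  moreover have "compact (sublevel (iter_poly p n) R)" for n
    using p by (intro compact_sublevel) (simp add: degree_iter_poly)
  ultimately show ?thesis unfolding eq by (intro connected_nest) auto
qed

lemma connected_frontier_filled:
  assumes p: "degree p \<ge> 2" and con: "connected (filled_julia p)"
  shows "connected (frontier (filled_julia p))"
  using con connected_Compl_filled[OF p] by (rule connected_frontier_simple)

section \<open>Normal families on the sphere\<close>

text \<open>From this product form both the comparison with the planar distance and the invariance
  under inversion can be read off.\<close>

lemma dist_Fin_sq:
  "(dist (Fin z) (Fin w))\<^sup>2 = 4 * (cmod (z - w))\<^sup>2 / (((cmod z)\<^sup>2 + 1) * ((cmod w)\<^sup>2 + 1))"
proof -
  define x y u v where "x = Re z" and "y = Im z" and "u = Re w" and "v = Im w"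
  define A B where "A = x^2 + y^2 + 1" and "B = u^2 + v^2 + 1"
  have AB: "A > 0" "B > 0" by (auto simp: A_def B_def add_nonneg_pos)
  have zA: "(cmod z)\<^sup>2 + 1 = A" "(cmod w)\<^sup>2 + 1 = B"
    by (auto simp: A_def B_def x_def y_def u_def v_def cmod_power2)
  have zA': "(cmod z)\<^sup>2 - 1 = A - 2" "(cmod w)\<^sup>2 - 1 = B - 2" using zA by auto
  have "(dist (Fin z) (Fin w))\<^sup>2 = (cmod ((2 / A) *\<^sub>R z - (2 / B) *\<^sub>R w))\<^sup>2 + ((A - 2) / A - (B - 2) / B)\<^sup>2"
    unfolding dist_riemann_sphere_def stereographic.simps zA zA' dist_prod_def
    by (simp add: dist_norm real_sqrt_pow2)
  also have "(cmod ((2 / A) *\<^sub>R z - (2 / B) *\<^sub>R w))\<^sup>2 = (2 / A * x - 2 / B * u)\<^sup>2 + (2 / A * y - 2 / B * v)\<^sup>2"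
    by (simp add: cmod_power2 x_def y_def u_def v_def)
  also have "\<dots> + ((A - 2) / A - (B - 2) / B)\<^sup>2 =
      (4 * ((x^2 + y^2 + 1) * B^2 + (u^2 + v^2 + 1) * A^2 - 2 * (x * u + y * v + 1) * A * B)) / (A^2 * B^2)"
    using AB by (simp add: power2_eq_square divide_simps) (simp add: algebra_simps)
  also have "\<dots> = (4 * (A * B * (A + B - 2 * (x * u + y * v + 1)))) / (A^2 * B^2)"
    unfolding A_def[symmetric] B_def[symmetric] by (simp add: power2_eq_square algebra_simps)
  also have "\<dots> = 4 * (A + B - 2 * (x * u + y * v + 1)) / (A * B)"
    using AB by (simp add: power2_eq_square)
  also have "A + B - 2 * (x * u + y * v + 1) = (cmod (z - w))\<^sup>2"
  proof -
    have "(cmod (z - w))\<^sup>2 = (x - u)\<^sup>2 + (y - v)\<^sup>2"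
      by (simp add: cmod_power2 x_def y_def u_def v_def)
    then show ?thesis by (simp add: A_def B_def power2_eq_square algebra_simps)
  qed
  finally show ?thesis unfolding zA .
qed

lemma dist_Fin_Infty_sq: "(dist (Fin z) Infty)\<^sup>2 = 4 / ((cmod z)\<^sup>2 + 1)"
proof -
  define A where "A = (cmod z)\<^sup>2 + 1"
  have A: "A > 0" by (auto simp: A_def add_nonneg_pos)
  have zA': "(cmod z)\<^sup>2 - 1 = A - 2" "(cmod z)\<^sup>2 = A - 1" by (auto simp: A_def)
  have "(dist (Fin z) Infty)\<^sup>2 = (cmod ((2 / A) *\<^sub>R z))\<^sup>2 + ((A - 2) / A - 1)\<^sup>2"
    unfolding dist_riemann_sphere_def stereographic.simps A_def[symmetric] zA'(1) dist_prod_def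
    by (simp add: dist_norm real_sqrt_pow2)
  also have "(cmod ((2 / A) *\<^sub>R z))\<^sup>2 = (2 / A)\<^sup>2 * (A - 1)"
    using A by (simp add: power_mult_distrib power_divide zA'(2)[symmetric])
  also have "\<dots> + ((A - 2) / A - 1)\<^sup>2 = 4 / A"
    using A by (simp add: power2_eq_square divide_simps)
  finally show ?thesis by (simp add: A_def)
qed

lemma dist_Fin_le: "dist (Fin z) (Fin w) \<le> 2 * dist z w"
proof -
  have ge: "1 \<le> ((cmod z)\<^sup>2 + 1) * ((cmod w)\<^sup>2 + 1)"
    using mult_mono[of 1 "(cmod z)\<^sup>2 + 1" 1 "(cmod w)\<^sup>2 + 1"] by simp
  have "(dist (Fin z) (Fin w))\<^sup>2 \<le> 4 * (cmod (z - w))\<^sup>2 / 1"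
    unfolding dist_Fin_sq using ge by (intro divide_left_mono) auto
  also have "\<dots> = (2 * dist z w)\<^sup>2" by (simp add: dist_norm power_mult_distrib)
  finally show ?thesis by (rule power2_le_imp_le) simp
qed

lemma continuous_on_Fin [continuous_intros]:
  assumes "continuous_on S f" shows "continuous_on S (\<lambda>x. Fin (f x))"
proof (rule continuous_on_compose2[OF _ assms, of UNIV Fin])
  show "continuous_on UNIV Fin"
  proof (rule continuous_onI)
    fix z :: complex and e :: real assume e: "e > 0"
    then show "\<exists>d>0. \<forall>w\<in>UNIV. dist w z < d \<longrightarrow> dist (Fin w) (Fin z) \<le> e"
    proof (intro exI[of _ "e / 2"] conjI ballI impI)
      fix w assume "dist w z < e / 2"
      then show "dist (Fin w) (Fin z) \<le> e" using dist_Fin_le[of w z] by simp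
    qed auto
  qed
qed auto

lemma continuous_on_stereographic: "continuous_on S stereographic"
  unfolding continuous_on_iff dist_riemann_sphere_def by blast

lemma tendsto_Fin_Infty:
  assumes "filterlim f at_infinity F"
  shows "((\<lambda>x. Fin (f x)) \<longlongrightarrow> Infty) F"
  unfolding tendsto_iff
proof (intro allI impI)
  fix e :: real assume e: "e > 0"
  have "\<forall>\<^sub>F x in F. 2 / e + 1 \<le> cmod (f x)"
    using assms unfolding filterlim_at_infinity_conv_norm_at_top filterlim_at_top by blast
  then show "\<forall>\<^sub>F x in F. dist (Fin (f x)) Infty < e"
  proof eventually_elim
    case (elim x)
    have "2 / e < cmod (f x)" using elim by simp
    then have "2 < e * cmod (f x)" using e by (simp add: field_simps)
    then have "2 ^ 2 < (e * cmod (f x)) ^ 2" by (intro power_strict_mono) auto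
    then have "4 < e\<^sup>2 * ((cmod (f x))\<^sup>2 + 1)"
      using e by (simp add: power_mult_distrib algebra_simps add_strict_increasing2)
    then have "(dist (Fin (f x)) Infty)\<^sup>2 < e\<^sup>2"
      unfolding dist_Fin_Infty_sq by (simp add: divide_less_eq add_nonneg_pos)
    then show ?case using e by (meson power2_less_imp_less less_imp_le)
  qed
qed

lemma dist_Fin_Infty_ge:
  assumes "cmod z \<le> R" "R \<ge> 1"
  shows "dist (Fin z) Infty \<ge> 1 / R"
proof -
  have "(cmod z)\<^sup>2 \<le> R\<^sup>2" using assms by (intro power_mono) auto
  moreover have "1 \<le> R\<^sup>2" using assms by simp
  ultimately have "(cmod z)\<^sup>2 + 1 \<le> 4 * R\<^sup>2" by simp
  then have "4 / (4 * R\<^sup>2) \<le> 4 / ((cmod z)\<^sup>2 + 1)"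
    by (intro divide_left_mono) (use assms in \<open>auto simp: add_nonneg_pos\<close>)
  then have "(1 / R)\<^sup>2 \<le> (dist (Fin z) Infty)\<^sup>2"
    unfolding dist_Fin_Infty_sq by (simp add: power_divide)
  then show ?thesis by (rule power2_le_imp_le) simp
qed

lemma open_Fin_image:
  assumes "open U" shows "open (Fin ` U)"
proof -
  define P :: "(complex \<times> real) set" where "P = {q. snd q \<noteq> 1}"
  \<comment> \<open>\<open>f\<close> is the inverse of the stereographic projection, continuous away
    from the north pole, the point of height 1.\<close>
  define f where "f = (\<lambda>q :: complex \<times> real. fst q /\<^sub>R (1 - snd q))"
  have "open P" unfolding P_def by (intro open_Collect_neq continuous_intros)
  moreover have "continuous_on P f" unfolding f_def P_def by (intro continuous_intros) auto
  ultimately have "open (P \<inter> f -` U)" using continuous_open_preimage[of P f U] assms by (simp add: Int_commute vimage_def)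
  then have "open (stereographic -` (P \<inter> f -` U))"
    using continuous_on_stereographic by (rule open_vimage)
  also have "stereographic -` (P \<inter> f -` U) = Fin ` U"
  proof -
    have fin: "snd (stereographic (Fin z)) \<noteq> 1 \<and> f (stereographic (Fin z)) = z" for z
    proof -
      define A where "A = (cmod z)\<^sup>2 + 1"
      have A: "A > 0" by (auto simp: A_def add_nonneg_pos)
      have "snd (stereographic (Fin z)) = (A - 2) / A" by (simp add: A_def)
      moreover have "1 - (A - 2) / A = 2 / A" using A by (simp add: field_simps)
      moreover have "fst (stereographic (Fin z)) = (2 / A) *\<^sub>R z" by (simp add: A_def)
      ultimately show ?thesis using A by (simp add: f_def del: stereographic.simps)
    qed
    show ?thesis
    proof (intro set_eqI iffI)
      fix x assume "x \<in> stereographic -` (P \<inter> f -` U)"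
      then show "x \<in> Fin ` U" using fin by (cases x) (auto simp: P_def)
    next
      fix x assume "x \<in> Fin ` U"
      then show "x \<in> stereographic -` (P \<inter> f -` U)" using fin by (auto simp: P_def)
    qed
  qed
  finally show ?thesis .
qed

text \<open>A compact set that avoids \<open>Infty\<close> has positive distance from it, which
  bounds the moduli of its points.\<close>

lemma compact_Fin_vimage:
  assumes "compact K" "Infty \<notin> K"
  shows "compact (Fin -` K)"
proof -
  have cl: "closed (Fin -` K)"
    using assms continuous_on_Fin[OF continuous_on_id, of UNIV] by (intro closed_vimage) (auto simp: compact_imp_closed)
  have "closed K" using assms by (simp add: compact_imp_closed)
  then obtain e where "e > 0" "ball Infty e \<subseteq> - K"
    using assms(2) open_contains_ball[of "- K"] by (auto simp: open_Compl)
  then have e: "e > 0" "\<And>x. x \<in> K \<Longrightarrow> e \<le> dist Infty x" by force+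
  have "Fin -` K \<subseteq> cball 0 (2 / e)"
  proof
    fix z assume "z \<in> Fin -` K"
    then have "e \<le> dist (Fin z) Infty" using e(2)[of "Fin z"] by (simp add: dist_commute)
    then have "e\<^sup>2 \<le> 4 / ((cmod z)\<^sup>2 + 1)" unfolding dist_Fin_Infty_sq[symmetric] using e by (intro power_mono) auto
    then have "e\<^sup>2 * ((cmod z)\<^sup>2 + 1) \<le> 4" by (simp add: le_divide_eq add_nonneg_pos)
    then have "(e * cmod z)\<^sup>2 \<le> 2\<^sup>2" using e by (simp add: power_mult_distrib algebra_simps) (smt (verit) zero_le_power2)
    then have "e * cmod z \<le> 2" by (rule power2_le_imp_le) simp
    then show "z \<in> cball 0 (2 / e)" using e by (simp add: field_simps)
  qed
  with cl show ?thesis using bounded_cball bounded_subset compact_eq_bounded_closed by metis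
qed

section \<open>Inversion as a coordinate at infinity\<close>

fun sphere_inversion :: "riemann_sphere \<Rightarrow> riemann_sphere" where
  "sphere_inversion (Fin z) = (if z = 0 then Infty else Fin (1 / z))"
| "sphere_inversion Infty = Fin 0"

lemma sphere_inversion_involution [simp]: "sphere_inversion (sphere_inversion x) = x"
  by (cases x) auto

text \<open>On the unit sphere the inversion is the half-turn about the diameter through the images
  of 1 and -1.\<close>

lemma dist_sphere_inversion: "dist (sphere_inversion x) (sphere_inversion y) = dist x y"
proof -
  have 1: "(dist (Fin (1 / z)) (Fin (1 / w)))\<^sup>2 = (dist (Fin z) (Fin w))\<^sup>2" if "z \<noteq> 0" "w \<noteq> 0" for z w
  proof -
    define a b where "a = (cmod z)\<^sup>2" and "b = (cmod w)\<^sup>2"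
    have ab: "a > 0" "b > 0" using that by (auto simp: a_def b_def)
    have "1 / z - 1 / w = (w - z) / (z * w)" using that by (simp add: field_simps)
    then have e1: "(cmod (1 / z - 1 / w))\<^sup>2 = (cmod (z - w))\<^sup>2 / (a * b)"
      by (simp add: norm_divide norm_mult power_divide power_mult_distrib a_def b_def norm_minus_commute)
    have e2: "(cmod (1 / z))\<^sup>2 = 1 / a" "(cmod (1 / w))\<^sup>2 = 1 / b"
      by (auto simp: norm_divide power_divide a_def b_def)
    have e3: "4 * (X / (a * b)) / ((1 / a + 1) * (1 / b + 1)) = 4 * X / ((a + 1) * (b + 1))" for X
    proof -
      have "(1 / a + 1) * (1 / b + 1) = ((a + 1) * (b + 1)) / (a * b)" using ab by (simp add: field_simps)
      then show ?thesis using ab by simp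
    qed
    show ?thesis unfolding dist_Fin_sq e1 e2 e3 by (simp only: a_def b_def)
  qed
  have 2: "(dist (Fin (1 / z)) Infty)\<^sup>2 = (dist (Fin z) (Fin 0))\<^sup>2" if "z \<noteq> 0" for z
  proof -
    define a where "a = (cmod z)\<^sup>2"
    have a: "a > 0" using that by (auto simp: a_def)
    have "(cmod (1 / z))\<^sup>2 = 1 / a" by (auto simp: norm_divide power_divide a_def)
    then have "(dist (Fin (1 / z)) Infty)\<^sup>2 = 4 / (1 / a + 1)" by (simp add: dist_Fin_Infty_sq)
    also have "\<dots> = 4 * a / (a + 1)" using a by (simp add: field_simps)
    finally show ?thesis unfolding dist_Fin_sq by (simp add: a_def)
  qed
  have 1: "dist (Fin (1 / z)) (Fin (1 / w)) = dist (Fin z) (Fin w)" if "z \<noteq> 0" "w \<noteq> 0" for z w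
    using 1[OF that] by (rule power2_eq_imp_eq) auto
  have 2: "dist (Fin (1 / z)) Infty = dist (Fin z) (Fin 0)" if "z \<noteq> 0" for z
    using 2[OF that] by (rule power2_eq_imp_eq) auto
  have 3: "dist (Fin (1 / z)) (Fin 0) = dist (Fin z) Infty" if "z \<noteq> 0" for z
    using 2[of "1 / z"] that by simp
  have 4: "dist Infty (Fin (1 / z)) = dist (Fin 0) (Fin z)" "dist (Fin 0) (Fin (1 / z)) = dist Infty (Fin z)"
    if "z \<noteq> 0" for z using 2[OF that] 3[OF that] by (metis dist_commute)+
  show ?thesis
    by (cases x; cases y) (simp_all add: 1 2 3 4 dist_commute[of "Fin 0" Infty])
qed

lemma continuous_on_sphere_inversion: "continuous_on S sphere_inversion"
  unfolding continuous_on_iff dist_sphere_inversion by blast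

lemma compact_inversion_vimage:
  assumes "compact K" "Fin 0 \<notin> K"
  shows "compact ((\<lambda>w. sphere_inversion (Fin w)) -` K)"
proof -
  have "compact (sphere_inversion ` K)" using assms by (intro compact_continuous_image continuous_on_sphere_inversion)
  moreover have "Infty \<notin> sphere_inversion ` K"
    using assms by (metis imageE sphere_inversion.simps(2) sphere_inversion_involution)
  ultimately have "compact (Fin -` (sphere_inversion ` K))" by (rule compact_Fin_vimage)
  moreover have "x \<in> sphere_inversion ` K \<longleftrightarrow> sphere_inversion x \<in> K" for x
    by (metis image_iff sphere_inversion_involution)
  then have "Fin -` (sphere_inversion ` K) = (\<lambda>w. sphere_inversion (Fin w)) -` K"
    by (simp only: vimage_def)
  ultimately show ?thesis by simp
qed

section \<open>Montel's theorem for maps into the sphere\<close>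

text \<open>One transfer serves both \<open>Fin\<close> and the coordinate at \<open>Infty\<close>,
  so that normality can be tested by planar function theory.\<close>

lemma normal_family_on_chart:
  assumes inj: "inj \<psi>" and V: "V \<subseteq> range \<psi>"
    and cpt: "\<And>K. compact K \<Longrightarrow> K \<subseteq> V \<Longrightarrow> compact (\<psi> -` K)"
    and lim: "\<And>f :: nat \<Rightarrow> riemann_sphere \<Rightarrow> riemann_sphere. range f \<subseteq> \<F> \<Longrightarrow> \<exists>r l. strict_mono r \<and>
      (\<forall>K. compact K \<and> K \<subseteq> \<psi> -` V \<longrightarrow> uniform_limit K (\<lambda>n w. f (r n) (\<psi> w)) l sequentially)"
  shows "normal_family_on V \<F>"
  unfolding normal_family_on_def
proof (intro allI impI)
  fix f :: "nat \<Rightarrow> riemann_sphere \<Rightarrow> riemann_sphere" assume "range f \<subseteq> \<F>"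
  from lim[OF this] obtain r l where r: "strict_mono r"
    and l: "\<And>K. compact K \<Longrightarrow> K \<subseteq> \<psi> -` V \<Longrightarrow> uniform_limit K (\<lambda>n w. f (r n) (\<psi> w)) l sequentially" by blast
  show "\<exists>r l. strict_mono r \<and> (\<forall>K. compact K \<and> K \<subseteq> V \<longrightarrow> uniform_limit K (\<lambda>n. f (r n)) l sequentially)"
  proof (intro exI conjI allI impI)
    fix K assume K: "compact K \<and> K \<subseteq> V"
    have "uniform_limit (\<psi> -` K) (\<lambda>n w. f (r n) (\<psi> w)) l sequentially"
      using K by (intro l cpt) auto
    then show "uniform_limit K (\<lambda>n. f (r n)) (l \<circ> inv \<psi>) sequentially"
      unfolding uniform_limit_iff
    proof (intro allI impI)
      fix e :: real assume *: "\<forall>e>0. \<forall>\<^sub>F n in sequentially. \<forall>x\<in>\<psi> -` K. dist (f (r n) (\<psi> x)) (l x) < e" "e > 0"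
      then have "\<forall>\<^sub>F n in sequentially. \<forall>x\<in>\<psi> -` K. dist (f (r n) (\<psi> x)) (l x) < e" by blast
      then show "\<forall>\<^sub>F n in sequentially. \<forall>x\<in>K. dist (f (r n) x) ((l \<circ> inv \<psi>) x) < e"
      proof eventually_elim
        case (elim n)
        show ?case
        proof
          fix x assume x: "x \<in> K"
          then obtain w where w: "x = \<psi> w" using K V by blast
          then show "dist (f (r n) x) ((l \<circ> inv \<psi>) x) < e" using elim x inj by auto
        qed
      qed
    qed
  qed (rule r)
qed

text \<open>When functions with large values are replaced by their reciprocals, this map turns the
  reciprocals back into sphere-valued functions; a reciprocal 0 has to be read as
  \<open>Infty\<close>.\<close>

lemma continuous_on_inverse_chart:
  assumes "a \<noteq> 0"
  shows "continuous_on UNIV (\<lambda>w. if w = 0 then Infty else Fin (c + a / w))"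
proof -
  have "isCont (\<lambda>w. if w = 0 then Infty else Fin (c + a / w)) w" for w
  proof (cases "w = 0")
    case True
    have "filterlim (\<lambda>w. a / w) at_infinity (at 0)"
      using assms by (intro filterlim_divide_at_infinity[of "\<lambda>_. a" a]) (auto simp: filterlim_at eventually_at_filter)
    then have "filterlim (\<lambda>w. c + a / w) at_infinity (at 0)"
      by (intro tendsto_add_filterlim_at_infinity[OF tendsto_const])
    then have "((\<lambda>w. Fin (c + a / w)) \<longlongrightarrow> Infty) (at 0)" by (rule tendsto_Fin_Infty)
    then have "((\<lambda>w. if w = 0 then Infty else Fin (c + a / w)) \<longlongrightarrow> Infty) (at 0)"
      by (rule Lim_transform_eventually) (auto simp: eventually_at_filter)
    then show ?thesis using True by (simp add: isCont_def)
  next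
    case False
    have "continuous_on (- {0}) (\<lambda>w. Fin (c + a / w))" by (intro continuous_intros) auto
    then have "continuous_on (- {0}) (\<lambda>w. if w = 0 then Infty else Fin (c + a / w))"
      by (rule continuous_on_eq) auto
    then show ?thesis using False by (simp add: continuous_on_eq_continuous_at open_Compl)
  qed
  then show ?thesis by (simp add: continuous_at_imp_continuous_on)
qed

lemma uniform_limit_continuous_compose:
  fixes \<psi> :: "complex \<Rightarrow> 'b::metric_space"
  assumes "continuous_on UNIV \<psi>" "uniform_limit K u h sequentially" "\<And>n x. x \<in> K \<Longrightarrow> cmod (u n x) \<le> B"
  shows "uniform_limit K (\<lambda>n x. \<psi> (u n x)) (\<lambda>x. \<psi> (h x)) sequentially"
proof (rule uniform_limit_compose_uniformly_continuous_on[OF assms(2)])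
  show "uniformly_continuous_on (cball 0 B) \<psi>"
    using assms(1) by (intro compact_uniformly_continuous) (auto intro: continuous_on_subset)
  show "\<forall>\<^sub>F n in sequentially. \<forall>x\<in>K. u n x \<in> cball 0 B" using assms(3) by simp
qed auto

text \<open>Local boundedness confines the values to a compact disc, on which \<open>\<psi>\<close>
  is uniformly continuous, so the locally uniform limits of the planar theorem survive composition
  with \<open>\<psi>\<close>.\<close>

lemma montel_bounded:
  fixes u :: "nat \<Rightarrow> complex \<Rightarrow> complex"
  assumes "open S" "\<And>n. u n holomorphic_on S"
    and bd: "\<And>K. compact K \<Longrightarrow> K \<subseteq> S \<Longrightarrow> \<exists>B. \<forall>n. \<forall>z\<in>K. cmod (u n z) \<le> B"
    and \<psi>: "continuous_on UNIV \<psi>"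
  obtains r h where "strict_mono (r :: nat \<Rightarrow> nat)"
    "\<And>K. compact K \<Longrightarrow> K \<subseteq> S \<Longrightarrow> uniform_limit K (\<lambda>n z. \<psi> (u (r n) z) :: 'b::metric_space) (\<lambda>z. \<psi> (h z)) sequentially"
proof -
  obtain h r where h: "h holomorphic_on S" "strict_mono (r :: nat \<Rightarrow> nat)"
     "\<And>x. x \<in> S \<Longrightarrow> ((\<lambda>n. u (r n) x) \<longlongrightarrow> h x) sequentially"
     "\<And>K. \<lbrakk>compact K; K \<subseteq> S\<rbrakk> \<Longrightarrow> uniform_limit K (u \<circ> r) h sequentially"
  proof (rule Montel[OF assms(1), of "range u" u])
    show "f holomorphic_on S" if "f \<in> range u" for f using that assms(2) by auto
    show "\<exists>B. \<forall>h\<in>range u. \<forall>z\<in>K. cmod (h z) \<le> B" if "compact K" "K \<subseteq> S" for K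
      using bd[OF that] by auto
  qed auto
  show thesis
  proof
    show "strict_mono r" by (rule h)
    fix K assume K: "compact K" "K \<subseteq> S"
    obtain B where "\<And>n z. z \<in> K \<Longrightarrow> cmod (u n z) \<le> B" using bd[OF K] by blast
    then show "uniform_limit K (\<lambda>n z. \<psi> (u (r n) z)) (\<lambda>z. \<psi> (h z)) sequentially"
      using h(4)[OF K] by (intro uniform_limit_continuous_compose[OF \<psi>, where B = B]) (auto simp: o_def)
  qed
qed

text \<open>Montel's fundamental normality test. After normalisation the omitted values are 0 and 1,
  and reciprocals omit them too. Either infinitely many functions are at most 1 in modulus at
  \<open>w\<close>, or infinitely many reciprocals are; by \<open>GPicard3\<close> such a subfamily
  is locally bounded.\<close>

lemma montel_two_values:
  fixes g :: "nat \<Rightarrow> complex \<Rightarrow> complex"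
  assumes S: "open S" "connected S" "S \<noteq> {}" and hol: "\<And>n. g n holomorphic_on S"
    and ab: "a \<noteq> b" and om: "\<And>n z. z \<in> S \<Longrightarrow> g n z \<noteq> a \<and> g n z \<noteq> b"
  shows "\<exists>r l. strict_mono (r :: nat \<Rightarrow> nat) \<and>
    (\<forall>K. compact K \<and> K \<subseteq> S \<longrightarrow> uniform_limit K (\<lambda>n z. Fin (g (r n) z)) l sequentially)"
proof -
  obtain w where w: "w \<in> S" using S by blast
  define f where "f = (\<lambda>n z. (g n z - a) / (b - a))"
  have gf: "g n z = a + (b - a) * f n z" for n z using ab by (simp add: f_def)
  have holf: "f n holomorphic_on S" for n unfolding f_def using ab hol by (intro holomorphic_intros) auto
  have f01: "f n z \<noteq> 0 \<and> f n z \<noteq> 1" if "z \<in> S" for n z using om[OF that, of n] ab by (auto simp: f_def)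
  have bd: "\<exists>B. \<forall>n. \<forall>z\<in>K. cmod (u n z) \<le> B"
    if "\<And>n. u n holomorphic_on S" "\<And>n z. z \<in> S \<Longrightarrow> u n z \<noteq> 0 \<and> u n z \<noteq> 1" "\<And>n. cmod (u n w) \<le> 1" "compact K" "K \<subseteq> S"
    for u :: "nat \<Rightarrow> complex \<Rightarrow> complex" and K
  proof (rule GPicard3[OF S(1,2) w, of "range u" "range u" K])
    fix B assume "\<And>h z. h \<in> range u \<Longrightarrow> z \<in> K \<Longrightarrow> cmod (h z) \<le> B"
    then show ?thesis by blast
  qed (use that in auto)
  show ?thesis
  proof (cases "infinite {n. cmod (f n w) \<le> 1}")
    case True
    then obtain s where s: "strict_mono (s :: nat \<Rightarrow> nat)" "\<And>n. cmod (f (s n) w) \<le> 1"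
      using infinite_enumerate[OF True] by auto
    obtain r h where r: "strict_mono (r :: nat \<Rightarrow> nat)"
      "\<And>K. compact K \<Longrightarrow> K \<subseteq> S \<Longrightarrow> uniform_limit K (\<lambda>n z. Fin (a + (b - a) * f (s (r n)) z)) (\<lambda>z. Fin (a + (b - a) * h z)) sequentially"
    proof (rule montel_bounded[OF S(1), of "\<lambda>n. f (s n)" "\<lambda>z. Fin (a + (b - a) * z)"])
      show "\<exists>B. \<forall>n. \<forall>z\<in>K. cmod (f (s n) z) \<le> B" if "compact K" "K \<subseteq> S" for K
        using that s f01 holf by (intro bd) auto
    qed (use holf in \<open>auto intro!: continuous_intros\<close>)
    then show ?thesis using s(1) strict_mono_o[OF s(1) r(1)] by (auto simp: gf o_def)
  next
    case False
    then have "infinite (- {n. cmod (f n w) \<le> 1})" by (simp add: infinite_imp_nonempty Compl_eq_Diff_UNIV)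
    then obtain s where s: "strict_mono (s :: nat \<Rightarrow> nat)" "\<And>n. cmod (f (s n) w) > 1"
      using infinite_enumerate[of "- {n. cmod (f n w) \<le> 1}"] by (auto simp: not_le)
    define u where "u = (\<lambda>n z. 1 / f (s n) z)"
    have cont: "continuous_on UNIV (\<lambda>w. if w = 0 then Infty else Fin (a + (b - a) / w))"
      using ab by (intro continuous_on_inverse_chart) auto
    obtain r h where r: "strict_mono (r :: nat \<Rightarrow> nat)"
      "\<And>K. compact K \<Longrightarrow> K \<subseteq> S \<Longrightarrow> uniform_limit K (\<lambda>n z. if u (r n) z = 0 then Infty else Fin (a + (b - a) / u (r n) z))
         (\<lambda>z. if h z = 0 then Infty else Fin (a + (b - a) / h z)) sequentially"
    proof (rule montel_bounded[OF S(1), of u, OF _ _ cont])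
      show hu: "u n holomorphic_on S" for n unfolding u_def using f01 holf by (intro holomorphic_intros) auto
      show "\<exists>B. \<forall>n. \<forall>z\<in>K. cmod (u n z) \<le> B" if "compact K" "K \<subseteq> S" for K
      proof (rule bd)
        show "cmod (u n w) \<le> 1" for n using s(2)[of n] by (simp add: u_def norm_divide divide_le_eq)
        show "u n z \<noteq> 0 \<and> u n z \<noteq> 1" if "z \<in> S" for n z using f01[OF that, of "s n"] by (auto simp: u_def)
      qed (use that hu in auto)
    qed auto
    have eq: "(if u n z = 0 then Infty else Fin (a + (b - a) / u n z)) = Fin (g (s n) z)" if "z \<in> S" for n z
      using f01[OF that, of "s n"] by (simp add: u_def gf)
    have "uniform_limit K (\<lambda>n z. Fin (g ((s \<circ> r) n) z)) (\<lambda>z. if h z = 0 then Infty else Fin (a + (b - a) / h z)) sequentially"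
      if "compact K" "K \<subseteq> S" for K
    proof -
      note ul = r(2)[OF that]
      have "(if u (r n) z = 0 then Infty else Fin (a + (b - a) / u (r n) z)) = Fin (g ((s \<circ> r) n) z)" if "z \<in> K" for n z
        using eq[of z "r n"] that \<open>K \<subseteq> S\<close> by auto
      then show ?thesis using ul unfolding uniform_limit_iff by simp
    qed
    then show ?thesis using strict_mono_o[OF s(1) r(1)] by blast
  qed
qed

section \<open>Julia sets of semigroups\<close>

text \<open>The fixed point equation of \<open>Psi p \<circ> Psi q\<close>. With \<open>d\<close>
  and \<open>e\<close> the degrees, the weights \<open>d - 1\<close> and \<open>d * (e - 1)\<close>
  add up to \<open>d * e - 1\<close>, so the capacity of a composition is a weighted mean.\<close>

lemma log_cap_pcompose:
  assumes p: "degree p \<ge> 2" and q: "degree q \<ge> 2"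
  shows "(real (degree p) * real (degree q) - 1) * log_cap (pcompose p q) =
    (real (degree p) - 1) * log_cap p + real (degree p) * (real (degree q) - 1) * log_cap q"
proof -
  define x where "x = log_cap (pcompose p q)"
  have deg: "degree (pcompose p q) = degree p * degree q" by (simp add: degree_pcompose)
  have "2 * 1 \<le> degree p * degree q" using p q by (intro mult_le_mono) auto
  then have "Psi (pcompose p q) x = x" using Psi_fixed_iff[of "pcompose p q" x] deg by (simp add: x_def)
  then have "Psi p (Psi q x) = x" using Psi_pcompose[of p q] p q by simp
  then have "log_cap p + real (degree p) * (log_cap q + real (degree q) * (x - log_cap q) - log_cap p) = x"
    unfolding Psi_eq_log_cap[OF p] Psi_eq_log_cap[OF q] .
  then show ?thesis unfolding x_def[symmetric] by (simp add: algebra_simps)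
qed

lemma log_cap_pcompose_bounds:
  assumes p: "degree p \<ge> 2" and q: "degree q \<ge> 2"
  shows "log_cap p \<le> M \<Longrightarrow> log_cap q \<le> M \<Longrightarrow> log_cap (pcompose p q) \<le> M"
    and "m \<le> log_cap p \<Longrightarrow> m \<le> log_cap q \<Longrightarrow> m \<le> log_cap (pcompose p q)"
proof -
  define d e where "d = real (degree p)" and "e = real (degree q)"
  have de: "d \<ge> 2" "e \<ge> 2" using p q by (auto simp: d_def e_def)
  have "2 * 2 \<le> d * e" using de by (intro mult_mono) auto
  then have pos: "d * e - 1 > 0" by simp
  note eq = log_cap_pcompose[OF p q, folded d_def e_def]
  show "log_cap (pcompose p q) \<le> M" if "log_cap p \<le> M" "log_cap q \<le> M"
  proof -
    have "(d * e - 1) * log_cap (pcompose p q) \<le> (d - 1) * M + d * (e - 1) * M"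
      unfolding eq using that de by (intro add_mono mult_left_mono) auto
    also have "\<dots> = (d * e - 1) * M" by (simp add: algebra_simps)
    finally show ?thesis using pos by simp
  qed
  show "m \<le> log_cap (pcompose p q)" if "m \<le> log_cap p" "m \<le> log_cap q"
  proof -
    have "(d - 1) * m + d * (e - 1) * m \<le> (d * e - 1) * log_cap (pcompose p q)"
      unfolding eq using that de by (intro add_mono mult_left_mono) auto
    moreover have "(d - 1) * m + d * (e - 1) * m = (d * e - 1) * m" by (simp add: algebra_simps)
    ultimately show ?thesis using pos by simp
  qed
qed

lemma log_cap_iter_poly:
  assumes p: "degree p \<ge> 2"
  shows "log_cap (iter_poly p (Suc n)) = log_cap p"
proof -
  have "2 * 1 \<le> degree p * degree p ^ n" using p by (intro mult_le_mono) auto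
  then have "degree (iter_poly p (Suc n)) \<ge> 2" unfolding degree_iter_poly by simp
  then show ?thesis using Psi_fixed_iff Psi_iter_poly[OF p, of "Suc n" "log_cap p"] by fastforce
qed

section \<open>Boundaries of filled Julia sets\<close>

lemma frontier_filled_nonempty:
  assumes p: "degree p \<ge> 2"
  shows "frontier (filled_julia p) \<noteq> {}"
proof -
  have "bounded (filled_julia p)" using compact_filled[OF p] by (rule compact_imp_bounded)
  then have "filled_julia p \<noteq> UNIV" using not_bounded_UNIV by metis
  then show ?thesis using filled_nonempty[OF p] by (simp add: frontier_not_empty)
qed

text \<open>The punctured plane is connected, so a one-point frontier would reduce the filled Julia
  set to that point. It would then fit into a disc too small for its capacity.\<close>

lemma frontier_filled_two_points:
  assumes p: "degree p \<ge> 2"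
  obtains a b where "a \<in> frontier (filled_julia p)" "b \<in> frontier (filled_julia p)" "a \<noteq> b"
proof -
  obtain a where a: "a \<in> frontier (filled_julia p)" using frontier_filled_nonempty[OF p] by blast
  have "\<exists>b\<in>frontier (filled_julia p). b \<noteq> a"
  proof (rule ccontr)
    assume "\<not> (\<exists>b\<in>frontier (filled_julia p). b \<noteq> a)"
    then have fr: "frontier (filled_julia p) \<subseteq> {a}" by blast
    have bd: "bounded (filled_julia p)" using compact_filled[OF p] by (rule compact_imp_bounded)
    have sub: "filled_julia p \<subseteq> {a}"
    proof (rule ccontr)
      assume "\<not> filled_julia p \<subseteq> {a}"
      then have 1: "- {a} \<inter> filled_julia p \<noteq> {}" by blast
      have "\<not> bounded (- {a})" by (simp add: cobounded_imp_unbounded)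
      then have 2: "- {a} - filled_julia p \<noteq> {}" using bd bounded_subset by blast
      have "connected (- {a})" using connected_punctured_universe[of a] by simp
      then have "- {a} \<inter> frontier (filled_julia p) \<noteq> {}" using 1 2 by (rule connected_Int_frontier)
      then show False using fr by blast
    qed
    have "log_cap p \<le> ln (exp (log_cap p - 1))"
      using sub by (intro log_cap_le_ln_radius[OF p, of _ a]) auto
    then show False by simp
  qed
  with a that show thesis by blast
qed

text \<open>The outside of the disc is connected and unbounded, so it is not contained in the filled
  Julia set; meeting that set, it would meet the frontier.\<close>

lemma filled_subset_cball_if_frontier:
  assumes p: "degree p \<ge> 2" and sub: "frontier (filled_julia p) \<subseteq> cball c R"
  shows "filled_julia p \<subseteq> cball c R"
proof (rule ccontr)
  assume "\<not> filled_julia p \<subseteq> cball c R"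
  then have 1: "- cball c R \<inter> filled_julia p \<noteq> {}" by blast
  have bd: "bounded (filled_julia p)" using compact_filled[OF p] by (rule compact_imp_bounded)
  have "\<not> bounded (- cball c R)" by (simp add: cobounded_imp_unbounded)
  then have 2: "- cball c R - filled_julia p \<noteq> {}" using bd bounded_subset by blast
  have "connected (- cball c R)" by (rule connected_complement_bounded_convex) auto
  then have "- cball c R \<inter> frontier (filled_julia p) \<noteq> {}" using 1 2 by (rule connected_Int_frontier)
  then show False using sub by blast
qed

lemma filled_decides_connected:
  assumes "connected U" "U \<inter> frontier (filled_julia p) = {}"
  shows "U \<subseteq> filled_julia p \<or> U \<inter> filled_julia p = {}"
  using connected_Int_frontier[OF assms(1), of "filled_julia p"] assms(2) by blast

lemma open_fatou_set: "open (fatou_set G)"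
  unfolding fatou_set_def open_subopen[of "Collect _"] by blast

lemma continuous_on_sphere_map_Fin: "continuous_on (Fin ` S) (sphere_map p)"
  unfolding continuous_on_iff
proof (intro ballI allI impI)
  fix x and \<epsilon> :: real assume x: "x \<in> Fin ` S" "\<epsilon> > 0"
  then obtain w where w: "x = Fin w" "w \<in> S" by blast
  have "continuous_on UNIV (\<lambda>z. Fin (poly p z))" by (intro continuous_on_Fin continuous_intros)
  then obtain d where d: "d > 0" "\<And>y. dist y w < d \<Longrightarrow> dist (Fin (poly p y)) (Fin (poly p w)) < \<epsilon>"
    using x(2) unfolding continuous_on_iff by (metis UNIV_I)
  have "open (Fin ` ball w d)" by (rule open_Fin_image) simp
  moreover have "x \<in> Fin ` ball w d" using w d by auto
  ultimately obtain d' where d': "d' > 0" "ball x d' \<subseteq> Fin ` ball w d" using open_contains_ball by blast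
  show "\<exists>d>0. \<forall>x'\<in>Fin ` S. dist x' x < d \<longrightarrow> dist (sphere_map p x') (sphere_map p x) < \<epsilon>"
  proof (intro exI conjI ballI impI)
    fix x' assume "x' \<in> Fin ` S" "dist x' x < d'"
    then have "x' \<in> Fin ` ball w d" using d'(2) by (auto simp: dist_commute subset_iff)
    then obtain y where "x' = Fin y" "dist w y < d" by auto
    then show "dist (sphere_map p x') (sphere_map p x) < \<epsilon>" using d(2)[of y] w by (simp add: dist_commute[of w y])
  qed (rule d')
qed

text \<open>A locally uniform limit would take the value \<open>\<infinity>\<close> at points arbitrarily near \<open>z\<close>, but not at \<open>z\<close>.\<close>

lemma escape_near_bounded_orbit_in_julia:
  assumes g: "\<And>n. g n \<in> G" and bd: "\<And>n. cmod (poly (g n) z) \<le> R"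
    and esc: "\<And>e. e > 0 \<Longrightarrow> \<exists>w. dist w z < e \<and> filterlim (\<lambda>n. poly (g n) w) at_infinity sequentially"
  shows "Fin z \<in> julia_set G"
proof (rule ccontr)
  assume "Fin z \<notin> julia_set G"
  then obtain U where U: "open U" "Fin z \<in> U" "normal_family_on U (sphere_map ` G)"
    by (auto simp: julia_set_def fatou_set_def)
  define f where "f = (\<lambda>n. sphere_map (g n))"
  have "range f \<subseteq> sphere_map ` G" unfolding f_def using g by blast
  from U(3)[unfolded normal_family_on_def, rule_format, OF this]
  obtain r l where r: "strict_mono (r :: nat \<Rightarrow> nat)"
    and l: "\<And>K. compact K \<Longrightarrow> K \<subseteq> U \<Longrightarrow> uniform_limit K (\<lambda>n. f (r n)) l sequentially"
    by blast
  have "open (Fin -` U)" by (intro open_vimage U continuous_on_Fin continuous_on_id)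
  then obtain e where e: "e > 0" "cball z e \<subseteq> Fin -` U" using U(2) open_contains_cball by blast
  define K where "K = Fin ` cball z e"
  have K: "compact K" "K \<subseteq> U"
    unfolding K_def using e by (auto intro!: compact_continuous_image continuous_on_Fin continuous_on_id)
  note ul = l[OF K]
  have lim: "(\<lambda>n. Fin (poly (g (r n)) w)) \<longlonglongrightarrow> l (Fin w)" if "w \<in> cball z e" for w
    using tendsto_uniform_limitI[OF ul, of "Fin w"] that by (simp add: K_def f_def)
  have linf: "l (Fin w) = Infty"
    if "w \<in> cball z e" "filterlim (\<lambda>n. poly (g n) w) at_infinity sequentially" for w
  proof -
    have "filterlim (\<lambda>n. poly (g (r n)) w) at_infinity sequentially"
      using filterlim_compose[OF that(2) filterlim_subseq[OF r]] .
    then have "(\<lambda>n. Fin (poly (g (r n)) w)) \<longlonglongrightarrow> Infty" by (rule tendsto_Fin_Infty)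
    with lim[OF that(1)] show ?thesis by (rule LIMSEQ_unique)
  qed
  have "continuous_on K (f n)" for n unfolding K_def f_def by (rule continuous_on_sphere_map_Fin)
  then have "continuous_on K l" using ul by (intro uniform_limit_theorem[OF _ ul]) auto
  then have cl: "continuous_on (cball z e) (\<lambda>w. l (Fin w))"
    by (intro continuous_on_compose2[of K l _ Fin] continuous_on_Fin continuous_on_id) (auto simp: K_def)
  have zc: "z \<in> cball z e" using e by simp
  have "l (Fin z) \<noteq> Infty"
  proof
    assume "l (Fin z) = Infty"
    then have "(\<lambda>n. Fin (poly (g (r n)) z)) \<longlonglongrightarrow> Infty" using lim[OF zc] by simp
    then have "\<forall>\<^sub>F n in sequentially. dist (Fin (poly (g (r n)) z)) Infty < 1 / max R 1"
      by (rule tendstoD) simp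
    then obtain n where "dist (Fin (poly (g (r n)) z)) Infty < 1 / max R 1"
      by (auto simp: eventually_sequentially)
    moreover have "cmod (poly (g (r n)) z) \<le> max R 1" using bd[of "r n"] by simp
    ultimately show False using dist_Fin_Infty_ge[of "poly (g (r n)) z" "max R 1"] by linarith
  qed
  then have "dist (l (Fin z)) Infty > 0" by simp
  then obtain d where d: "d > 0" "\<And>y. y \<in> cball z e \<Longrightarrow> dist y z < d \<Longrightarrow> dist (l (Fin y)) (l (Fin z)) < dist (l (Fin z)) Infty"
    using cl zc unfolding continuous_on_iff by metis
  obtain y where y: "dist y z < min d e" "filterlim (\<lambda>n. poly (g n) y) at_infinity sequentially"
    using esc[of "min d e"] d e by auto
  then have yc: "y \<in> cball z e" by (simp add: dist_commute)
  show False using d(2)[OF yc] y(1) linf[OF yc y(2)] by (simp add: dist_commute)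
qed

lemma frontier_filled_subset_julia:
  assumes p: "degree p \<ge> 2" and it: "\<And>n. iter_poly p (Suc n) \<in> G" and z: "z \<in> frontier (filled_julia p)"
  shows "Fin z \<in> julia_set G"
proof -
  obtain R where R: "\<And>z n. z \<in> filled_julia p \<Longrightarrow> cmod ((poly p ^^ n) z) \<le> R"
    using filled_bounded_orbits[OF p] by metis
  have zf: "z \<in> filled_julia p" using z frontier_filled_subset[OF p] by blast
  show ?thesis
  proof (rule escape_near_bounded_orbit_in_julia[OF it])
    show "cmod (poly (iter_poly p (Suc n)) z) \<le> R" for n
      unfolding poly_iter_poly by (rule R[OF zf])
    fix e :: real assume "e > 0"
    moreover have "z \<in> closure (- filled_julia p)" using z by (simp add: frontier_closures)
    ultimately obtain y where y: "y \<notin> filled_julia p" "dist y z < e"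
      unfolding closure_approachable by blast
    have "filterlim (\<lambda>n. (poly p ^^ Suc n) y) at_infinity sequentially"
      using filterlim_compose[OF filled_escape[OF p y(1)] filterlim_Suc] .
    then show "\<exists>w. dist w z < e \<and> filterlim (\<lambda>n. poly (iter_poly p (Suc n)) w) at_infinity sequentially"
      unfolding poly_iter_poly using y by blast
  qed
qed

lemma normal_family_two_omitted_values:
  assumes U: "open U" "connected U" "U \<noteq> {}" and ac: "a \<noteq> c"
    and om: "\<And>p z. p \<in> G \<Longrightarrow> z \<in> U \<Longrightarrow> poly p z \<noteq> a \<and> poly p z \<noteq> c"
  shows "normal_family_on (Fin ` U) (sphere_map ` G)"
proof (rule normal_family_on_chart[of Fin])
  show "inj Fin" by (simp add: inj_def)
  show "compact (Fin -` K)" if "compact K" "K \<subseteq> Fin ` U" for K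
    using that by (intro compact_Fin_vimage) auto
  fix f :: "nat \<Rightarrow> riemann_sphere \<Rightarrow> riemann_sphere" assume "range f \<subseteq> sphere_map ` G"
  then have "\<forall>n. \<exists>p\<in>G. f n = sphere_map p" by blast
  then obtain g where g: "\<And>n. g n \<in> G" "\<And>n. f n = sphere_map (g n)" by metis
  have "\<exists>r l. strict_mono (r :: nat \<Rightarrow> nat) \<and>
    (\<forall>K. compact K \<and> K \<subseteq> U \<longrightarrow> uniform_limit K (\<lambda>n z. Fin (poly (g (r n)) z)) l sequentially)"
    by (rule montel_two_values[OF U _ ac om[OF g(1)]]) (auto intro: holomorphic_on_poly)
  moreover have "Fin -` Fin ` U = U" by (auto simp: image_iff)
  ultimately show "\<exists>r l. strict_mono r \<and>
    (\<forall>K. compact K \<and> K \<subseteq> Fin -` Fin ` U \<longrightarrow> uniform_limit K (\<lambda>n w. f (r n) (Fin w)) l sequentially)"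
    by (simp add: g(2))
qed auto

text \<open>In the coordinate \<open>w = 1 / z\<close> the maps become \<open>1 / p (1 / w)\<close>,
  bounded by 1 with a removable singularity at 0, so Montel's theorem for bounded families
  applies.\<close>

lemma normal_family_near_Infty:
  assumes deg: "\<And>p. p \<in> G \<Longrightarrow> degree p \<ge> 1" and R: "R > 0"
    and big: "\<And>p z. p \<in> G \<Longrightarrow> cmod z \<ge> R \<Longrightarrow> cmod (poly p z) \<ge> 1"
  shows "normal_family_on (- Fin ` cball 0 R) (sphere_map ` G)"
proof (rule normal_family_on_chart[of "\<lambda>w. sphere_inversion (Fin w)"])
  let ?V = "- Fin ` cball 0 R" and ?\<psi> = "\<lambda>w. sphere_inversion (Fin w)"
  show "inj ?\<psi>" by (rule injI) (metis riemann_sphere.inject sphere_inversion_involution)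
  have "x \<in> range ?\<psi>" if "x \<in> ?V" for x
  proof (cases x)
    case (Fin z)
    then have "z \<noteq> 0" using that R by auto
    then have "x = ?\<psi> (1 / z)" using Fin by simp
    then show ?thesis by blast
  next
    case Infty
    then have "x = ?\<psi> 0" by simp
    then show ?thesis by blast
  qed
  then show "?V \<subseteq> range ?\<psi>" by blast
  show "compact (?\<psi> -` K)" if "compact K" "K \<subseteq> ?V" for K
    using that R by (intro compact_inversion_vimage) auto
  have V: "?\<psi> -` ?V = ball 0 (1 / R)"
  proof (intro set_eqI)
    fix w
    show "w \<in> ?\<psi> -` ?V \<longleftrightarrow> w \<in> ball 0 (1 / R)"
    proof (cases "w = 0")
      case False
      have "Fin (1 / w) \<in> Fin ` cball 0 R \<longleftrightarrow> cmod (1 / w) \<le> R" by auto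
      also have "\<dots> \<longleftrightarrow> \<not> cmod w < 1 / R" using R False by (simp add: norm_divide field_simps not_less)
      finally show ?thesis using False by simp
    qed (use R in auto)
  qed
  fix f :: "nat \<Rightarrow> riemann_sphere \<Rightarrow> riemann_sphere" assume "range f \<subseteq> sphere_map ` G"
  then have "\<forall>n. \<exists>p\<in>G. f n = sphere_map p" by blast
  then obtain g where g: "\<And>n. g n \<in> G" "\<And>n. f n = sphere_map (g n)" by metis
  define S where "S = ball (0::complex) (1 / R)"
  define u where "u = (\<lambda>n w. if w = 0 then 0 else 1 / poly (g n) (1 / w))"
  have low: "cmod (poly (g n) (1 / w)) \<ge> 1" if "w \<in> S" "w \<noteq> 0" for n w
    using that R by (intro big g) (simp add: S_def norm_divide field_simps)
  have bd: "cmod (u n w) \<le> 1" if "w \<in> S" for n w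
    using low[OF that, of n] R by (auto simp: u_def norm_divide divide_le_eq)
  have hol: "u n holomorphic_on S" for n
  proof (rule no_isolated_singularity')
    show "finite {0::complex}" by simp
    show "open S" by (simp add: S_def)
    show "u n holomorphic_on S - {0}"
    proof (rule holomorphic_transform[of "\<lambda>w. 1 / poly (g n) (1 / w)"])
      show "(\<lambda>w. 1 / poly (g n) (1 / w)) holomorphic_on S - {0}"
        using low[of _ n] R by (intro holomorphic_intros) force+
    qed (auto simp: u_def)
    fix z :: complex assume "z \<in> {0}"
    then have z: "z = 0" by simp
    have "filterlim (\<lambda>w. 1 / w) at_infinity (at (0::complex))"
      by (intro filterlim_divide_at_infinity[of "\<lambda>_. 1" 1]) (auto simp: filterlim_at eventually_at_filter)
    then have "filterlim (\<lambda>w. poly (g n) (1 / w)) at_infinity (at 0)"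
      using deg[OF g(1)[of n]] by (intro filterlim_compose[OF filterlim_poly_at_infinity]) auto
    then have "((\<lambda>w. 1 / poly (g n) (1 / w)) \<longlongrightarrow> 0) (at 0)"
      by (intro tendsto_divide_0[OF tendsto_const])
    then have "(u n \<longlongrightarrow> 0) (at 0)"
      by (rule Lim_transform_eventually) (auto simp: eventually_at_filter u_def)
    moreover have "u n 0 = 0" by (simp add: u_def)
    ultimately show "(u n \<longlongrightarrow> u n z) (at z within S)"
      unfolding z by (metis tendsto_within_subset subset_UNIV)
  qed
  have \<psi>c: "continuous_on UNIV ?\<psi>"
    by (rule continuous_on_compose2[OF continuous_on_sphere_inversion[of UNIV]]) (auto intro: continuous_on_Fin continuous_on_id)
  obtain r h where r: "strict_mono (r :: nat \<Rightarrow> nat)"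
    "\<And>K. compact K \<Longrightarrow> K \<subseteq> S \<Longrightarrow> uniform_limit K (\<lambda>n w. ?\<psi> (u (r n) w)) (\<lambda>w. ?\<psi> (h w)) sequentially"
  proof (rule montel_bounded[of S u, OF _ hol _ \<psi>c])
    show "\<exists>B. \<forall>n. \<forall>z\<in>K. cmod (u n z) \<le> B" if "compact K" "K \<subseteq> S" for K
      using bd that by blast
  qed (auto simp: S_def)
  have eq: "?\<psi> (u n w) = f n (?\<psi> w)" if "w \<in> S" for n w
    using low[OF that, of n] R by (auto simp: u_def g(2))
  have "uniform_limit K (\<lambda>n w. f (r n) (?\<psi> w)) (\<lambda>w. ?\<psi> (h w)) sequentially" if "compact K" "K \<subseteq> S" for K
  proof -
    have "\<And>n w. w \<in> K \<Longrightarrow> ?\<psi> (u (r n) w) = f (r n) (?\<psi> w)" using eq that by blast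
    then show ?thesis using r(2)[OF that] unfolding uniform_limit_iff by simp
  qed
  then show "\<exists>r l. strict_mono r \<and>
    (\<forall>K. compact K \<and> K \<subseteq> ?\<psi> -` ?V \<longrightarrow> uniform_limit K (\<lambda>n w. f (r n) (?\<psi> w)) l sequentially)"
    using r(1) unfolding V S_def by blast
qed

text \<open>The consequences of postcritical boundedness from which the rest is deduced: connected
  filled Julia sets with a point \<open>b\<close> in common.\<close>

locale connected_semigroup =
  fixes G :: "complex poly set" and b :: complex
  assumes nonempty: "G \<noteq> {}"
    and deg: "p \<in> G \<Longrightarrow> degree p \<ge> 2"
    and comp: "p \<in> G \<Longrightarrow> q \<in> G \<Longrightarrow> pcompose p q \<in> G"
    and base: "p \<in> G \<Longrightarrow> b \<in> filled_julia p"
    and conn: "p \<in> G \<Longrightarrow> connected (filled_julia p)"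
begin

lemma iter_in: "p \<in> G \<Longrightarrow> iter_poly p (Suc n) \<in> G"
  by (induction n) (auto intro: comp simp: pcompose_idR)

text \<open>Because all filled Julia sets contain \<open>b\<close>, a bound on the capacity controls
  their position as well as their size.\<close>

lemma filled_subset_cball:
  assumes p: "p \<in> G" and "log_cap p \<le> M"
  shows "filled_julia p \<subseteq> cball b (2 * exp 1 * exp M)"
proof
  fix z assume "z \<in> filled_julia p"
  then have "dist b z \<le> 2 * exp 1 * exp (log_cap p)"
    using dist_filled_le[OF deg[OF p] conn[OF p] base[OF p]] by blast
  also have "\<dots> \<le> 2 * exp 1 * exp M" using assms by simp
  finally show "z \<in> cball b (2 * exp 1 * exp M)" by simp
qed

text \<open>If \<open>poly g u\<close> lay on the boundary for \<open>h\<close>, the elements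
  \<open>f k\<close>, an iterate of \<open>h\<close> after \<open>g\<close>, would be bounded at
  \<open>u\<close> and escape at points arbitrarily near. Their capacities stay between
  \<open>m\<close> and \<open>M\<close>, so their filled Julia sets stay in one disc and contain a
  point \<open>q k\<close> at a definite distance from \<open>b\<close>. For large \<open>k\<close>
  the domain \<open>U\<close> misses \<open>filled_julia (f k)\<close>, so \<open>f k\<close> omits
  \<open>b\<close> and \<open>q k\<close> on \<open>U\<close>. Then \<open>GPicard1\<close> bounds
  the \<open>f k\<close> uniformly near \<open>u\<close>, against the escape.\<close>

lemma forward_disjoint:
  assumes U: "open U" "connected U" and dis: "\<And>p. p \<in> G \<Longrightarrow> U \<inter> frontier (filled_julia p) = {}"
    and g: "g \<in> G" and h: "h \<in> G" and u: "u \<in> U"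
  shows "poly g u \<notin> frontier (filled_julia h)"
proof
  assume fu: "poly g u \<in> frontier (filled_julia h)"
  note dg = deg[OF g] and dh = deg[OF h]
  define f where "f = (\<lambda>k. pcompose (iter_poly h (Suc k)) g)"
  have fG: "f k \<in> G" for k unfolding f_def by (intro comp iter_in g h)
  have pf: "poly (f k) z = (poly h ^^ Suc k) (poly g z)" for k z
    by (simp add: f_def poly_pcompose poly_iter_poly del: iter_poly.simps funpow.simps)
  define M m where "M = max (log_cap h) (log_cap g)" and "m = min (log_cap h) (log_cap g)"
  have lc: "m \<le> log_cap (f k) \<and> log_cap (f k) \<le> M" for k
    unfolding f_def M_def m_def
    using log_cap_pcompose_bounds(1)[OF deg[OF iter_in[OF h]] dg, of k "max (log_cap h) (log_cap g)"]
      log_cap_pcompose_bounds(2)[OF deg[OF iter_in[OF h]] dg, of "min (log_cap h) (log_cap g)" k]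
      log_cap_iter_poly[OF dh, of k]
    by (simp del: iter_poly.simps)
  define R where "R = 2 * exp 1 * exp M"
  have fR: "filled_julia (f k) \<subseteq> cball b R" for k
    unfolding R_def using lc by (intro filled_subset_cball fG) auto
  \<comment> \<open>Inside the disc of radius \<open>exp (m - 1)\<close> the set would have
    \<open>log_cap\<close> at most \<open>m - 1\<close>. The distance found here keeps the omitted
    values \<open>b\<close> and \<open>q k\<close> from merging as \<open>k\<close> grows.\<close>
  have "\<exists>q\<in>filled_julia (f k). dist b q > exp (m - 1)" for k
  proof (rule ccontr)
    assume "\<not> ?thesis"
    then have "filled_julia (f k) \<subseteq> cball b (exp (m - 1))" by force
    then have "log_cap (f k) \<le> ln (exp (m - 1))" by (intro log_cap_le_ln_radius deg fG) auto
    then show False using lc[of k] by simp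
  qed
  then obtain q where q: "\<And>k. q k \<in> filled_julia (f k)" "\<And>k. dist b (q k) > exp (m - 1)" by metis
  have escape: "\<exists>y\<in>W. filterlim (\<lambda>k. poly (f k) y) at_infinity sequentially" if W: "open W" "u \<in> W" for W
  proof -
    have "open (poly g ` W)" using W dg by (intro open_poly_image) auto
    moreover have "poly g u \<in> poly g ` W" using W by blast
    moreover have "poly g u \<notin> interior (filled_julia h)" using fu by (auto simp: frontier_def)
    ultimately have "\<not> poly g ` W \<subseteq> filled_julia h" by (auto simp: interior_def)
    then obtain y where y: "y \<in> W" "poly g y \<notin> filled_julia h" by blast
    have "filterlim (\<lambda>k. (poly h ^^ Suc k) (poly g y)) at_infinity sequentially"
      using filterlim_compose[OF filled_escape[OF dh y(2)] filterlim_Suc] .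
    then show ?thesis using y by (auto simp: pf)
  qed
  have large: "\<forall>\<^sub>F k in sequentially. poly (f k) y \<notin> cball b C" if "filterlim (\<lambda>k. poly (f k) y) at_infinity sequentially" for y C
  proof -
    have "\<forall>\<^sub>F k in sequentially. C + cmod b + 1 \<le> cmod (poly (f k) y)"
      using that unfolding filterlim_at_infinity_conv_norm_at_top filterlim_at_top by blast
    then show ?thesis
    proof eventually_elim
      case (elim k)
      then show ?case using norm_triangle_ineq2[of "poly (f k) y" b] by (simp add: dist_norm norm_minus_commute)
    qed
  qed
  obtain y where y: "y \<in> U" "filterlim (\<lambda>k. poly (f k) y) at_infinity sequentially"
    using escape[OF U(1) u] by blast
  obtain N where N: "\<And>k. k \<ge> N \<Longrightarrow> poly (f k) y \<notin> cball b R"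
    using large[OF y(2), of R] by (auto simp: eventually_sequentially)
  have disj: "U \<inter> filled_julia (f k) = {}" if "k \<ge> N" for k
  proof -
    have "\<not> U \<subseteq> filled_julia (f k)"
      using N[OF that] y(1) fR[of k] poly_in_filled_iff[of "f k" y] by blast
    then show ?thesis using filled_decides_connected[OF U(2) dis[OF fG]] by blast
  qed
  \<comment> \<open>The omitted values \<open>b\<close> and \<open>q k\<close> become 0 and 1. Since
    \<open>q k - b\<close> has modulus between \<open>exp (m - 1)\<close> and \<open>R\<close>,
    bounds for \<open>\<phi> k\<close> and for \<open>f k\<close> are equivalent, uniformly in
    \<open>k\<close>.\<close>
  define \<phi> where "\<phi> = (\<lambda>k z. (poly (f k) z - b) / (q k - b))"
  have qb: "q k \<noteq> b" for k using q(2)[of k] by (smt (verit) dist_self exp_gt_zero)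
  have om: "\<phi> k z \<noteq> 0 \<and> \<phi> k z \<noteq> 1" if "k \<ge> N" "z \<in> U" for k z
  proof -
    have "poly (f k) z \<notin> filled_julia (f k)" using disj[OF that(1)] that(2) poly_in_filled_iff[of "f k" z] by blast
    then have "poly (f k) z \<noteq> b" "poly (f k) z \<noteq> q k" using base[OF fG] q(1) by metis+
    then show ?thesis using qb[of k] by (auto simp: \<phi>_def)
  qed
  obtain Rh where Rh: "\<And>z n. z \<in> filled_julia h \<Longrightarrow> cmod ((poly h ^^ n) z) \<le> Rh"
    using filled_bounded_orbits[OF dh] by metis
  have guh: "poly g u \<in> filled_julia h" using fu frontier_filled_subset[OF dh] by blast
  define C where "C = max 1 ((Rh + cmod b) / exp (m - 1))"
  have bd: "cmod (\<phi> k u) \<le> C" for k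
  proof -
    have "cmod (poly (f k) u - b) \<le> Rh + cmod b"
      using Rh[OF guh, of "Suc k"] norm_triangle_ineq4[of "poly (f k) u" b] unfolding pf by linarith
    moreover have "cmod (q k - b) \<ge> exp (m - 1)" using q(2)[of k] by (simp add: dist_norm norm_minus_commute)
    ultimately have "cmod (\<phi> k u) \<le> (Rh + cmod b) / exp (m - 1)"
      unfolding \<phi>_def norm_divide by (intro frac_le) (auto intro: order.trans[OF norm_ge_zero])
    then show ?thesis by (simp add: C_def)
  qed
  have "C > 0" by (simp add: C_def)
  have hol: "\<phi> k holomorphic_on U" for k
    unfolding \<phi>_def using qb by (intro holomorphic_intros) auto
  obtain B Z where B: "0 < B" "open Z" "u \<in> Z" "Z \<subseteq> U" "\<And>h z. h \<in> \<phi> ` {N..} \<Longrightarrow> z \<in> Z \<Longrightarrow> cmod (h z) \<le> B"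
    by (rule GPicard1[OF U u \<open>C > 0\<close> order_refl, of "\<phi> ` {N..}"]) (use hol om bd in auto)
  obtain y' where y': "y' \<in> Z" "filterlim (\<lambda>k. poly (f k) y') at_infinity sequentially"
    using escape[OF B(2,3)] by blast
  obtain N' where N': "\<And>k. k \<ge> N' \<Longrightarrow> poly (f k) y' \<notin> cball b (B * R)"
    using large[OF y'(2), of "B * R"] by (auto simp: eventually_sequentially)
  define k where "k = max N N'"
  have "cmod (\<phi> k y') \<le> B" using B(5)[of "\<phi> k" y'] y' by (auto simp: k_def)
  then have "cmod (poly (f k) y' - b) \<le> B * cmod (q k - b)"
    using qb[of k] by (simp add: \<phi>_def norm_divide divide_le_eq)
  also have "\<dots> \<le> B * R"
    using fR[of k] q(1)[of k] B(1) by (intro mult_left_mono) (auto simp: dist_norm norm_minus_commute)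
  finally show False using N'[of k] by (simp add: k_def dist_norm norm_minus_commute)
qed

text \<open>The omitted values are two points on the boundary for one fixed element
  \<open>h\<close>, hence the same for the whole semigroup.\<close>

lemma normal_near_finite:
  assumes U: "open U" "connected U" "U \<noteq> {}" and dis: "\<And>p. p \<in> G \<Longrightarrow> U \<inter> frontier (filled_julia p) = {}"
  shows "normal_family_on (Fin ` U) (sphere_map ` G)"
proof -
  obtain h where h: "h \<in> G" using nonempty by blast
  obtain a c where "a \<in> frontier (filled_julia h)" "c \<in> frontier (filled_julia h)" "a \<noteq> c"
    using frontier_filled_two_points[OF deg[OF h]] by metis
  then show ?thesis
    using forward_disjoint[OF U(1,2) dis _ h] by (intro normal_family_two_omitted_values[OF U, of a c]) metis+
qed

text \<open>The zeros of \<open>p - [:b:]\<close> lie in \<open>filled_julia p\<close>, so every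
  linear factor is at least \<open>2 * R\<close>, and \<open>log_cap p \<le> ln R\<close> keeps the
  leading coefficient from being small. The powers of \<open>R\<close> cancel up to one, and degree
  at least 2 leaves the factor 4. The estimate depends on \<open>p\<close> only through
  \<open>R\<close>.\<close>

lemma poly_lower_bound:
  assumes p: "p \<in> G" and R: "R > 0" "filled_julia p \<subseteq> cball 0 R" and z: "cmod z \<ge> 3 * R"
  shows "cmod (poly p z - b) \<ge> 4 * R"
proof -
  define P where "P = p - [:b:]"
  note dp = deg[OF p]
  have P: "degree P = degree p" "lead_coeff P = lead_coeff p"
    using degree_lead_coeff_diff_const[of p b] dp by (auto simp: P_def)
  obtain r where r: "\<And>z. poly P z = lead_coeff P * (\<Prod>i<degree P. z - r i)"
    "\<And>i. i < degree P \<Longrightarrow> poly P (r i) = 0" using poly_roots_product by blast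
  have "2 * R \<le> cmod (z - r i)" if "i < degree P" for i
  proof -
    have "poly p (r i) = b" using r(2)[OF that] by (simp add: P_def)
    then have "r i \<in> filled_julia p" using base[OF p] poly_in_filled_iff[of p "r i"] by simp
    then have "cmod (r i) \<le> R" using R by auto
    then show ?thesis using z norm_triangle_ineq2[of z "r i"] by simp
  qed
  then have "(\<Prod>i<degree P. 2 * R) \<le> (\<Prod>i<degree P. cmod (z - r i))"
    using R by (intro prod_mono) auto
  then have 1: "(2 * R) ^ degree p \<le> (\<Prod>i<degree P. cmod (z - r i))" by (simp add: P)
  have lp: "cmod (lead_coeff p) > 0" using dp by auto
  have "log_cap p \<le> ln R" using R by (intro log_cap_le_ln_radius[OF dp])
  then have "- ln (cmod (lead_coeff p)) \<le> ln R * (real (degree p) - 1)"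
    unfolding log_cap_def using dp by (subst (asm) pos_divide_le_eq) auto
  then have "- ln (cmod (lead_coeff p)) \<le> ln (R ^ (degree p - 1))"
    using dp R by (simp add: ln_realpow of_nat_diff mult.commute)
  then have "ln (1 / R ^ (degree p - 1)) \<le> ln (cmod (lead_coeff p))" using R by (simp add: ln_div)
  then have 2: "1 / R ^ (degree p - 1) \<le> cmod (lead_coeff p)"
    using lp R by (subst (asm) ln_le_cancel_iff) auto
  have "4 * R \<le> 2 ^ degree p * R"
    using dp R power_increasing[of 2 "degree p" "2::real"] by (intro mult_right_mono) auto
  also have "\<dots> = 1 / R ^ (degree p - 1) * (2 * R) ^ degree p"
  proof -
    have "R ^ degree p = R * R ^ (degree p - 1)" using dp by (simp add: power_eq_if)
    then show ?thesis using R by (simp add: power_mult_distrib)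
  qed
  also have "\<dots> \<le> cmod (lead_coeff p) * (\<Prod>i<degree P. cmod (z - r i))"
    using 1 2 R by (intro mult_mono) auto
  also have "\<dots> = cmod (poly P z)" by (subst r(1), subst P(2)) (simp add: norm_mult prod_norm[symmetric])
  finally show ?thesis by (simp add: P_def)
qed

lemma normal_near_infinity:
  assumes R: "R \<ge> 1" "cmod b \<le> R" and sub: "\<And>p. p \<in> G \<Longrightarrow> filled_julia p \<subseteq> cball 0 R"
  shows "normal_family_on (- Fin ` cball 0 (3 * R)) (sphere_map ` G)"
proof (rule normal_family_near_Infty)
  show "degree p \<ge> 1" if "p \<in> G" for p using deg[OF that] by simp
  show "1 \<le> cmod (poly p z)" if "p \<in> G" "3 * R \<le> cmod z" for p z
  proof -
    have "cmod (poly p z - b) \<ge> 4 * R"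
      using R that by (intro poly_lower_bound sub) auto
    then show ?thesis using norm_triangle_ineq4[of "poly p z" b] R by linarith
  qed
qed (use R in simp)

text \<open>Off the closure, normality at a finite point comes from omitted values. At
  \<open>Infty\<close>, a neighbourhood free of boundaries confines all boundaries, hence all filled
  Julia sets, to one disc, and the lower bound outside a larger disc applies.\<close>

theorem julia_set_eq_closure:
  "julia_set G = closure (Fin ` (\<Union>p\<in>G. frontier (filled_julia p)))"
proof
  define E where "E = closure (Fin ` (\<Union>p\<in>G. frontier (filled_julia p)))"
  have "Fin ` (\<Union>p\<in>G. frontier (filled_julia p)) \<subseteq> julia_set G"
    using frontier_filled_subset_julia[OF deg iter_in] by blast
  then show "closure (Fin ` (\<Union>p\<in>G. frontier (filled_julia p))) \<subseteq> julia_set G"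
    using open_fatou_set by (intro closure_minimal) (auto simp: julia_set_def)
  show "julia_set G \<subseteq> closure (Fin ` (\<Union>p\<in>G. frontier (filled_julia p)))"
  proof (rule ccontr)
    assume "\<not> ?thesis"
    then obtain x where x: "x \<in> julia_set G" "x \<notin> E" by (auto simp: E_def)
    have oE: "open (- E)" by (simp add: E_def open_Compl)
    have inE: "Fin z \<in> E" if "p \<in> G" "z \<in> frontier (filled_julia p)" for p z
      using that closure_subset[of "Fin ` (\<Union>p\<in>G. frontier (filled_julia p))"] by (auto simp: E_def)
    have "x \<in> fatou_set G"
    proof (cases x)
      case (Fin z)
      have "open (Fin -` (- E))" by (intro open_vimage oE continuous_on_Fin continuous_on_id)
      then obtain e where e: "e > 0" "ball z e \<subseteq> Fin -` (- E)"
        using x Fin open_contains_ball by blast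
      have "normal_family_on (Fin ` ball z e) (sphere_map ` G)"
        using e inE by (intro normal_near_finite) auto
      moreover have "open (Fin ` ball z e)" by (rule open_Fin_image) simp
      ultimately show ?thesis using Fin e unfolding fatou_set_def by force
    next
      case Infty
      have "\<exists>R. \<forall>p\<in>G. frontier (filled_julia p) \<subseteq> cball 0 R"
      proof (rule ccontr)
        assume "\<not> ?thesis"
        then have "\<forall>n::nat. \<exists>z. Fin z \<in> E \<and> real n \<le> cmod z" using inE by (meson less_le_not_le linorder_not_le mem_cball_0 subsetI)
        then obtain zs where zs: "\<And>n. Fin (zs n) \<in> E" "\<And>n. real n \<le> cmod (zs n)" by metis
        have "filterlim zs at_infinity sequentially"
          unfolding filterlim_at_infinity_conv_norm_at_top
          using zs(2) by (intro filterlim_at_top_mono[OF filterlim_real_sequentially]) auto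
        then have "(\<lambda>n. Fin (zs n)) \<longlonglongrightarrow> Infty" by (rule tendsto_Fin_Infty)
        then have "Infty \<in> E" using zs(1) closed_sequentially[of E "\<lambda>n. Fin (zs n)" Infty] by (simp add: E_def)
        then show False using x Infty by simp
      qed
      then obtain R0 where R0: "\<And>p. p \<in> G \<Longrightarrow> frontier (filled_julia p) \<subseteq> cball 0 R0" by blast
      define R where "R = max 1 (max (cmod b) R0)"
      have "filled_julia p \<subseteq> cball 0 R" if "p \<in> G" for p
        using R0[OF that] by (intro filled_subset_cball_if_frontier deg that) (auto simp: R_def)
      then have "normal_family_on (- Fin ` cball 0 (3 * R)) (sphere_map ` G)"
        by (intro normal_near_infinity) (auto simp: R_def)
      moreover have "compact (Fin ` cball 0 (3 * R))"
        by (intro compact_continuous_image continuous_on_Fin continuous_on_id) auto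
      then have "open (- Fin ` cball 0 (3 * R))" by (simp add: compact_imp_closed open_Compl)
      moreover have "x \<in> - Fin ` cball 0 (3 * R)" using Infty by auto
      ultimately show ?thesis unfolding fatou_set_def by blast
    qed
    then show False using x by (simp add: julia_set_def)
  qed
qed

end

section \<open>Components and capacities\<close>

lemma compact_UNIV_sphere: "compact (UNIV :: riemann_sphere set)"
proof -
  have 1: "compact (Fin ` cball 0 1)"
    by (intro compact_continuous_image continuous_on_Fin continuous_on_id) auto
  then have "compact (sphere_inversion ` Fin ` cball 0 1)"
    by (rule compact_continuous_image[OF continuous_on_sphere_inversion])
  with 1 have "compact (Fin ` cball 0 1 \<union> sphere_inversion ` Fin ` cball 0 1)" by (rule compact_Un)
  moreover have "x \<in> Fin ` cball 0 1 \<union> sphere_inversion ` Fin ` cball 0 1" for x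
  proof (cases x)
    case (Fin z)
    show ?thesis
    proof (cases "cmod z \<le> 1")
      case False
      then have "x = sphere_inversion (Fin (1 / z))" "1 / z \<in> cball 0 1"
        using Fin by (auto simp: norm_divide divide_le_eq)
      then show ?thesis by blast
    qed (use Fin in auto)
  next
    case Infty
    then have "x = sphere_inversion (Fin 0)" by simp
    then show ?thesis by (metis UnI2 centre_in_cball image_eqI zero_le_one)
  qed
  ultimately show ?thesis by (metis UNIV_eq_I)
qed

lemma continuous_on_inv_Fin: "continuous_on (range Fin) (inv Fin)"
proof (rule continuous_on_inverse_open_map[of UNIV Fin])
  show "continuous_on UNIV Fin" by (intro continuous_on_Fin continuous_on_id)
  show "inv Fin (Fin x) = x" for x by (simp add: inj_def)
  show "openin (top_of_set (range Fin)) (Fin ` U)" if "openin (top_of_set UNIV) U" for U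
    using that open_Fin_image[of U] by (auto simp: openin_open)
qed auto

lemma connected_components_mono_image:
  assumes cont: "continuous_on T g" and K: "connected K" "K \<subseteq> T" "g ` K \<subseteq> S" and x: "x \<in> K" "y \<in> K"
    and C: "C \<in> components S" "g x \<in> C"
  shows "g y \<in> C"
proof -
  have "connected (g ` K)" using K cont by (intro connected_continuous_image) (auto intro: continuous_on_subset)
  moreover have "C \<inter> g ` K \<noteq> {}" using C x by blast
  ultimately have "g ` K \<subseteq> C" using components_maximal[OF C(1)] K(3) by blast
  then show ?thesis using x by blast
qed

text \<open>\<open>g\<close> maps each component of \<open>T\<close> into a single component of
  \<open>S\<close>. Lifts under \<open>s\<close> of points from different components therefore lie
  in different components of \<open>T\<close>.\<close>

lemma components_lepoll_if_section:
  assumes g: "continuous_on T g" "g ` T \<subseteq> S" and s: "s ` S \<subseteq> T" "\<And>x. x \<in> S \<Longrightarrow> g (s x) = x"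
  shows "components S \<lesssim> components T"
proof -
  define pt where "pt = (\<lambda>C. SOME x. x \<in> (C :: 'b set))"
  have pt: "pt C \<in> C" "pt C \<in> S" if "C \<in> components S" for C
  proof -
    have "C \<noteq> {}" using that in_components_nonempty by blast
    then show "pt C \<in> C" unfolding pt_def by (meson all_not_in_conv someI_ex)
    then show "pt C \<in> S" using that in_components_subset by blast
  qed
  have "inj_on (\<lambda>C. connected_component_set T (s (pt C))) (components S)"
  proof (rule inj_onI)
    fix C D assume CD: "C \<in> components S" "D \<in> components S"
      "connected_component_set T (s (pt C)) = connected_component_set T (s (pt D))"
    let ?K = "connected_component_set T (s (pt C))"
    have "s (pt C) \<in> ?K" "s (pt D) \<in> ?K"
      using CD(3) s(1) pt CD(1,2) by (auto simp: connected_component_refl_eq image_subset_iff)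
    moreover have "?K \<subseteq> T" "g ` ?K \<subseteq> S"
      using g(2) connected_component_subset[of T "s (pt C)"] by blast+
    moreover have "g (s (pt C)) \<in> C" using pt[OF CD(1)] s(2) by simp
    ultimately have "g (s (pt D)) \<in> C"
      using connected_components_mono_image[OF g(1), of ?K S "s (pt C)" "s (pt D)" C] CD(1) by simp
    then have "pt D \<in> C" using s(2) pt CD by simp
    then show "C = D" using CD pt by (metis components_eq disjoint_iff)
  qed
  moreover have "connected_component_set T (s (pt C)) \<in> components T" if "C \<in> components S" for C
    using pt[OF that] s(1) by (auto simp: components_def image_subset_iff)
  ultimately show ?thesis unfolding lepoll_def by blast
qed

text \<open>In a compact Hausdorff space a component is the intersection of the clopen sets around
  it. This theorem of Sura-Bura is applied to the stereographic image in Euclidean space, and the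
  clopen set is pulled back.\<close>

lemma separate_sphere_components:
  assumes J: "closed (J :: riemann_sphere set)" and C: "C \<in> components J" "D \<in> components J" "C \<noteq> D"
  obtains A B where "closed A" "closed B" "A \<inter> B = {}" "A \<union> B = J" "C \<subseteq> A" "D \<subseteq> B"
proof -
  define st where "st = stereographic"
  have cst: "continuous_on X st" for X unfolding st_def by (rule continuous_on_stereographic)
  have inj: "inj st" unfolding st_def by (rule inj_stereographic)
  have cinv: "continuous_on (st ` J) (inv st)"
    unfolding continuous_on_iff
  proof (intro ballI allI impI)
    fix x and e :: real assume "x \<in> st ` J" "e > 0"
    then show "\<exists>d>0. \<forall>x'\<in>st ` J. dist x' x < d \<longrightarrow> dist (inv st x') (inv st x) < e"
      using inj by (intro exI[of _ e]) (auto simp: dist_riemann_sphere_def st_def)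
  qed
  obtain x y where x: "x \<in> C" and y: "y \<in> D"
    using C in_components_nonempty by (metis all_not_in_conv)
  have xyJ: "x \<in> J" "y \<in> J" using x y C in_components_subset by blast+
  have "compact J" using compact_UNIV_sphere J by (metis compact_Int_closed inf_top.left_neutral)
  then have cpt: "compact (st ` J)" by (intro compact_continuous_image cst)
  define E where "E = connected_component_set (st ` J) (st x)"
  have E: "E \<in> components (st ` J)" using xyJ by (auto simp: E_def components_def)
  have xE: "st x \<in> E" using xyJ by (auto simp: E_def connected_component_refl_eq)
  have "st y \<notin> E"
  proof
    assume yE: "st y \<in> E"
    have "inv st (st y) \<in> C"
    proof (rule connected_components_mono_image[OF cinv, of E J "st x"])
      show "connected E" using E in_components_connected by blast
      show "E \<subseteq> st ` J" using E in_components_subset by blast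
      show "inv st ` E \<subseteq> J"
      proof (rule image_subsetI)
        fix e assume "e \<in> E"
        with \<open>E \<subseteq> st ` J\<close> obtain j where "j \<in> J" "e = st j" by blast
        then show "inv st e \<in> J" using inj by simp
      qed
    qed (use xE yE C x inj in auto)
    then have "y \<in> C" using inj by simp
    then show False using C y by (metis components_eq disjoint_iff)
  qed
  then obtain T where T: "E \<subseteq> T" "openin (top_of_set (st ` J)) T" "closedin (top_of_set (st ` J)) T" "st y \<notin> T"
    using Sura_Bura_compact[OF cpt E] by blast
  define A where "A = st -` T"
  define B where "B = st -` (st ` J - T)"
  have "closed (st ` J)" using cpt by (rule compact_imp_closed)
  then have clT: "closed T" using T(3) by (rule closedin_closed_trans[rotated])
  obtain W where W: "open W" "T = st ` J \<inter> W" using T(2) by (auto simp: openin_open)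
  then have "st ` J - T = st ` J \<inter> - W" by blast
  then have clJT: "closed (st ` J - T)" using \<open>closed (st ` J)\<close> W(1) by (simp add: closed_Int closed_Compl)
  have AB: "closed A" "closed B"
    unfolding A_def B_def by (intro closed_vimage cst clT clJT)+
  have un: "A \<union> B = J" "A \<inter> B = {}"
  proof -
    have "T \<subseteq> st ` J" using T(3) closedin_imp_subset by blast
    then have "A \<union> B = st -` (st ` J)" by (auto simp: A_def B_def)
    then show "A \<union> B = J" using inj by (simp add: inj_vimage_image_eq)
    show "A \<inter> B = {}" by (auto simp: A_def B_def)
  qed
  have xA: "x \<in> A" using T(1) xE by (auto simp: A_def)
  have yB: "y \<in> B" using T(4) xyJ by (auto simp: B_def)
  have "C \<subseteq> A"
    using connected_closedD[of C A B] in_components_connected[OF C(1)] in_components_subset[OF C(1)] AB un x xA by blast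
  moreover have "D \<subseteq> B"
    using connected_closedD[of D A B] in_components_connected[OF C(2)] in_components_subset[OF C(2)] AB un y yB by blast
  ultimately show thesis using that AB un by blast
qed

lemma different_components_if_separated:
  assumes M: "M = P \<union> Q" "closed P" "closed Q" "P \<inter> Q = {}" and K: "K \<in> components M" "x \<in> K" "x \<in> P" "y \<in> Q"
  shows "y \<notin> K"
  using connected_closedD[of K P Q] in_components_connected[OF K(1)] in_components_subset[OF K(1)] M K by blast

context connected_semigroup
begin

section \<open>Nested filled Julia sets and the capacity gap\<close>

lemma frontier_connected: "p \<in> G \<Longrightarrow> connected (frontier (filled_julia p))"
  using connected_frontier_filled deg conn by blast

text \<open>A frontier inside the other filled Julia set brings the whole set with it, because the
  connected complement of the other set is unbounded. If each frontier avoided the other set,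
  connectedness and the common point \<open>b\<close> would still give an inclusion, a
  contradiction.\<close>

lemma nested:
  assumes p: "p \<in> G" and q: "q \<in> G" and dis: "frontier (filled_julia p) \<inter> frontier (filled_julia q) = {}"
  shows "filled_julia p \<subseteq> interior (filled_julia q) \<or> filled_julia q \<subseteq> interior (filled_julia p)"
proof -
  have aux: "filled_julia p \<subseteq> interior (filled_julia q)"
    if p: "p \<in> G" and q: "q \<in> G" and dis: "frontier (filled_julia p) \<inter> frontier (filled_julia q) = {}"
      and sub: "frontier (filled_julia p) \<subseteq> filled_julia q" for p q
  proof -
    have "\<not> bounded (- filled_julia q)"
      using compact_filled[OF deg[OF q]] by (simp add: cobounded_imp_unbounded compact_imp_bounded)
    then have ne: "- filled_julia q - filled_julia p \<noteq> {}"
      using compact_imp_bounded[OF compact_filled[OF deg[OF p]]] bounded_subset by blast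
    have "- filled_julia q \<inter> frontier (filled_julia p) = {}" using sub by blast
    then have "- filled_julia q \<subseteq> filled_julia p \<or> - filled_julia q \<inter> filled_julia p = {}"
      using connected_Compl_filled[OF deg[OF q]] by (rule filled_decides_connected[rotated])
    with ne have sub2: "filled_julia p \<subseteq> filled_julia q" by blast
    have "interior (filled_julia p) \<subseteq> interior (filled_julia q)" using sub2 by (rule interior_mono)
    moreover have "filled_julia p \<subseteq> interior (filled_julia p) \<union> frontier (filled_julia p)"
      by (metis Un_Diff_cancel closure_subset frontier_def subset_trans sup_ge2 sup_commute Un_commute)
    moreover have "frontier (filled_julia p) \<subseteq> interior (filled_julia q)"
      using sub dis frontier_filled_subset closure_subset unfolding frontier_def by blast
    ultimately show ?thesis by blast
  qed
  have P: "frontier (filled_julia p) \<subseteq> filled_julia q \<or> frontier (filled_julia p) \<inter> filled_julia q = {}"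
    using dis by (intro filled_decides_connected frontier_connected p)
  have Q: "frontier (filled_julia q) \<subseteq> filled_julia p \<or> frontier (filled_julia q) \<inter> filled_julia p = {}"
    using dis by (intro filled_decides_connected frontier_connected q) blast
  have "frontier (filled_julia p) \<subseteq> filled_julia q \<or> frontier (filled_julia q) \<subseteq> filled_julia p"
  proof (rule ccontr)
    assume n: "\<not> ?thesis"
    then have "filled_julia p \<inter> frontier (filled_julia q) = {}" using Q by blast
    then have "filled_julia p \<subseteq> filled_julia q \<or> filled_julia p \<inter> filled_julia q = {}"
      by (intro filled_decides_connected conn p)
    then have "filled_julia p \<subseteq> filled_julia q" using base p q by blast
    then show False using n frontier_filled_subset[OF deg[OF p]] by blast
  qed
  then show ?thesis using aux p q dis by (metis inf_commute)
qed

text \<open>The dilation of \<open>filled_julia p\<close> about the common point \<open>b\<close> by the factor \<open>1 + \<delta> / (2 * R)\<close> moves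
  points by less than \<open>\<delta>\<close>, so it stays inside \<open>filled_julia q\<close>.\<close>

lemma log_cap_gap:
  assumes p: "p \<in> G" and q: "q \<in> G" and sub: "filled_julia p \<subseteq> interior (filled_julia q)"
    and R: "R > 0" "filled_julia p \<subseteq> cball b R"
    and \<delta>: "\<delta> > 0" "\<And>v w. v \<in> frontier (filled_julia p) \<Longrightarrow> w \<in> frontier (filled_julia q) \<Longrightarrow> \<delta> \<le> dist v w"
  shows "log_cap p + ln (1 + \<delta> / (2 * R)) \<le> log_cap q"
proof (rule log_cap_dilation[OF deg[OF p] deg[OF q], of _ b])
  have t: "\<delta> / (2 * R) > 0" using R \<delta> by simp
  then show "1 + \<delta> / (2 * R) > 0" by simp
  show "(\<lambda>z. b + complex_of_real (1 + \<delta> / (2 * R)) * (z - b)) ` filled_julia p \<subseteq> filled_julia q"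
  proof (rule image_subsetI, rule ccontr)
    fix z assume z: "z \<in> filled_julia p"
    define z' where "z' = b + complex_of_real (1 + \<delta> / (2 * R)) * (z - b)"
    assume "b + complex_of_real (1 + \<delta> / (2 * R)) * (z - b) \<notin> filled_julia q"
    then have z': "z' \<notin> filled_julia q" by (simp add: z'_def)
    have "z' - z = complex_of_real (\<delta> / (2 * R)) * (z - b)" by (simp add: z'_def algebra_simps)
    then have "dist z z' = \<delta> / (2 * R) * cmod (z - b)"
      using t by (simp only: dist_norm norm_minus_commute[of z z'] norm_mult norm_of_real)
    also have "\<dots> \<le> \<delta> / (2 * R) * R"
      using R z t by (intro mult_left_mono) (auto simp: dist_norm norm_minus_commute)
    also have "\<dots> < \<delta>" using R \<delta> by simp
    finally have dz: "dist z z' < \<delta>" .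
    have zq: "z \<in> filled_julia q" using z sub interior_subset by blast
    \<comment> \<open>The segment meets the frontier of \<open>filled_julia q\<close> at
      \<open>w\<close>, and before that the frontier of the smaller set at \<open>v\<close>; these
      two points would be closer than \<open>\<delta>\<close>.\<close>
    have "closed_segment z z' \<inter> frontier (filled_julia q) \<noteq> {}"
      using z' zq by (intro connected_Int_frontier connected_segment) auto
    then obtain w where w: "w \<in> closed_segment z z'" "w \<in> frontier (filled_julia q)" by blast
    then have wp: "w \<notin> filled_julia p" using sub by (auto simp: frontier_def)
    have "closed_segment z w \<inter> frontier (filled_julia p) \<noteq> {}"
      using wp z by (intro connected_Int_frontier connected_segment) auto
    then obtain v where v: "v \<in> closed_segment z w" "v \<in> frontier (filled_julia p)" by blast
    have "dist v w \<le> dist z w" using dist_in_closed_segment[OF v(1)] by (simp add: dist_commute)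
    also have "\<dots> \<le> dist z z'" using dist_in_closed_segment[OF w(1)] by (simp add: dist_commute)
    finally show False using \<delta>(2)[OF v(2) w(2)] dz by linarith
  qed
qed

section \<open>Capacities on the two sides of a splitting of the Julia set\<close>

definition julia_part :: "complex poly \<Rightarrow> riemann_sphere set" where
  "julia_part p = Fin ` frontier (filled_julia p)"

lemma julia_part_subset: "p \<in> G \<Longrightarrow> julia_part p \<subseteq> julia_set G"
  unfolding julia_part_def using frontier_filled_subset_julia[OF deg iter_in] by blast

lemma julia_part_in_closed_partition:
  assumes AB: "closed A" "closed B" "A \<inter> B = {}" "A \<union> B = julia_set G" and p: "p \<in> G"
  shows "julia_part p \<subseteq> A \<and> julia_part p \<inter> B = {} \<or> julia_part p \<subseteq> B \<and> julia_part p \<inter> A = {}"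
proof -
  have "connected (julia_part p)"
    unfolding julia_part_def by (intro connected_continuous_image frontier_connected p continuous_on_Fin continuous_on_id)
  then show ?thesis
    using connected_closedD[of "julia_part p" A B] AB julia_part_subset[OF p] by blast
qed

text \<open>A filled Julia set of large capacity does not fit into a given disc, and then neither
  does its frontier.\<close>

lemma Infty_in_if_log_cap_unbounded:
  assumes A: "closed A" and unb: "\<And>M. \<exists>p\<in>G. log_cap p > M \<and> julia_part p \<subseteq> A"
  shows "Infty \<in> A"
proof -
  have "\<exists>z. Fin z \<in> A \<and> real n \<le> cmod z" for n
  proof -
    obtain p where p: "p \<in> G" "log_cap p > ln (real (Suc n))" "julia_part p \<subseteq> A" using unb by blast
    have "\<not> filled_julia p \<subseteq> cball 0 (real (Suc n))"
      using log_cap_le_ln_radius[OF deg[OF p(1)], of "real (Suc n)" 0] p(2) by auto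
    then have "\<not> frontier (filled_julia p) \<subseteq> cball 0 (real (Suc n))"
      using filled_subset_cball_if_frontier[OF deg[OF p(1)]] by blast
    then obtain z where "z \<in> frontier (filled_julia p)" "real n \<le> cmod z" by (auto simp: subset_iff)
    then show ?thesis using p(3) by (auto simp: julia_part_def)
  qed
  then obtain zs where zs: "\<And>n. Fin (zs n) \<in> A" "\<And>n. real n \<le> cmod (zs n)" by metis
  have "filterlim zs at_infinity sequentially"
    unfolding filterlim_at_infinity_conv_norm_at_top
    using zs(2) by (intro filterlim_at_top_mono[OF filterlim_real_sequentially]) auto
  then have "(\<lambda>n. Fin (zs n)) \<longlonglongrightarrow> Infty" by (rule tendsto_Fin_Infty)
  then show ?thesis using closed_sequentially[OF A, of "\<lambda>n. Fin (zs n)" Infty] zs(1) by blast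
qed

text \<open>By connectedness a small capacity means a small diameter, so filled Julia sets through
  \<open>b\<close> shrink to \<open>b\<close>.\<close>

lemma base_in_if_log_cap_unbounded_below:
  assumes A: "closed A" and unb: "\<And>M. \<exists>p\<in>G. log_cap p < M \<and> julia_part p \<subseteq> A"
  shows "Fin b \<in> A"
proof -
  have "\<exists>z. Fin z \<in> A \<and> dist z b \<le> 2 * exp 1 * inverse (real (Suc n))" for n
  proof -
    obtain p where p: "p \<in> G" "log_cap p < ln (inverse (real (Suc n)))" "julia_part p \<subseteq> A" using unb by blast
    obtain z where z: "z \<in> frontier (filled_julia p)" using frontier_filled_nonempty[OF deg[OF p(1)]] by blast
    then have "z \<in> filled_julia p" using frontier_filled_subset[OF deg[OF p(1)]] by blast
    then have "dist b z \<le> 2 * exp 1 * exp (ln (inverse (real (Suc n))))"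
      using filled_subset_cball[OF p(1) less_imp_le[OF p(2)]] by (simp only: subset_iff mem_cball)
    then show ?thesis using z p(3) by (intro exI[of _ z]) (auto simp: julia_part_def dist_commute[of z b])
  qed
  then obtain zs where zs: "\<And>n. Fin (zs n) \<in> A" "\<And>n. dist (zs n) b \<le> 2 * exp 1 * inverse (real (Suc n))" by metis
  have "(\<lambda>n. 2 * exp 1 * inverse (real (Suc n))) \<longlonglongrightarrow> 2 * exp 1 * 0"
    by (intro tendsto_mult tendsto_const LIMSEQ_inverse_real_of_nat)
  then have "(\<lambda>n. 2 * exp 1 * inverse (real (Suc n))) \<longlonglongrightarrow> 0" by simp
  then have "(\<lambda>n. dist (zs n) b) \<longlonglongrightarrow> 0"
    by (rule tendsto_sandwich[OF _ _ tendsto_const, rotated 2]) (use zs(2) in \<open>auto intro: always_eventually\<close>)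
  then have "zs \<longlonglongrightarrow> b" by (rule tendsto_dist_iff[THEN iffD2])
  then have "(\<lambda>n. Fin (zs n)) \<longlonglongrightarrow> Fin b"
    by (intro continuous_on_tendsto_compose[OF continuous_on_Fin[OF continuous_on_id, of UNIV]]) auto
  then show ?thesis using closed_sequentially[OF A, of "\<lambda>n. Fin (zs n)"] zs(1) by blast
qed

definition log_caps_in :: "riemann_sphere set \<Rightarrow> ereal set" where
  "log_caps_in A = (\<lambda>p. ereal (log_cap p)) ` {p \<in> G. julia_part p \<subseteq> A}"

lemma closure_log_caps_nearby:
  assumes "\<gamma> \<in> closure (log_caps_in A)" "open U" "\<gamma> \<in> U"
  obtains p where "p \<in> G" "julia_part p \<subseteq> A" "ereal (log_cap p) \<in> U"
proof -
  have "U \<inter> log_caps_in A \<noteq> {}" using assms open_Int_closure_eq_empty[of U "log_caps_in A"] by blast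
  then show thesis using that by (auto simp: log_caps_in_def)
qed

text \<open>A common limit would put \<open>Infty\<close> into both sets if it is infinity, and
  \<open>Fin b\<close> if it is minus infinity. For a finite limit \<open>x\<close>, elements
  \<open>p\<close> and \<open>q\<close> from the two sides have capacities as close as desired, yet
  their filled Julia sets are nested with boundaries at distance at least
  \<open>\<delta>\<close>.\<close>

lemma closure_log_caps_disjoint:
  assumes AB: "closed A" "closed B" "A \<inter> B = {}"
  shows "closure (log_caps_in A) \<inter> closure (log_caps_in B) = {}"
proof (rule ccontr)
  assume "\<not> ?thesis"
  then obtain \<gamma> where \<gamma>: "\<gamma> \<in> closure (log_caps_in A)" "\<gamma> \<in> closure (log_caps_in B)" by blast
  show False
  proof (cases \<gamma>)
    case PInf
    have "Infty \<in> C" if cC: "closed C" "\<gamma> \<in> closure (log_caps_in C)" for C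
    proof (rule Infty_in_if_log_cap_unbounded[OF cC(1)])
      fix M
      obtain p where "p \<in> G" "julia_part p \<subseteq> C" "ereal (log_cap p) \<in> {ereal M<..}"
        by (rule closure_log_caps_nearby[OF cC(2), of "{ereal M<..}"]) (auto simp: PInf)
      then show "\<exists>p\<in>G. log_cap p > M \<and> julia_part p \<subseteq> C" by auto
    qed
    then show False using AB \<gamma> by blast
  next
    case MInf
    have "Fin b \<in> C" if cC: "closed C" "\<gamma> \<in> closure (log_caps_in C)" for C
    proof (rule base_in_if_log_cap_unbounded_below[OF cC(1)])
      fix M
      obtain p where "p \<in> G" "julia_part p \<subseteq> C" "ereal (log_cap p) \<in> {..<ereal M}"
        by (rule closure_log_caps_nearby[OF cC(2), of "{..<ereal M}"]) (auto simp: MInf)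
      then show "\<exists>p\<in>G. log_cap p < M \<and> julia_part p \<subseteq> C" by auto
    qed
    then show False using AB \<gamma> by blast
  next
    case (real x)
    define R where "R = 2 * exp 1 * exp (x + 1)"
    have R: "R > 0" by (simp add: R_def)
    \<comment> \<open>Cut down to the disc, \<open>A'\<close> is compact and so has positive
      distance from the closed set \<open>B'\<close>. The disc contains the filled Julia sets of all
      elements with \<open>log_cap\<close> at most \<open>x + 1\<close>.\<close>
    define A' where "A' = Fin -` A \<inter> cball b R"
    define B' where "B' = Fin -` B"
    have "compact A'" "closed B'"
      unfolding A'_def B'_def using AB continuous_on_Fin[OF continuous_on_id, of UNIV]
      by (auto intro!: closed_Int_compact closed_vimage)
    moreover have "A' \<inter> B' = {}" using AB by (auto simp: A'_def B'_def)
    ultimately obtain \<delta> where \<delta>: "\<delta> > 0" "\<And>v w. v \<in> A' \<Longrightarrow> w \<in> B' \<Longrightarrow> \<delta> \<le> dist v w"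
      using separate_compact_closed[of A' B'] by blast
    \<comment> \<open>Two capacities within \<open>\<epsilon>\<close> of \<open>x\<close> differ by
      less than the guaranteed gap; the bound 1 keeps the filled Julia sets inside the disc of
      radius \<open>R\<close>.\<close>
    define \<epsilon> where "\<epsilon> = min 1 (ln (1 + \<delta> / (2 * R)) / 2)"
    have \<epsilon>: "\<epsilon> > 0" "\<epsilon> \<le> 1" "2 * \<epsilon> \<le> ln (1 + \<delta> / (2 * R))" 
  proof -
    have "1 + \<delta> / (2 * R) > 1" using \<delta>(1) R by simp
    then have "ln (1 + \<delta> / (2 * R)) > 0" by (rule ln_gt_zero)
    then show "\<epsilon> > 0" "\<epsilon> \<le> 1" "2 * \<epsilon> \<le> ln (1 + \<delta> / (2 * R))" by (auto simp: \<epsilon>_def)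
  qed
    have near: "\<exists>p\<in>G. julia_part p \<subseteq> C \<and> \<bar>log_cap p - x\<bar> < \<epsilon>" if cC: "\<gamma> \<in> closure (log_caps_in C)" for C
    proof -
      obtain p where "p \<in> G" "julia_part p \<subseteq> C" "ereal (log_cap p) \<in> {ereal (x - \<epsilon>)<..<ereal (x + \<epsilon>)}"
        by (rule closure_log_caps_nearby[OF cC, of "{ereal (x - \<epsilon>)<..<ereal (x + \<epsilon>)}"]) (use \<epsilon> in \<open>auto simp: real\<close>)
      then show ?thesis by (intro bexI[of _ p]) auto
    qed
    obtain p where p: "p \<in> G" "julia_part p \<subseteq> A" "\<bar>log_cap p - x\<bar> < \<epsilon>" using near[OF \<gamma>(1)] by blast
    obtain q where q: "q \<in> G" "julia_part q \<subseteq> B" "\<bar>log_cap q - x\<bar> < \<epsilon>" using near[OF \<gamma>(2)] by blast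
    have pR: "filled_julia p \<subseteq> cball b R" unfolding R_def using p \<epsilon> by (intro filled_subset_cball) auto
    have qR: "filled_julia q \<subseteq> cball b R" unfolding R_def using q \<epsilon> by (intro filled_subset_cball) auto
    have fp: "frontier (filled_julia p) \<subseteq> A'"
      using p(2) pR frontier_filled_subset[OF deg[OF p(1)]] by (auto simp: A'_def julia_part_def)
    have fq: "frontier (filled_julia q) \<subseteq> B'" using q(2) by (auto simp: B'_def julia_part_def)
    have sep: "\<delta> \<le> dist v w" if "v \<in> frontier (filled_julia p)" "w \<in> frontier (filled_julia q)" for v w
      using that fp fq \<delta>(2) by blast
    have "frontier (filled_julia p) \<inter> frontier (filled_julia q) = {}" using fp fq \<open>A' \<inter> B' = {}\<close> by blast
    from nested[OF p(1) q(1) this] show False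
    proof
      assume "filled_julia p \<subseteq> interior (filled_julia q)"
      from log_cap_gap[OF p(1) q(1) this R pR \<delta>(1) sep] show False using p q \<epsilon> by linarith
    next
      assume "filled_julia q \<subseteq> interior (filled_julia p)"
      from log_cap_gap[OF q(1) p(1) this R qR \<delta>(1)] sep have "log_cap q + ln (1 + \<delta> / (2 * R)) \<le> log_cap p"
        by (metis dist_commute)
      then show False using p q \<epsilon> by linarith
    qed
  qed
qed

text \<open>The slope of \<open>Psi p\<close> is the degree, at least 2, so its unique fixed point
  is always repelling.\<close>

lemma repelling_closure_Psi: "repelling_closure (Psi ` G) = closure ((\<lambda>p. ereal (log_cap p)) ` G)"
proof -
  have "{x. \<exists>h\<in>Psi ` G. h x = x \<and> \<bar>deriv h x\<bar> > 1} = log_cap ` G"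
  proof (intro set_eqI iffI)
    fix x assume "x \<in> {x. \<exists>h\<in>Psi ` G. h x = x \<and> \<bar>deriv h x\<bar> > 1}"
    then show "x \<in> log_cap ` G" using Psi_fixed_iff[OF deg] by auto
  next
    fix x assume "x \<in> log_cap ` G"
    then obtain p where p: "p \<in> G" "x = log_cap p" by blast
    then have "Psi p x = x" "\<bar>deriv (Psi p) x\<bar> > 1" using Psi_fixed_iff[OF deg] deg[OF p(1)] by (auto simp: deriv_Psi)
    then show "x \<in> {x. \<exists>h\<in>Psi ` G. h x = x \<and> \<bar>deriv h x\<bar> > 1}" using p by blast
  qed
  then show ?thesis unfolding repelling_closure_def by (simp add: image_image)
qed

lemma repelling_closure_partition:
  assumes "closed A" "closed B" "A \<inter> B = {}" "A \<union> B = julia_set G"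
  shows "repelling_closure (Psi ` G) = closure (log_caps_in A) \<union> closure (log_caps_in B)"
proof -
  have "(\<lambda>p. ereal (log_cap p)) ` G = log_caps_in A \<union> log_caps_in B"
  proof -
    have "\<forall>p\<in>G. julia_part p \<subseteq> A \<or> julia_part p \<subseteq> B"
      using julia_part_in_closed_partition[OF assms] by blast
    then show ?thesis unfolding log_caps_in_def by blast
  qed
  then show ?thesis by (simp add: repelling_closure_Psi closure_Un)
qed

section \<open>Components represented by limits of capacities\<close>

text \<open>A component of the Julia set of \<open>G\<close> need not contain the Julia set of any element of \<open>G\<close>, so its
  place in \<open>M(\<Psi>(G))\<close> is determined by approximation.\<close>

definition represents :: "riemann_sphere set \<Rightarrow> (nat \<Rightarrow> complex poly) \<Rightarrow> (nat \<Rightarrow> complex) \<Rightarrow> ereal \<Rightarrow> bool" where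
  "represents C p z \<gamma> \<longleftrightarrow> (\<forall>n. p n \<in> G \<and> z n \<in> frontier (filled_julia (p n))) \<and>
     (\<exists>x\<in>C. (\<lambda>n. Fin (z n)) \<longlonglongrightarrow> x) \<and> (\<lambda>n. ereal (log_cap (p n))) \<longlonglongrightarrow> \<gamma>"

text \<open>A point of \<open>C\<close> is a limit of boundary points; compactness of the extended
  reals gives a subsequence along which the capacities converge too.\<close>

lemma represents_exists:
  assumes C: "C \<in> components (julia_set G)"
  shows "\<exists>p z \<gamma>. represents C p z \<gamma>"
proof -
  obtain x where x: "x \<in> C" using C in_components_nonempty by blast
  then have "x \<in> julia_set G" using C in_components_subset by blast
  then have "x \<in> closure (Fin ` (\<Union>p\<in>G. frontier (filled_julia p)))" unfolding julia_set_eq_closure .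
  then obtain s where s: "\<And>n. s n \<in> Fin ` (\<Union>p\<in>G. frontier (filled_julia p))" "s \<longlonglongrightarrow> x"
    unfolding closure_sequential by blast
  have "\<forall>n. \<exists>p z. p \<in> G \<and> z \<in> frontier (filled_julia p) \<and> s n = Fin z" using s(1) by blast
  then obtain p z where pz: "\<And>n. p n \<in> G" "\<And>n. z n \<in> frontier (filled_julia (p n))" "\<And>n. s n = Fin (z n)" by metis
  have "seq_compact (UNIV :: ereal set)" using compact_UNIV by (rule compact_imp_seq_compact)
  then obtain \<gamma> r where r: "strict_mono (r :: nat \<Rightarrow> nat)" "((\<lambda>n. ereal (log_cap (p n))) \<circ> r) \<longlonglongrightarrow> \<gamma>"
    unfolding seq_compact_def by blast
  have "(\<lambda>n. Fin (z (r n))) \<longlonglongrightarrow> x" using LIMSEQ_subseq_LIMSEQ[OF s(2) r(1)] pz(3) by (simp add: o_def)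
  then have "represents C (p \<circ> r) (z \<circ> r) \<gamma>"
    unfolding represents_def using pz r(2) x by (auto simp: o_def)
  then show ?thesis by blast
qed

text \<open>The points \<open>z n\<close> are eventually off \<open>B\<close>, and the connected
  boundary through \<open>z n\<close> lies on one side of the splitting.\<close>

lemma represents_eventually:
  assumes rep: "represents C p z \<gamma>" and AB: "closed A" "closed B" "A \<inter> B = {}" "A \<union> B = julia_set G" "C \<subseteq> A"
  shows "\<forall>\<^sub>F n in sequentially. julia_part (p n) \<subseteq> A"
proof -
  obtain x where x: "x \<in> C" "(\<lambda>n. Fin (z n)) \<longlonglongrightarrow> x" using rep by (auto simp: represents_def)
  have "open (- B)" "x \<in> - B" using AB x by (auto simp: open_Compl)
  then have "\<forall>\<^sub>F n in sequentially. Fin (z n) \<in> - B" using x(2) topological_tendstoD by blast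
  then show ?thesis
  proof eventually_elim
    case (elim n)
    have "Fin (z n) \<in> julia_part (p n)" "p n \<in> G" using rep by (auto simp: represents_def julia_part_def)
    then show ?case using julia_part_in_closed_partition[OF AB(1-4), of "p n"] elim by blast
  qed
qed

lemma represents_in_closure:
  assumes rep: "represents C p z \<gamma>" and AB: "closed A" "closed B" "A \<inter> B = {}" "A \<union> B = julia_set G" "C \<subseteq> A"
  shows "\<gamma> \<in> closure (log_caps_in A)"
proof -
  have lim: "(\<lambda>n. ereal (log_cap (p n))) \<longlonglongrightarrow> \<gamma>" and pG: "\<And>n. p n \<in> G" using rep by (auto simp: represents_def)
  have "\<forall>\<^sub>F n in sequentially. ereal (log_cap (p n)) \<in> closure (log_caps_in A)"
    using represents_eventually[OF assms]
  proof eventually_elim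
    case (elim n)
    then have "ereal (log_cap (p n)) \<in> log_caps_in A" using pG by (auto simp: log_caps_in_def)
    then show ?case using closure_subset by blast
  qed
  then show ?thesis using lim by (intro Lim_in_closed_set[OF closed_closure]) auto
qed

lemma represents_in_repelling_closure:
  assumes "represents C p z \<gamma>"
  shows "\<gamma> \<in> repelling_closure (Psi ` G)"
proof -
  have "(\<lambda>n. ereal (log_cap (p n))) \<longlonglongrightarrow> \<gamma>" "\<And>n. p n \<in> G" using assms by (auto simp: represents_def)
  then show ?thesis unfolding repelling_closure_Psi closure_sequential
    by (intro exI[of _ "\<lambda>n. ereal (log_cap (p n))"]) auto
qed

lemma represents_different_components:
  assumes C: "C \<in> components (julia_set G)" "D \<in> components (julia_set G)" "C \<noteq> D"
    and rep: "represents C p z \<gamma>" "represents D q w \<gamma>'"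
    and K: "K \<in> components (repelling_closure (Psi ` G))" "\<gamma> \<in> K"
  shows "\<gamma>' \<notin> K"
proof -
  have "closed (julia_set G)" unfolding julia_set_def using open_fatou_set by (simp add: closed_def)
  then obtain A B where AB: "closed A" "closed B" "A \<inter> B = {}" "A \<union> B = julia_set G" "C \<subseteq> A" "D \<subseteq> B"
    using separate_sphere_components[OF _ C] by blast
  show ?thesis
  proof (rule different_components_if_separated[OF repelling_closure_partition[OF AB(1-4)] _ _ _ K])
    show "closure (log_caps_in A) \<inter> closure (log_caps_in B) = {}" by (rule closure_log_caps_disjoint[OF AB(1-3)])
    show "\<gamma> \<in> closure (log_caps_in A)" by (rule represents_in_closure[OF rep(1) AB(1-5)])
    show "\<gamma>' \<in> closure (log_caps_in B)"
      using AB by (intro represents_in_closure[OF rep(2) AB(2,1)]) auto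
  qed auto
qed

text \<open>For large \<open>n\<close> the boundary for \<open>p n\<close> is disjoint from
  \<open>D\<close>, so \<open>D\<close> lies inside or outside \<open>filled_julia (p n)\<close>.
  Inside is impossible: the unbounded complement of that set would lie in the bounded component
  \<open>U\<close>. So \<open>w m\<close> is outside for large \<open>m\<close>, nesting gives
  \<open>filled_julia (p n) \<subseteq> filled_julia (q m)\<close>, and monotonicity passes to the
  limits.\<close>

lemma represents_order:
  assumes C: "C \<in> planar_julia_components G" "D \<in> planar_julia_components G"
    and sur: "surrounded_by (Fin -` C) (Fin -` D)"
    and rep: "represents C p z \<gamma>" "represents D q w \<gamma>'"
  shows "\<gamma> \<le> \<gamma>'"
proof -
  have CD: "C \<in> components (julia_set G)" "D \<in> components (julia_set G)" "Infty \<notin> C" "Infty \<notin> D" "C \<noteq> D"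
    using C sur by (auto simp: planar_julia_components_def surrounded_by_def)
  have cJ: "closed (julia_set G)" unfolding julia_set_def using open_fatou_set by (simp add: closed_def)
  obtain A B where AB: "closed A" "closed B" "A \<inter> B = {}" "A \<union> B = julia_set G" "C \<subseteq> A" "D \<subseteq> B"
    using separate_sphere_components[OF cJ CD(1,2,5)] by blast
  obtain U where U: "U \<in> components (- (Fin -` D))" "bounded U" "Fin -` C \<subseteq> U"
    using sur by (auto simp: surrounded_by_def)
  define K where "K = Fin -` D"
  have "closed D" using closed_components[OF cJ] CD(2) .
  then have "closed K" unfolding K_def by (intro closed_vimage continuous_on_Fin continuous_on_id)
  then have oU: "open U" using U(1) unfolding K_def[symmetric] by (meson open_Compl open_components)
  have conK: "connected K"
  proof -
    have "D \<subseteq> range Fin" using CD(4) by (metis image_eqI riemann_sphere.exhaust subsetI UNIV_I)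
    then have "connected (inv Fin ` D)"
      using in_components_connected[OF CD(2)] continuous_on_inv_Fin
      by (intro connected_continuous_image) (auto intro: continuous_on_subset)
    moreover have "inv Fin ` D = K"
    proof (intro equalityI subsetI)
      fix v assume "v \<in> inv Fin ` D"
      then obtain d where d: "d \<in> D" "v = inv Fin d" by blast
      then have "Fin v = d" using \<open>D \<subseteq> range Fin\<close> f_inv_into_f by (metis subsetD)
      then show "v \<in> K" using d by (simp add: K_def)
    next
      fix v assume "v \<in> K"
      moreover have "inv Fin (Fin v) = v" by (simp add: inj_def)
      ultimately show "v \<in> inv Fin ` D" unfolding K_def by (metis image_eqI vimageD)
    qed
    ultimately show ?thesis by simp
  qed
  have pG: "\<And>n. p n \<in> G" "\<And>n. z n \<in> frontier (filled_julia (p n))" and qG: "\<And>n. q n \<in> G" "\<And>n. w n \<in> frontier (filled_julia (q n))"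
    and lims: "(\<lambda>n. ereal (log_cap (p n))) \<longlonglongrightarrow> \<gamma>" "(\<lambda>n. ereal (log_cap (q n))) \<longlonglongrightarrow> \<gamma>'"
    using rep by (auto simp: represents_def)
  obtain x where x: "x \<in> C" "(\<lambda>n. Fin (z n)) \<longlonglongrightarrow> x" using rep(1) by (auto simp: represents_def)
  obtain y where y: "y \<in> D" "(\<lambda>n. Fin (w n)) \<longlonglongrightarrow> y" using rep(2) by (auto simp: represents_def)
  have inFin: "\<forall>\<^sub>F n in sequentially. u n \<in> V"
    if "(\<lambda>n. Fin (u n)) \<longlonglongrightarrow> Fin v" "open V" "v \<in> V" for u :: "nat \<Rightarrow> complex" and v V
  proof -
    have "\<forall>\<^sub>F n in sequentially. Fin (u n) \<in> Fin ` V"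
      using that open_Fin_image[OF that(2)] topological_tendstoD by blast
    then show ?thesis by eventually_elim auto
  qed
  obtain xz where xz: "x = Fin xz" using x(1) CD(3) by (cases x) auto
  obtain yw where yw: "y = Fin yw" using y(1) CD(4) by (cases y) auto
  have "xz \<in> U" using U(3) x(1) xz by auto
  then have evU: "\<forall>\<^sub>F n in sequentially. z n \<in> U" using inFin x(2) xz oU by blast
  have evA: "\<forall>\<^sub>F n in sequentially. julia_part (p n) \<subseteq> A" by (rule represents_eventually[OF rep(1) AB(1-5)])
  have evB: "\<forall>\<^sub>F n in sequentially. julia_part (q n) \<subseteq> B"
    using AB by (intro represents_eventually[OF rep(2) AB(2,1)]) auto
  have "\<forall>\<^sub>F n in sequentially. ereal (log_cap (p n)) \<le> \<gamma>'"
    using evU evA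
  proof eventually_elim
    case (elim n)
    note dp = deg[OF pG(1)[of n]]
    have "K \<inter> frontier (filled_julia (p n)) = {}"
      using elim(2) AB(3,6) by (auto simp: K_def julia_part_def)
    then have dec: "K \<subseteq> filled_julia (p n) \<or> K \<inter> filled_julia (p n) = {}" by (rule filled_decides_connected[OF conK])
    have "\<not> K \<subseteq> filled_julia (p n)"
    proof
      assume "K \<subseteq> filled_julia (p n)"
      then have sub: "- filled_julia (p n) \<subseteq> - K" by blast
      have "z n \<in> closure (- filled_julia (p n))" using pG(2)[of n] by (simp add: frontier_closures)
      then have "U \<inter> - filled_julia (p n) \<noteq> {}" using elim(1) oU open_Int_closure_eq_empty[of U "- filled_julia (p n)"] by blast
      then have "- filled_julia (p n) \<subseteq> U"
        using components_maximal[OF U(1) connected_Compl_filled[OF dp]] sub by (auto simp: K_def)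
      then have "bounded (- filled_julia (p n))" using U(2) bounded_subset by blast
      moreover have "\<not> bounded (- filled_julia (p n))"
        using compact_filled[OF dp] by (simp add: cobounded_imp_unbounded compact_imp_bounded)
      ultimately show False by blast
    qed
    with dec have "yw \<in> - filled_julia (p n)" using y(1) yw by (auto simp: K_def)
    moreover have "open (- filled_julia (p n))" using compact_filled[OF dp] by (simp add: compact_imp_closed open_Compl)
    ultimately have "\<forall>\<^sub>F m in sequentially. w m \<in> - filled_julia (p n)" using inFin y(2) yw by blast
    with evB have "\<forall>\<^sub>F m in sequentially. ereal (log_cap (p n)) \<le> ereal (log_cap (q m))"
    proof eventually_elim
      case (elim m)
      have "julia_part (p n) \<inter> julia_part (q m) = {}"
        using \<open>julia_part (p n) \<subseteq> A\<close> elim(1) AB(3) by blast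
      then have "frontier (filled_julia (p n)) \<inter> frontier (filled_julia (q m)) = {}" by (auto simp: julia_part_def)
      from nested[OF pG(1) qG(1) this] have "filled_julia (p n) \<subseteq> filled_julia (q m)"
      proof
        assume "filled_julia (q m) \<subseteq> interior (filled_julia (p n))"
        then have "w m \<in> filled_julia (p n)"
          using qG(2)[of m] frontier_filled_subset[OF deg[OF qG(1)[of m]]] interior_subset by blast
        then show ?thesis using elim(2) by blast
      qed (use interior_subset in blast)
      then show ?case using log_cap_mono[OF dp deg[OF qG(1)]] by simp
    qed
    \<comment> \<open>How large \<open>m\<close> has to be depends on \<open>n\<close>, so the limit
      in \<open>m\<close> is taken first.\<close>
    then show ?case using lims(2) by (intro tendsto_lowerbound) auto
  qed
  then show ?thesis using lims(1) by (intro tendsto_upperbound) auto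
qed

text \<open>Components are disjoint intervals here, so a single comparison decides the order of all
  their points.\<close>

lemma less_r_components:
  assumes K: "K \<in> components M" "L \<in> components M" "K \<noteq> L" and xy: "x \<in> K" "y \<in> L" "x \<le> (y :: ereal)"
  shows "less_r K L"
  unfolding less_r_def
proof (intro conjI ballI)
  have dis: "K \<inter> L = {}" using K components_nonoverlap by blast
  fix s t assume st: "s \<in> K" "t \<in> L"
  show "s < t"
  proof (rule ccontr)
    assume "\<not> s < t"
    then have ts: "t \<le> s" by simp
    have cK: "{u..v} \<subseteq> K" if "u \<in> K" "v \<in> K" for u v
      using connected_contains_Icc[OF in_components_connected[OF K(1)]] that by blast
    have cL: "{u..v} \<subseteq> L" if "u \<in> L" "v \<in> L" for u v
      using connected_contains_Icc[OF in_components_connected[OF K(2)]] that by blast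
    show False
    proof (cases "t \<le> x")
      case True
      then have "x \<in> {t..y}" using xy by simp
      then show False using cL[OF st(2) xy(2)] dis xy by blast
    next
      case False
      then have "t \<in> {x..s}" using ts by simp
      then show False using cK[OF xy(1) st(1)] dis st by blast
    qed
  qed
qed (rule K)

lemma exists_component_injection:
  "\<exists>\<Phi>. inj_on \<Phi> (components (julia_set G)) \<and>
    \<Phi> ` components (julia_set G) \<subseteq> components (repelling_closure (Psi ` G)) \<and>
    (\<forall>J1\<in>planar_julia_components G. \<forall>J2\<in>planar_julia_components G.
       surrounded_by (Fin -` J1) (Fin -` J2) \<longrightarrow> less_r (\<Phi> J1) (\<Phi> J2))"
proof -
  define M where "M = repelling_closure (Psi ` G)"
  obtain p z \<gamma> where rep: "\<And>C. C \<in> components (julia_set G) \<Longrightarrow> represents C (p C) (z C) (\<gamma> C)"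
    using represents_exists by metis
  define \<Phi> where "\<Phi> = (\<lambda>C. connected_component_set M (\<gamma> C))"
  have \<gamma>M: "\<gamma> C \<in> M" if "C \<in> components (julia_set G)" for C
    unfolding M_def by (rule represents_in_repelling_closure[OF rep[OF that]])
  have \<Phi>: "\<Phi> C \<in> components M" "\<gamma> C \<in> \<Phi> C" if "C \<in> components (julia_set G)" for C
    using \<gamma>M[OF that] by (auto simp: \<Phi>_def components_def connected_component_refl_eq)
  have ne: "\<Phi> C \<noteq> \<Phi> D" if "C \<in> components (julia_set G)" "D \<in> components (julia_set G)" "C \<noteq> D" for C D
    using represents_different_components[OF that rep[OF that(1)] rep[OF that(2)], of "\<Phi> C"] \<Phi> that
    by (auto simp: M_def)
  show ?thesis
  proof (intro exI[of _ \<Phi>] conjI ballI impI)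
    show "inj_on \<Phi> (components (julia_set G))" using ne by (auto simp: inj_on_def)
    show "\<Phi> ` components (julia_set G) \<subseteq> components (repelling_closure (Psi ` G))"
      using \<Phi> by (auto simp: M_def)
    fix J1 J2 assume J: "J1 \<in> planar_julia_components G" "J2 \<in> planar_julia_components G"
      "surrounded_by (Fin -` J1) (Fin -` J2)"
    then have J': "J1 \<in> components (julia_set G)" "J2 \<in> components (julia_set G)" "J1 \<noteq> J2"
      by (auto simp: planar_julia_components_def surrounded_by_def)
    show "less_r (\<Phi> J1) (\<Phi> J2)"
      using less_r_components[OF \<Phi>(1)[OF J'(1)] \<Phi>(1)[OF J'(2)] ne[OF J'] \<Phi>(2)[OF J'(1)] \<Phi>(2)[OF J'(2)]]
        represents_order[OF J rep[OF J'(1)] rep[OF J'(2)]] by blast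
  qed
qed

end

section \<open>Real affine semigroups\<close>

text \<open>The pairs \<open>(x, d)\<close> stand for the contractions \<open>u \<mapsto> x + (u - x) / d\<close>. Starting at
  a point of \<open>N\<close> just below a gap, one adds a small multiple of a huge element of \<open>N\<close>;
  contracting towards \<open>c\<close> tunes that multiple to a size that lands in the gap.\<close>

lemma ray_subset_of_contraction_invariant:
  fixes N :: "real set" and I :: "(real \<times> real) set"
  assumes N: "closed N" and dense: "N \<subseteq> closure (fst ` I)" and d: "\<And>x d. (x, d) \<in> I \<Longrightarrow> d \<ge> 2"
    and sub: "fst ` I \<subseteq> N"
    and inv: "\<And>x d u. (x, d) \<in> I \<Longrightarrow> u \<in> N \<Longrightarrow> x + (u - x) / d \<in> N"
    and unb: "\<And>K. \<exists>u\<in>N. u > K"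
    and c: "(c, D) \<in> I"
  shows "{c..} \<subseteq> N"
proof
  fix y assume "y \<in> {c..}"
  then have cy: "c \<le> y" by simp
  have cN: "c \<in> N" using c sub by force
  show "y \<in> N"
  proof (rule ccontr)
    assume "y \<notin> N"
    then have "open (- N)" "y \<in> - N" using N by auto
    then obtain \<epsilon> where \<epsilon>: "\<epsilon> > 0" "ball y \<epsilon> \<subseteq> - N" using open_contains_ball by blast
    \<comment> \<open>The largest element \<open>a\<close> of \<open>N\<close> between
      \<open>c\<close> and \<open>y\<close> is the lower end of a gap that reaches up to
      \<open>y + \<epsilon>\<close>.\<close>
    define S where "S = N \<inter> {c..y}"
    have "compact S" unfolding S_def using N by (intro closed_Int_compact) auto
    moreover have "S \<noteq> {}" using cN cy by (auto simp: S_def)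
    ultimately obtain a where a: "a \<in> S" "\<And>s. s \<in> S \<Longrightarrow> s \<le> a" using compact_attains_sup[of S] by blast
    have aN: "a \<in> N" and ay: "a \<le> y - \<epsilon>"
    proof -
      show "a \<in> N" using a by (simp add: S_def)
      then have "a \<notin> ball y \<epsilon>" using \<epsilon> by blast
      moreover have "a \<le> y" using a by (simp add: S_def)
      ultimately show "a \<le> y - \<epsilon>" by (auto simp: dist_real_def)
    qed
    have gap: "v \<notin> N" if "a < v" "v < y + \<epsilon>" for v
    proof
      assume v: "v \<in> N"
      show False
      proof (cases "v \<le> y")
        case True
        have "c \<le> a" using a(1) by (simp add: S_def)
        then have "v \<in> S" using v True that by (simp add: S_def)
        then show False using a(2)[of v] that by simp
      next
        case False
        then have "v \<in> ball y \<epsilon>" using that by (simp add: dist_real_def)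
        then show False using v \<epsilon> by blast
      qed
    qed
    have D: "D \<ge> 2" using d[OF c] .
    \<comment> \<open>The added term \<open>s k\<close> will be at least
      \<open>\<epsilon> / D\<close>, which is \<open>4 * \<eta>\<close>, while the errors
      \<open>x - a\<close> and \<open>(c - x) / V ^ j\<close> stay below \<open>\<eta>\<close> each.
      So the point constructed lies above \<open>a\<close>, and
      \<open>\<eta> * 8 \<le> \<epsilon>\<close> keeps it below
      \<open>y + \<epsilon>\<close>.\<close>
    define \<eta> where "\<eta> = \<epsilon> / (4 * D)"
    have \<eta>: "\<eta> > 0" using \<epsilon> D by (simp add: \<eta>_def)
    have "\<eta> * (4 * D) = \<epsilon>" using D by (simp add: \<eta>_def)
    moreover have "\<eta> * (4 * D) \<ge> \<eta> * 8" using D \<eta> by (intro mult_left_mono) auto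
    ultimately have \<eta>8: "\<eta> * 8 \<le> \<epsilon>" by simp
    have "a \<in> closure (fst ` I)" using aN dense by blast
    then obtain x0 where "x0 \<in> fst ` I" "dist x0 a < \<eta>" using \<eta> unfolding closure_approachable by blast
    then obtain x V where xV: "(x, V) \<in> I" "\<bar>x - a\<bar> < \<eta>" by (auto simp: dist_real_def)
    have V: "V \<ge> 2" using d[OF xV(1)] .
    have iter: "x' + (u - x') / V' ^ k \<in> N" if "(x', V') \<in> I" "u \<in> N" for x' V' u k
    proof (induction k)
      case (Suc k)
      have "x' + (x' + (u - x') / V' ^ k - x') / V' \<in> N" by (rule inv[OF that(1) Suc])
      then show ?case by (simp add: mult.commute)
    qed (use that in simp)
    have "(\<lambda>j. (c - x) * inverse (V ^ j)) \<longlonglongrightarrow> (c - x) * 0"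
      using V by (intro tendsto_mult tendsto_const LIMSEQ_inverse_realpow_zero) auto
    then have "\<forall>\<^sub>F j in sequentially. dist ((c - x) * inverse (V ^ j)) 0 < \<eta>"
      using \<eta> by (intro tendstoD) auto
    then obtain j where j: "\<bar>(c - x) / V ^ j\<bar> < \<eta>" by (auto simp: eventually_sequentially divide_inverse)
    have Vj: "V ^ j > 0" using V by simp
    obtain u where u: "u \<in> N" "u > c + \<epsilon> * V ^ j" using unb by blast
    define s where "s = (\<lambda>k. (u - c) / (V ^ j * D ^ k))"
    have P: "x + (c - x) / V ^ j + s k \<in> N" for k
    proof -
      \<comment> \<open>First \<open>k\<close> contractions towards \<open>c\<close>, then
        \<open>j\<close> contractions towards \<open>x\<close>.\<close>
      have "x + (c + (u - c) / D ^ k - x) / V ^ j \<in> N" by (intro iter xV c u)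
      moreover have "(c + (u - c) / D ^ k - x) / V ^ j = (c - x) / V ^ j + s k"
        by (simp add: s_def add_divide_distrib diff_divide_distrib mult.commute)
      ultimately show ?thesis by (simp add: add.assoc)
    qed
    have "s \<longlonglongrightarrow> (u - c) / V ^ j * 0"
    proof -
      have "(\<lambda>k. (u - c) / V ^ j * inverse (D ^ k)) \<longlonglongrightarrow> (u - c) / V ^ j * 0"
        using D by (intro tendsto_mult tendsto_const LIMSEQ_inverse_realpow_zero) auto
      moreover have "s = (\<lambda>k. (u - c) / V ^ j * inverse (D ^ k))" by (auto simp: s_def divide_inverse)
      ultimately show ?thesis by simp
    qed
    then have "\<forall>\<^sub>F k in sequentially. s k < \<epsilon>" using \<epsilon> by (intro order_tendstoD) auto
    then have ex: "\<exists>k. s k < \<epsilon>" by (auto simp: eventually_sequentially)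
    \<comment> \<open>\<open>s\<close> starts above \<open>\<epsilon>\<close>, by the choice of
      \<open>u\<close>, and shrinks by the factor \<open>D\<close> at each step; its first value
      below \<open>\<epsilon>\<close> is therefore at least \<open>\<epsilon> / D\<close>.\<close>
    define k where "k = (LEAST k. s k < \<epsilon>)"
    have k: "s k < \<epsilon>" unfolding k_def using ex by (rule LeastI_ex)
    have "s 0 > \<epsilon>" using u Vj by (simp add: s_def field_simps)
    then have "k \<noteq> 0" using k by (metis less_asym)
    then obtain k' where k': "k = Suc k'" by (cases k) auto
    have "\<not> s k' < \<epsilon>" using not_less_Least[of k' "\<lambda>k. s k < \<epsilon>"] k' by (simp add: k_def)
    moreover have "s k' = D * s k" using D by (simp add: s_def k')
    ultimately have "\<epsilon> \<le> D * s k" by simp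
    then have "\<eta> * 4 \<le> s k" using D by (simp add: \<eta>_def field_simps)
    then have "a < x + (c - x) / V ^ j + s k" "x + (c - x) / V ^ j + s k < y + \<epsilon>"
      using j xV(2) k ay \<eta> \<eta>8 by linarith+
    then show False using gap P[of k] by blast
  qed
qed

context connected_semigroup
begin

section \<open>The real set of logarithmic capacities\<close>

definition cap_set :: "real set" where "cap_set = closure (log_cap ` G)"

lemma closed_cap_set: "closed cap_set" by (simp add: cap_set_def)

lemma log_cap_in_cap_set: "p \<in> G \<Longrightarrow> log_cap p \<in> cap_set"
  unfolding cap_set_def using closure_subset by blast

text \<open>The map is the inverse of \<open>Psi p\<close>. Let \<open>f k\<close> be a high iterate
  of \<open>q\<close> after \<open>p\<close>. \<open>Psi p\<close> carries the fixed point
  \<open>log_cap (f k)\<close> close to \<open>log_cap q\<close>, because the inverse of the affine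
  map of the iterate contracts strongly towards \<open>log_cap q\<close>. So
  \<open>log_cap (f k)\<close> tends to the preimage of \<open>log_cap q\<close> under
  \<open>Psi p\<close>.\<close>

lemma cap_set_backward_invariant:
  assumes p: "p \<in> G" and u: "u \<in> cap_set"
  shows "log_cap p + (u - log_cap p) / real (degree p) \<in> cap_set"
proof -
  define \<phi> where "\<phi> = (\<lambda>u. log_cap p + (u - log_cap p) / real (degree p))"
  have dp: "real (degree p) \<ge> 2" using deg[OF p] by simp
  have "\<phi> (log_cap q) \<in> cap_set" if q: "q \<in> G" for q
  proof -
    define e where "e = real (degree p)"
    define d where "d = real (degree q)"
    have d: "d \<ge> 2" using deg[OF q] by (simp add: d_def)
    have e: "e \<ge> 2" using dp by (simp add: e_def)
    define f where "f = (\<lambda>k. pcompose (iter_poly q (Suc k)) p)"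
    have fG: "f k \<in> G" for k unfolding f_def by (intro comp iter_in p q)
    have lf: "log_cap (f k) = ((1 - inverse (d ^ Suc k)) * log_cap q + (e - 1) * log_cap p) / (e - inverse (d ^ Suc k))" for k
    proof -
      define t where "t = d ^ Suc k"
      have t1: "t \<ge> 1" unfolding t_def using d by (intro one_le_power) simp
      then have t0: "t > 0" by simp
      have "inverse t \<le> 1" using t1 le_imp_inverse_le[of 1 t] by simp
      then have pos: "e - inverse t > 0" using e by simp
      have "(t * e - 1) * log_cap (f k) = (t - 1) * log_cap q + t * (e - 1) * log_cap p"
        using log_cap_pcompose[OF deg[OF iter_in[OF q]] deg[OF p], of k] log_cap_iter_poly[OF deg[OF q], of k]
        unfolding degree_iter_poly of_nat_power by (simp add: f_def d_def e_def t_def del: iter_poly.simps power_Suc)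
      then have "inverse t * ((t * e - 1) * log_cap (f k)) =
          inverse t * ((t - 1) * log_cap q + t * (e - 1) * log_cap p)" by simp
      moreover have "inverse t * ((t * e - 1) * X) = (e - inverse t) * X" for X
        using t0 by (simp add: field_simps)
      moreover have "inverse t * ((t - 1) * X + t * (e - 1) * Y) = (1 - inverse t) * X + (e - 1) * Y" for X Y
        using t0 by (simp add: field_simps)
      ultimately have "(e - inverse t) * log_cap (f k) = (1 - inverse t) * log_cap q + (e - 1) * log_cap p"
        by simp
      then show ?thesis using pos unfolding t_def[symmetric] by (simp add: eq_divide_eq mult.commute)
    qed
    have "(\<lambda>k. inverse (d ^ Suc k)) \<longlonglongrightarrow> 0"
      using d by (intro LIMSEQ_Suc LIMSEQ_inverse_realpow_zero) auto
    then have "(\<lambda>k. log_cap (f k)) \<longlonglongrightarrow> ((1 - 0) * log_cap q + (e - 1) * log_cap p) / (e - 0)"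
      unfolding lf using e by (intro tendsto_intros) auto
    moreover have "((1 - 0) * log_cap q + (e - 1) * log_cap p) / (e - 0) = \<phi> (log_cap q)"
      using e by (simp add: \<phi>_def e_def[symmetric] field_simps)
    ultimately have "(\<lambda>k. log_cap (f k)) \<longlonglongrightarrow> \<phi> (log_cap q)" by simp
    then show ?thesis
      by (rule closed_sequentially[OF closed_cap_set, rotated]) (rule log_cap_in_cap_set[OF fG])
  qed
  then have "\<phi> ` log_cap ` G \<subseteq> cap_set" by blast
  moreover have "continuous_on (closure (log_cap ` G)) \<phi>"
    unfolding \<phi>_def by (intro continuous_intros) (use dp in auto)
  ultimately have "\<phi> ` closure (log_cap ` G) \<subseteq> cap_set"
    using closed_cap_set by (intro image_closure_subset)
  then have "\<phi> ` cap_set \<subseteq> cap_set" by (simp add: cap_set_def)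
  then show ?thesis using u by (auto simp: \<phi>_def)
qed

lemma repelling_closure_eq: "repelling_closure (Psi ` G) = closure (ereal ` cap_set)"
proof -
  have "continuous_on (closure (log_cap ` G)) ereal" by (intro continuous_on_ereal continuous_on_id)
  then have "ereal ` cap_set \<subseteq> closure (ereal ` log_cap ` G)"
    unfolding cap_set_def using closed_closure closure_subset by (rule image_closure_subset)
  then have "closure (ereal ` cap_set) \<subseteq> closure (ereal ` log_cap ` G)" by (intro closure_minimal closed_closure)
  moreover have "ereal ` log_cap ` G \<subseteq> ereal ` cap_set" using log_cap_in_cap_set by blast
  then have "closure (ereal ` log_cap ` G) \<subseteq> closure (ereal ` cap_set)" by (rule closure_mono)
  ultimately have "closure (ereal ` cap_set) = closure (ereal ` log_cap ` G)" by (rule subset_antisym)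
  then show ?thesis by (simp add: repelling_closure_Psi image_image)
qed

lemma connected_repelling_closure_if_interval:
  assumes "connected cap_set"
  shows "connected (repelling_closure (Psi ` G))"
  unfolding repelling_closure_eq
  by (intro connected_imp_connected_closure connected_continuous_image assms continuous_on_ereal continuous_on_id)

text \<open>The ray above every \<open>log_cap p\<close> lies in \<open>cap_set\<close>. As these
  points are dense in \<open>cap_set\<close>, everything above any of its points belongs to
  it.\<close>

lemma connected_cap_set_if_unbounded_above:
  assumes unb: "\<And>K. \<exists>u\<in>cap_set. u > K"
  shows "connected cap_set"
proof -
  define I where "I = (\<lambda>p. (log_cap p, real (degree p))) ` G"
  have ray: "{log_cap p..} \<subseteq> cap_set" if p: "p \<in> G" for p
  proof (rule ray_subset_of_contraction_invariant[of cap_set I])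
    have fI: "fst ` I = log_cap ` G" unfolding I_def image_image by simp
    show "cap_set \<subseteq> closure (fst ` I)" by (simp add: fI cap_set_def)
    show "fst ` I \<subseteq> cap_set" unfolding fI using log_cap_in_cap_set by blast
    show "(log_cap p, real (degree p)) \<in> I" using p by (simp add: I_def)
    show "x + (u - x) / d \<in> cap_set" if "(x, d) \<in> I" "u \<in> cap_set" for x d u
      using that cap_set_backward_invariant by (auto simp: I_def)
    show "2 \<le> d" if "(x, d) \<in> I" for x d using that deg by (auto simp: I_def)
    show "closed cap_set" by (rule closed_cap_set)
  qed (rule unb)
  have "is_interval cap_set" unfolding is_interval_1
  proof (intro ballI allI impI)
    fix x y z assume xz: "x \<in> cap_set" "z \<in> cap_set" "x \<le> y \<and> y \<le> z"
    show "y \<in> cap_set"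
    proof (cases "x = y")
      case False
      then have "y - x > 0" using xz by simp
      then obtain c where "c \<in> log_cap ` G" "dist c x < y - x"
        using xz(1) unfolding cap_set_def closure_approachable by blast
      then obtain p where p: "p \<in> G" "log_cap p \<le> y" by (auto simp: dist_real_def)
      then show ?thesis using ray[OF p(1)] by auto
    qed (use xz in simp)
  qed
  then show ?thesis by (simp add: is_interval_connected)
qed

lemma connected_cap_set_if_unbounded_below:
  assumes unb: "\<And>K. \<exists>u\<in>cap_set. u < K"
  shows "connected cap_set"
proof -
  \<comment> \<open>Reflection turns unboundedness below into unboundedness above and keeps the
    contraction ratios.\<close>
  define I where "I = (\<lambda>p. (- log_cap p, real (degree p))) ` G"
  have ray: "{..log_cap p} \<subseteq> cap_set" if p: "p \<in> G" for p
  proof -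
    have "{- log_cap p..} \<subseteq> uminus ` cap_set"
    proof (rule ray_subset_of_contraction_invariant[of "uminus ` cap_set" I])
      have fI: "fst ` I = uminus ` log_cap ` G" unfolding I_def image_image by simp
      show "closed (uminus ` cap_set)" using closed_cap_set by (rule closed_negations)
      show "uminus ` cap_set \<subseteq> closure (fst ` I)"
        unfolding fI cap_set_def
        by (rule image_closure_subset[OF _ closed_closure closure_subset]) (intro continuous_intros)
      show "fst ` I \<subseteq> uminus ` cap_set" unfolding fI using log_cap_in_cap_set by blast
      show "(- log_cap p, real (degree p)) \<in> I" using p by (simp add: I_def)
      show "x + (u - x) / d \<in> uminus ` cap_set" if xd: "(x, d) \<in> I" and u: "u \<in> uminus ` cap_set" for x d u
      proof -
        obtain q where q: "q \<in> G" "x = - log_cap q" "d = real (degree q)" using xd by (auto simp: I_def)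
        obtain v where v: "v \<in> cap_set" "u = - v" using u by blast
        have "x + (u - x) / d = - (log_cap q + (v - log_cap q) / real (degree q))"
          by (simp add: q v diff_divide_distrib add_divide_distrib)
        then show ?thesis using cap_set_backward_invariant[OF q(1) v(1)] by blast
      qed
      show "2 \<le> d" if "(x, d) \<in> I" for x d using that deg by (auto simp: I_def)
      show "\<exists>u\<in>uminus ` cap_set. u > K" for K
      proof -
        obtain u where "u \<in> cap_set" "u < - K" using unb by blast
        then show ?thesis by (intro bexI[of _ "- u"]) auto
      qed
    qed
    show ?thesis
    proof
      fix v assume "v \<in> {..log_cap p}"
      then have "- v \<in> uminus ` cap_set" using \<open>{- log_cap p..} \<subseteq> uminus ` cap_set\<close> by auto
      then show "v \<in> cap_set" by auto
    qed
  qed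
  have "is_interval cap_set" unfolding is_interval_1
  proof (intro ballI allI impI)
    fix x y z assume xz: "x \<in> cap_set" "z \<in> cap_set" "x \<le> y \<and> y \<le> z"
    show "y \<in> cap_set"
    proof (cases "z = y")
      case False
      then have "z - y > 0" using xz by simp
      then obtain c where "c \<in> log_cap ` G" "dist c z < z - y"
        using xz(2) unfolding cap_set_def closure_approachable by blast
      then obtain p where p: "p \<in> G" "y \<le> log_cap p" by (auto simp: dist_real_def)
      then show ?thesis using ray[OF p(1)] by auto
    qed (use xz in simp)
  qed
  then show ?thesis by (simp add: is_interval_connected)
qed

lemma disconnected_julia_set:
  assumes dis: "\<not> connected (julia_set G)"
  shows "\<not> connected (repelling_closure (Psi ` G))"
proof
  assume con: "connected (repelling_closure (Psi ` G))"
  obtain C D where CD: "C \<in> components (julia_set G)" "D \<in> components (julia_set G)" "C \<noteq> D"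
    using dis by (auto simp: connected_eq_connected_components_eq)
  obtain \<Phi> where \<Phi>: "inj_on \<Phi> (components (julia_set G))"
    "\<Phi> ` components (julia_set G) \<subseteq> components (repelling_closure (Psi ` G))"
    using exists_component_injection by blast
  have "\<Phi> C = \<Phi> D"
    using con \<Phi>(2) CD by (meson connected_eq_connected_components_eq image_subset_iff)
  then show False using \<Phi>(1) CD by (meson inj_on_contraD)
qed

text \<open>Were \<open>cap_set\<close> unbounded in either direction, it would be connected, and
  with it \<open>repelling_closure\<close>; the injection of components would then leave
  \<open>julia_set G\<close> a single one.\<close>

lemma compact_cap_set:
  assumes dis: "\<not> connected (julia_set G)"
  shows "compact cap_set"
proof -
  have nc: "\<not> connected cap_set"
    using disconnected_julia_set[OF dis] connected_repelling_closure_if_interval by blast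
  obtain K where K: "\<And>u. u \<in> cap_set \<Longrightarrow> u \<le> K"
    using connected_cap_set_if_unbounded_above nc by (meson not_le)
  obtain L where L: "\<And>u. u \<in> cap_set \<Longrightarrow> L \<le> u"
    using connected_cap_set_if_unbounded_below nc by (meson not_le)
  have "cap_set \<subseteq> {L..K}" using K L by auto
  then have "bounded cap_set" using bounded_closed_interval bounded_subset by blast
  then show ?thesis using closed_cap_set compact_eq_bounded_closed by blast
qed

lemma repelling_closure_eq_cap_set:
  assumes "\<not> connected (julia_set G)"
  shows "repelling_closure (Psi ` G) = ereal ` cap_set"
proof -
  have "compact (ereal ` cap_set)"
    using compact_cap_set[OF assms] by (intro compact_continuous_image continuous_on_ereal continuous_on_id)
  then show ?thesis by (simp add: repelling_closure_eq compact_imp_closed)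
qed

section \<open>The affine semigroup acting on the plane\<close>

lemma eta_Psi:
  "p \<in> G \<Longrightarrow> poly (eta (Psi p)) z = of_real (log_cap p) + of_real (real (degree p)) * (z - of_real (log_cap p))"
proof -
  assume "p \<in> G"
  then have "Psi p x = log_cap p + real (degree p) * (x - log_cap p)" for x using Psi_eq_log_cap deg by blast
  then have *: "Psi p 0 = log_cap p - real (degree p) * log_cap p"
    "Psi p 1 = log_cap p + real (degree p) - real (degree p) * log_cap p"
    by (simp_all add: algebra_simps)
  show ?thesis unfolding eta_def * by (simp add: algebra_simps)
qed

lemma degree_eta_Psi: "p \<in> G \<Longrightarrow> degree (eta (Psi p)) \<ge> 1"
  using deg[of p] by (simp add: eta_def Psi_def)

text \<open>The maps coming from the iterates of \<open>p\<close> fix \<open>log_cap p\<close> and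
  expand about it by powers of the degree, so points arbitrarily near escape.\<close>

lemma log_cap_in_julia_eta:
  assumes p: "p \<in> G"
  shows "Fin (of_real (log_cap p)) \<in> julia_set (eta ` Psi ` G)"
proof (rule escape_near_bounded_orbit_in_julia[of "\<lambda>n. eta (Psi (iter_poly p (Suc n)))"])
  define d where "d = real (degree p)"
  have d: "d \<ge> 2" using deg[OF p] by (simp add: d_def)
  have val: "poly (eta (Psi (iter_poly p (Suc n)))) w = of_real (log_cap p) + of_real (d ^ Suc n) * (w - of_real (log_cap p))" for n w
    using eta_Psi[OF iter_in[OF p], of n w] log_cap_iter_poly[OF deg[OF p], of n]
    by (simp add: degree_iter_poly d_def del: iter_poly.simps)
  show "eta (Psi (iter_poly p (Suc n))) \<in> eta ` Psi ` G" for n using iter_in[OF p] by blast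
  show "cmod (poly (eta (Psi (iter_poly p (Suc n)))) (of_real (log_cap p))) \<le> \<bar>log_cap p\<bar>" for n
    unfolding val by simp
  fix e :: real assume e: "e > 0"
  define w where "w = complex_of_real (log_cap p + e / 2)"
  have "dist w (of_real (log_cap p)) < e" using e by (simp add: w_def dist_norm)
  moreover have "filterlim (\<lambda>n. poly (eta (Psi (iter_poly p (Suc n)))) w) at_infinity sequentially"
    unfolding val
  proof (rule tendsto_add_filterlim_at_infinity[OF tendsto_const], unfold filterlim_at_infinity_conv_norm_at_top)
    have "filterlim (\<lambda>n. (2::real) ^ n) at_top sequentially" by real_asymp
    then have "filterlim (\<lambda>n. d ^ n) at_top sequentially"
      by (rule filterlim_at_top_mono) (use d in \<open>auto intro!: always_eventually power_mono\<close>)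
    then have "filterlim (\<lambda>n. d ^ Suc n * (e / 2)) at_top sequentially"
      using e by (intro filterlim_at_top_mult_tendsto_pos[OF tendsto_const] filterlim_compose[OF _ filterlim_Suc]) auto
    moreover have "cmod (of_real (d ^ Suc n) * (w - of_real (log_cap p))) = d ^ Suc n * (e / 2)" for n
      using d e unfolding norm_mult norm_of_real by (simp add: w_def)
    ultimately show "filterlim (\<lambda>n. cmod (of_real (d ^ Suc n) * (w - of_real (log_cap p)))) at_top sequentially"
      by (simp only:)
  qed
  ultimately show "\<exists>w. dist w (of_real (log_cap p)) < e \<and>
    filterlim (\<lambda>n. poly (eta (Psi (iter_poly p (Suc n)))) w) at_infinity sequentially" by blast
qed

text \<open>A point of the plane that some \<open>eta (Psi p)\<close> maps to a point of
  \<open>cap_set\<close> is itself a real point of \<open>cap_set\<close>, by invariance under the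
  inverse maps. So off \<open>cap_set\<close> all maps omit \<open>cap_set\<close>, which has two
  points because it is disconnected. Its boundedness gives normality at
  \<open>Infty\<close>.\<close>

lemma julia_eta_eq:
  assumes dis: "\<not> connected (julia_set G)"
  shows "julia_set (eta ` Psi ` G) = (\<lambda>x. Fin (of_real x)) ` cap_set"
proof
  define E where "E = (\<lambda>x. Fin (complex_of_real x)) ` cap_set"
  have cont: "continuous_on X (\<lambda>x. Fin (complex_of_real x))" for X
    by (intro continuous_on_Fin continuous_on_of_real continuous_on_id)
  have clJ: "closed (julia_set (eta ` Psi ` G))" unfolding julia_set_def using open_fatou_set by (simp add: closed_def)
  show "(\<lambda>x. Fin (of_real x)) ` cap_set \<subseteq> julia_set (eta ` Psi ` G)"
    unfolding cap_set_def
    by (rule image_closure_subset[OF cont clJ]) (use log_cap_in_julia_eta in blast)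
  have cE: "closed (complex_of_real ` cap_set)"
    using compact_cap_set[OF dis] by (intro compact_imp_closed compact_continuous_image continuous_on_of_real continuous_on_id)
  obtain a c where ac: "a \<in> cap_set" "c \<in> cap_set" "a \<noteq> c"
  proof -
    have "\<not> connected cap_set"
      using disconnected_julia_set[OF dis] connected_repelling_closure_if_interval by blast
    then have "cap_set \<noteq> {}" "\<And>a. cap_set \<noteq> {a}" by auto
    then show ?thesis using that by blast
  qed
  show "julia_set (eta ` Psi ` G) \<subseteq> (\<lambda>x. Fin (of_real x)) ` cap_set"
  proof (rule ccontr)
    assume "\<not> ?thesis"
    then obtain x where x: "x \<in> julia_set (eta ` Psi ` G)" "x \<notin> E" by (auto simp: E_def)
    have "x \<in> fatou_set (eta ` Psi ` G)"
    proof (cases x)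
      case (Fin z)
      have "z \<in> - complex_of_real ` cap_set" using x(2) Fin by (auto simp: E_def)
      moreover have "open (- complex_of_real ` cap_set)" using cE by (simp add: open_Compl)
      ultimately obtain e where e: "e > 0" "ball z e \<subseteq> - complex_of_real ` cap_set"
        using open_contains_ball by blast
      have avoid: "poly (eta (Psi p)) w \<noteq> of_real v" if p: "p \<in> G" and w: "w \<in> ball z e" and v: "v \<in> cap_set" for p w v
      proof
        assume "poly (eta (Psi p)) w = of_real v"
        then have "of_real (real (degree p)) * (w - of_real (log_cap p)) = of_real (v - log_cap p)"
          unfolding eta_Psi[OF p] by (simp add: algebra_simps)
        moreover have "of_real (real (degree p)) \<noteq> (0 :: complex)" using deg[OF p] by auto
        ultimately have "w - of_real (log_cap p) = of_real (v - log_cap p) / of_real (real (degree p))"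
          by (metis nonzero_mult_div_cancel_left)
        then have "w = of_real (log_cap p + (v - log_cap p) / real (degree p))" by (simp add: algebra_simps)
        then have "w \<in> complex_of_real ` cap_set" using cap_set_backward_invariant[OF p v] by blast
        then show False using w e by blast
      qed
      have "normal_family_on (Fin ` ball z e) (sphere_map ` eta ` Psi ` G)"
      proof (rule normal_family_two_omitted_values[of _ "of_real a" "of_real c"])
        show "poly q w \<noteq> of_real a \<and> poly q w \<noteq> of_real c" if "q \<in> eta ` Psi ` G" "w \<in> ball z e" for q w
          using that avoid ac by blast
      qed (use e ac in auto)
      moreover have "open (Fin ` ball z e)" by (rule open_Fin_image) simp
      ultimately show ?thesis using Fin e unfolding fatou_set_def by force
    next
      case Infty
      obtain R0 where R0: "\<And>u. u \<in> cap_set \<Longrightarrow> \<bar>u\<bar> \<le> R0"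
        using compact_imp_bounded[OF compact_cap_set[OF dis]] unfolding bounded_iff by auto
      \<comment> \<open>For \<open>cmod z \<ge> R\<close> the distance from \<open>z\<close> to each
        \<open>log_cap p\<close> is at least \<open>2 * max R0 1\<close>; doubled by the degree and
        reduced by \<open>\<bar>log_cap p\<bar>\<close>, it still exceeds 1.\<close>
      define R where "R = 3 * max R0 1"
      have "normal_family_on (- Fin ` cball 0 R) (sphere_map ` eta ` Psi ` G)"
      proof (rule normal_family_near_Infty)
        show "degree q \<ge> 1" if "q \<in> eta ` Psi ` G" for q using that degree_eta_Psi by blast
        show "R > 0" by (simp add: R_def)
        fix q z assume "q \<in> eta ` Psi ` G" and z: "R \<le> cmod z"
        then obtain p where p: "p \<in> G" "q = eta (Psi p)" by blast
        have l: "\<bar>log_cap p\<bar> \<le> max R0 1" using R0[OF log_cap_in_cap_set[OF p(1)]] by simp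
        have "2 * max R0 1 \<le> cmod z - \<bar>log_cap p\<bar>" using z l by (simp add: R_def)
        also have "\<dots> \<le> cmod (z - of_real (log_cap p))" using norm_triangle_ineq2[of z "of_real (log_cap p)"] by simp
        finally have z2: "2 * max R0 1 \<le> cmod (z - of_real (log_cap p))" .
        have "2 * (2 * max R0 1) \<le> real (degree p) * cmod (z - of_real (log_cap p))"
          using deg[OF p(1)] z2 by (intro mult_mono) auto
        also have "\<dots> = cmod (of_real (real (degree p)) * (z - of_real (log_cap p)))" by (simp only: norm_mult norm_of_real abs_of_nat)
        also have "\<dots> \<le> cmod (poly q z) + \<bar>log_cap p\<bar>"
          using norm_triangle_ineq4[of "poly q z" "of_real (log_cap p)"] unfolding p(2) eta_Psi[OF p(1)] by simp
        finally show "1 \<le> cmod (poly q z)" using l by linarith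
      qed
      moreover have "compact (Fin ` cball 0 R)"
        by (intro compact_continuous_image continuous_on_Fin continuous_on_id) auto
      then have "open (- Fin ` cball 0 R)" by (simp add: compact_imp_closed open_Compl)
      moreover have "x \<in> - Fin ` cball 0 R" using Infty by auto
      ultimately show ?thesis unfolding fatou_set_def by blast
    qed
    then show False using x by (simp add: julia_set_def)
  qed
qed

text \<open>A connected \<open>julia_set G\<close> has at most one component, and the affine Julia
  set is nonempty. In the disconnected case the affine Julia set and
  \<open>repelling_closure\<close> are both copies of \<open>cap_set\<close>, so the injection of
  components carries over.\<close>

lemma components_lepoll_eta:
  "components (julia_set G) \<lesssim> components (julia_set (eta ` Psi ` G))"
proof (cases "connected (julia_set G)")
  case True
  obtain p where "p \<in> G" using nonempty by blast
  then have "julia_set (eta ` Psi ` G) \<noteq> {}" using log_cap_in_julia_eta by blast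
  then obtain K where K: "K \<in> components (julia_set (eta ` Psi ` G))" by (metis components_eq_empty ex_in_conv)
  have "C = D" if "C \<in> components (julia_set G)" "D \<in> components (julia_set G)" for C D
    using True that by (simp add: connected_eq_connected_components_eq)
  then have "inj_on (\<lambda>_. K) (components (julia_set G))" by (auto simp: inj_on_def)
  then show ?thesis using K unfolding lepoll_def by blast
next
  case False
  note M = repelling_closure_eq_cap_set[OF False] and J = julia_eta_eq[OF False]
  have 1: "components (julia_set G) \<lesssim> components (repelling_closure (Psi ` G))"
    using exists_component_injection unfolding lepoll_def by blast
  have 2: "components (repelling_closure (Psi ` G)) \<lesssim> components (julia_set (eta ` Psi ` G))"
    unfolding M J
  proof (rule components_lepoll_if_section)
    have "continuous_on (range Fin) (\<lambda>x. ereal (Re (inv Fin x)))"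
      by (intro continuous_on_ereal continuous_on_Re continuous_on_inv_Fin)
    then show "continuous_on ((\<lambda>x. Fin (complex_of_real x)) ` cap_set) (\<lambda>x. ereal (Re (inv Fin x)))"
      by (rule continuous_on_subset) auto
    have inv: "inv Fin (Fin z) = z" for z by (simp add: inj_def)
    show "(\<lambda>x. ereal (Re (inv Fin x))) ` (\<lambda>x. Fin (complex_of_real x)) ` cap_set \<subseteq> ereal ` cap_set"
      by (auto simp: inv)
    show "(\<lambda>x. Fin (complex_of_real (real_of_ereal x))) ` ereal ` cap_set \<subseteq> (\<lambda>x. Fin (complex_of_real x)) ` cap_set"
      by auto
    show "ereal (Re (inv Fin (Fin (complex_of_real (real_of_ereal x))))) = x" if "x \<in> ereal ` cap_set" for x
      using that by (auto simp: inv)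
  qed
  show ?thesis using 1 2 by (rule lepoll_trans)
qed

end

section \<open>From postcritical boundedness to a common point\<close>

lemma generated_semigroup_pcompose:
  "polynomial_semigroup G \<Longrightarrow> p \<in> G \<Longrightarrow> q \<in> G \<Longrightarrow> pcompose p q \<in> G"
  unfolding polynomial_semigroup_def using generated_semigroup.compose by blast

text \<open>For a critical point \<open>c\<close> of \<open>g\<close>, the point
  \<open>h (g c)\<close> is a critical value of \<open>pcompose h g\<close>, so the semigroup maps
  \<open>cv\<close> into itself. Being bounded, \<open>cv\<close> lies in every filled Julia set.
  Critical points therefore have bounded orbits, and any point of \<open>cv\<close> can serve as the
  common point.\<close>

lemma postcritically_bounded_connected_semigroup:
  assumes G: "G \<in> \<G>" and ne: "G \<noteq> {}"
  shows "\<exists>b. connected_semigroup G b"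
proof -
  have sg: "polynomial_semigroup G" and deg: "\<And>g. g \<in> G \<Longrightarrow> degree g \<ge> 2"
    and bd: "bounded (Fin -` planar_postcritical_set G)"
    using G by (auto simp: postcritically_bounded_semigroups_def)
  note comp = generated_semigroup_pcompose[OF sg]
  define cv where "cv = {poly g c | g c. g \<in> G \<and> poly (pderiv g) c = 0}"
  have "cv \<subseteq> Fin -` planar_postcritical_set G"
  proof
    fix v assume "v \<in> cv"
    then obtain g c where gc: "g \<in> G" "poly (pderiv g) c = 0" "v = poly g c" by (auto simp: cv_def)
    have "critical_point g (Fin c)" using gc by simp
    then have "Fin v \<in> critical_values g"
      unfolding critical_values_def gc(3) by (metis (mono_tags) image_eqI mem_Collect_eq sphere_map.simps(1))
    then have "Fin v \<in> (\<Union>g\<in>G. critical_values g)" using gc(1) by blast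
    then have "Fin v \<in> postcritical_set G"
      unfolding postcritical_set_def by (rule closure_subset[THEN subsetD])
    then show "v \<in> Fin -` planar_postcritical_set G" by (simp add: planar_postcritical_set_def)
  qed
  then have bcv: "bounded cv" using bd bounded_subset by blast
  have fwd: "poly h v \<in> cv" if h: "h \<in> G" and v: "v \<in> cv" for h v
  proof -
    obtain g c where gc: "g \<in> G" "poly (pderiv g) c = 0" "v = poly g c" using v by (auto simp: cv_def)
    have "poly (pderiv (pcompose h g)) c = 0" using gc by (simp add: pderiv_pcompose)
    moreover have "poly h v = poly (pcompose h g) c" using gc by (simp add: poly_pcompose)
    ultimately show ?thesis using comp[OF h gc(1)] unfolding cv_def by blast
  qed
  have cvf: "v \<in> filled_julia h" if h: "h \<in> G" and v: "v \<in> cv" for h v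
  proof -
    have "(poly h ^^ n) v \<in> cv" for n by (induction n) (auto intro: fwd h v)
    then have "range (\<lambda>n. (poly h ^^ n) v) \<subseteq> cv" by blast
    then show ?thesis unfolding filled_julia_def using bcv bounded_subset by blast
  qed
  obtain g where g: "g \<in> G" using ne by blast
  \<comment> \<open>Degree at least 2 guarantees a critical point in the plane, so \<open>cv\<close>
    is nonempty.\<close>
  have "degree (pderiv g) \<noteq> 0" using deg[OF g] by (simp add: degree_pderiv)
  then have "\<not> constant (poly (pderiv g))" by (simp add: constant_degree)
  then obtain c where c: "poly (pderiv g) c = 0" using fundamental_theorem_of_algebra by blast
  have b: "poly g c \<in> cv" using g c unfolding cv_def by blast
  have "connected_semigroup G (poly g c)"
  proof
    show "connected (filled_julia p)" if p: "p \<in> G" for p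
    proof (rule connected_filled[OF deg[OF p]])
      fix c assume "poly (pderiv p) c = 0"
      then have "poly p c \<in> cv" using p unfolding cv_def by blast
      then show "c \<in> filled_julia p" using cvf[OF p] poly_in_filled_iff by blast
    qed
  qed (use ne deg comp cvf b in auto)
  then show ?thesis by blast
qed

text \<open>The empty family generates an empty semigroup, for which
  \<open>connected_semigroup\<close> fails; normality is vacuous because there is no sequence of
  maps to test.\<close>

lemma julia_set_empty: "julia_set {} = {}"
proof -
  have "normal_family_on UNIV (sphere_map ` {})" unfolding normal_family_on_def by auto
  then have "fatou_set {} = UNIV" unfolding fatou_set_def by blast
  then show ?thesis by (simp add: julia_set_def)
qed

theorem theorem2p12:
  shows
    "(\<forall>G\<in>\<G>.
       components (julia_set G) \<lesssim> components (repelling_closure (Psi ` G)) \<and>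
       (\<exists>\<Phi>. inj_on \<Phi> (components (julia_set G)) \<and>
            \<Phi> ` components (julia_set G) \<subseteq> components (repelling_closure (Psi ` G)) \<and>
            (\<forall>J1\<in>planar_julia_components G. \<forall>J2\<in>planar_julia_components G.
               surrounded_by (Fin -` J1) (Fin -` J2) \<longrightarrow> less_r (\<Phi> J1) (\<Phi> J2)))) \<and>
     (\<forall>G\<in>\<G>\<^sub>d\<^sub>i\<^sub>s.
       repelling_closure (Psi ` G) \<subseteq> range ereal \<and>
       (\<lambda>x. Fin (complex_of_real x)) ` (ereal -` repelling_closure (Psi ` G))
         = julia_set (eta ` Psi ` G)) \<and>
     (\<forall>G\<in>\<G>.
       components (julia_set G) \<lesssim> components (julia_set (eta ` Psi ` G)))"
proof (intro conjI ballI)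
  fix G assume G: "G \<in> \<G>"
  have inj: "\<exists>\<Phi>. inj_on \<Phi> (components (julia_set G)) \<and>
            \<Phi> ` components (julia_set G) \<subseteq> components (repelling_closure (Psi ` G)) \<and>
            (\<forall>J1\<in>planar_julia_components G. \<forall>J2\<in>planar_julia_components G.
               surrounded_by (Fin -` J1) (Fin -` J2) \<longrightarrow> less_r (\<Phi> J1) (\<Phi> J2))"
  proof (cases "G = {}")
    case True
    then show ?thesis by (simp add: julia_set_empty planar_julia_components_def)
  next
    case False
    then obtain b where "connected_semigroup G b" using postcritically_bounded_connected_semigroup[OF G] by blast
    then show ?thesis by (rule connected_semigroup.exists_component_injection)
  qed
  then show "\<exists>\<Phi>. inj_on \<Phi> (components (julia_set G)) \<and>
            \<Phi> ` components (julia_set G) \<subseteq> components (repelling_closure (Psi ` G)) \<and>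
            (\<forall>J1\<in>planar_julia_components G. \<forall>J2\<in>planar_julia_components G.
               surrounded_by (Fin -` J1) (Fin -` J2) \<longrightarrow> less_r (\<Phi> J1) (\<Phi> J2))" .
  show "components (julia_set G) \<lesssim> components (repelling_closure (Psi ` G))"
    using inj unfolding lepoll_def by blast
  show "components (julia_set G) \<lesssim> components (julia_set (eta ` Psi ` G))"
  proof (cases "G = {}")
    case True
    then show ?thesis by (simp add: julia_set_empty)
  next
    case False
    then obtain b where "connected_semigroup G b" using postcritically_bounded_connected_semigroup[OF G] by blast
    then show ?thesis by (rule connected_semigroup.components_lepoll_eta)
  qed
next
  fix G assume G: "G \<in> \<G>\<^sub>d\<^sub>i\<^sub>s"
  then have dis: "\<not> connected (julia_set G)" and G': "G \<in> \<G>" by (auto simp: disconnected_semigroups_def)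
  then have "G \<noteq> {}" using julia_set_empty by auto
  then obtain b where "connected_semigroup G b" using postcritically_bounded_connected_semigroup[OF G'] by blast
  then interpret connected_semigroup G b .
  show "repelling_closure (Psi ` G) \<subseteq> range ereal"
    unfolding repelling_closure_eq_cap_set[OF dis] by blast
  show "(\<lambda>x. Fin (complex_of_real x)) ` (ereal -` repelling_closure (Psi ` G)) = julia_set (eta ` Psi ` G)"
    unfolding repelling_closure_eq_cap_set[OF dis] julia_eta_eq[OF dis] by (simp add: inj_vimage_image_eq inj_def)
qed

end
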